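(* Let $\Omega\Subset\mathbb{R}^3$ be a bounded domain with $0\in\partial\Omega$, let $M>0$, $0<\alpha<1$, and let $h>0$ be sufficiently small such that $$(B_h\times(-M,M))\cap\Omega=S_h\times(-M,M).$$ For $x_3^c\in(-M,M)$ let $L>0$ be sufficiently small such that $(x_3^c-L,x_3^c+L)\subset(-M,M)$. Let $k\in\mathbb{R}_+$, $q\in L^\infty(S_h\times(-M,M))$, $\eta\in L^\infty(\Gamma_h^\pm\times(-M,M))$, and let $v\in H^2(\Omega)$ and $w\in H^1(\Omega)$ be eigenfunctions (nontrivial solutions) of $$\begin{cases}\Delta v+k^2v=0, & x'\in S_h,\ -M<x_3<M,\\ \Delta w+k^2qw=0, & x'\in S_h,\ -M<x_3<M,\\ w=v,\quad \partial_\nu v+\eta v=\partial_\nu w, & x'\in\Gamma_h^\pm,\ -M<x_3<M.\end{cases}$$ Assume that $qw\in C^\alpha(\overline{S_h}\times[-M,M])$, $\eta\in C^\alpha(\overline{\Gamma_h^\pm}\times[-M,M])$ and $v-w\in H^2(S_h\times(-M,M))$. Assume further that (a) $\eta=\eta(x',x_3)$ is independent of $x_3$ and does not vanish on the edge of $W\times(-M,M)$, i.e. $\eta(0)\neq0$; (b) $-\pi<\theta_m<\theta_M<\pi$ and $\theta_M-\theta_m\neq\pi$. Then $v$ and $w$ vanish at the edge point $(0,x_3^c)\in\mathbb{R}^3$ of $S_h\times(-M,M)$, where $x_3^c\in(-M,M)$.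
   Context: Points of $\mathbb{R}^3$ are written $x=(x',x_3)$ with $x'\in\mathbb{R}^2$; $B_h\subset\mathbb{R}^2$ is the open disc of radius $h$ centered at $0$. The sector is $W=\{x'\in\mathbb{R}^2: x'\neq0,\ \theta_m<\arg(x_1+ix_2)<\theta_M\}$ with $-\pi<\theta_m<\theta_M<\pi$; its boundary rays are $\Gamma^+$ (polar angle $\theta_M$) and $\Gamma^-$ (polar angle $\theta_m$). Set $S_h=W\cap B_h$, $\Gamma_h^\pm=\Gamma^\pm\cap B_h$; $\nu$ is the outward unit normal to $\Gamma_h^\pm\times(-M,M)$. *)

theory Defs
  imports "HOL-Analysis.Analysis"
begin

text \<open>
  Functions are complex-valued. Elements of Lebesgue and Sobolev spaces are represented by
  functions on the whole type, of which only the values almost everywhere on the set in question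
  matter.
\<close>

subsection \<open>Function spaces\<close>

definition L2 :: "'a measure \<Rightarrow> ('a \<Rightarrow> complex) set" where
  "L2 N = {f \<in> borel_measurable N. integrable N (\<lambda>x. (cmod (f x))\<^sup>2)}"

definition Linf :: "'a measure \<Rightarrow> ('a \<Rightarrow> complex) set" where
  "Linf N = {f \<in> borel_measurable N. \<exists>C. AE x in N. cmod (f x) \<le> C}"

definition L2_tendsto :: "'a measure \<Rightarrow> (nat \<Rightarrow> 'a \<Rightarrow> complex) \<Rightarrow> ('a \<Rightarrow> complex) \<Rightarrow> bool" where
  "L2_tendsto N F f \<longleftrightarrow> (\<lambda>n. \<integral>\<^sup>+x. ennreal ((cmod (F n x - f x))\<^sup>2) \<partial>N) \<longlonglongrightarrow> 0"

definition hoelder_on :: "real \<Rightarrow> 'a::metric_space set \<Rightarrow> ('a \<Rightarrow> complex) \<Rightarrow> bool" where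
  "hoelder_on \<alpha> K f \<longleftrightarrow>
     bounded (f ` K) \<and> (\<exists>C. \<forall>x\<in>K. \<forall>y\<in>K. cmod (f x - f y) \<le> C * dist x y powr \<alpha>)"

definition dir_deriv ::
  "'a::euclidean_space \<Rightarrow> ('a \<Rightarrow> 'b::real_normed_vector) \<Rightarrow> 'a \<Rightarrow> 'b" where
  "dir_deriv b f x = frechet_derivative f (at x) b"

primrec Ck :: "nat \<Rightarrow> ('a::euclidean_space \<Rightarrow> 'b::real_normed_vector) \<Rightarrow> bool" where
  "Ck 0 f \<longleftrightarrow> continuous_on UNIV f"
| "Ck (Suc k) f \<longleftrightarrow> f differentiable_on UNIV \<and> (\<forall>b\<in>Basis. Ck k (dir_deriv b f))"

definition smooth :: "('a::euclidean_space \<Rightarrow> 'b::real_normed_vector) \<Rightarrow> bool" where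
  "smooth f \<longleftrightarrow> (\<forall>k. Ck k f)"

definition test_function :: "'a::euclidean_space set \<Rightarrow> ('a \<Rightarrow> real) \<Rightarrow> bool" where
  "test_function D \<phi> \<longleftrightarrow>
     smooth \<phi> \<and> compact (closure {x. \<phi> x \<noteq> 0}) \<and> closure {x. \<phi> x \<noteq> 0} \<subseteq> D"

text \<open>\<open>g\<close> is the weak partial derivative of \<open>u\<close> in direction \<open>b\<close> on the open set \<open>D\<close>, both in
  \<open>L\<^sup>2(D)\<close>.\<close>

definition weak_partial ::
  "'a::euclidean_space set \<Rightarrow> 'a \<Rightarrow> ('a \<Rightarrow> complex) \<Rightarrow> ('a \<Rightarrow> complex) \<Rightarrow> bool" where
  "weak_partial D b u g \<longleftrightarrow>
     u \<in> L2 (lebesgue_on D) \<and> g \<in> L2 (lebesgue_on D) \<and>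
     (\<forall>\<phi>. test_function D \<phi> \<longrightarrow>
        (\<integral>x. dir_deriv b \<phi> x *\<^sub>R u x \<partial>lebesgue_on D) = - (\<integral>x. \<phi> x *\<^sub>R g x \<partial>lebesgue_on D))"

primrec sobolev_H :: "nat \<Rightarrow> 'a::euclidean_space set \<Rightarrow> ('a \<Rightarrow> complex) set" where
  "sobolev_H 0 D = L2 (lebesgue_on D)"
| "sobolev_H (Suc k) D =
     {u \<in> L2 (lebesgue_on D). \<forall>b\<in>Basis. \<exists>g\<in>sobolev_H k D. weak_partial D b u g}"

text \<open>\<open>\<Delta>u = f\<close> on the open set \<open>D\<close> in the sense of distributions.\<close>

definition weak_laplacian ::
  "'a::euclidean_space set \<Rightarrow> ('a \<Rightarrow> complex) \<Rightarrow> ('a \<Rightarrow> complex) \<Rightarrow> bool" where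
  "weak_laplacian D u f \<longleftrightarrow>
     (\<forall>\<phi>. test_function D \<phi> \<longrightarrow>
        (\<integral>x. (\<Sum>b\<in>Basis. dir_deriv b (dir_deriv b \<phi>) x) *\<^sub>R u x \<partial>lebesgue_on D) =
        (\<integral>x. \<phi> x *\<^sub>R f x \<partial>lebesgue_on D))"

subsection \<open>Traces\<close>

text \<open>
  The trace on a boundary portion with surface measure \<open>\<sigma>\<close> of a function \<open>u \<in> H\<^sup>1(D)\<close>: the
  \<open>L\<^sup>2(\<sigma>)\<close>-limit of the restrictions of functions smooth up to the boundary that converge to \<open>u\<close>
  in \<open>H\<^sup>1(D)\<close>. It exists and is unique if \<open>D\<close> is a bounded Lipschitz domain.
\<close>

definition has_trace ::
  "'a::euclidean_space set \<Rightarrow> 'a measure \<Rightarrow> ('a \<Rightarrow> complex) \<Rightarrow> ('a \<Rightarrow> complex) \<Rightarrow> bool" where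
  "has_trace D \<sigma> u g \<longleftrightarrow>
     g \<in> L2 \<sigma> \<and>
     (\<exists>G F. (\<forall>b\<in>Basis. weak_partial D b u (G b)) \<and>
        (\<forall>n. smooth (F n)) \<and>
        L2_tendsto (lebesgue_on D) F u \<and>
        (\<forall>b\<in>Basis. L2_tendsto (lebesgue_on D) (\<lambda>n. dir_deriv b (F n)) (G b)) \<and>
        L2_tendsto \<sigma> F g)"

text \<open>The normal derivative \<open>\<nu> \<bullet> \<nabla>u\<close> of \<open>u \<in> H\<^sup>2(D)\<close> on a flat boundary portion with constant
  normal \<open>\<nu>\<close>, formed from the traces of the weak partial derivatives.\<close>

definition has_normal_trace ::
  "'a::euclidean_space set \<Rightarrow> 'a measure \<Rightarrow> 'a \<Rightarrow> ('a \<Rightarrow> complex) \<Rightarrow> ('a \<Rightarrow> complex) \<Rightarrow> bool" where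
  "has_normal_trace D \<sigma> \<nu> u g \<longleftrightarrow>
     (\<exists>G T. (\<forall>b\<in>Basis. weak_partial D b u (G b) \<and> has_trace D \<sigma> (G b) (T b)) \<and>
        (AE x in \<sigma>. g x = (\<Sum>b\<in>Basis. (\<nu> \<bullet> b) *\<^sub>R T b x)))"

text \<open>\<open>w = v\<close> and \<open>\<partial>\<^sub>\<nu>v + \<eta>v = \<partial>\<^sub>\<nu>w\<close> on the boundary portion, in the sense of traces.\<close>

definition conductive_bc ::
  "'a::euclidean_space set \<Rightarrow> 'a measure \<Rightarrow> 'a \<Rightarrow> ('a \<Rightarrow> complex) \<Rightarrow>
     ('a \<Rightarrow> complex) \<Rightarrow> ('a \<Rightarrow> complex) \<Rightarrow> bool" where
  "conductive_bc D \<sigma> \<nu> \<eta> v w \<longleftrightarrow>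
     (\<exists>tv tw dv dw.
        has_trace D \<sigma> v tv \<and> has_trace D \<sigma> w tw \<and>
        has_normal_trace D \<sigma> \<nu> v dv \<and> has_normal_trace D \<sigma> \<nu> w dw \<and>
        (AE x in \<sigma>. tw x = tv x) \<and> (AE x in \<sigma>. dv x + \<eta> x * tv x = dw x))"

text \<open>\<open>u\<close> vanishes at the boundary point \<open>p\<close> of \<open>D\<close>: it has a representative that is continuous
  on \<open>D\<close> and up to \<open>p\<close>, with value \<open>0\<close> at \<open>p\<close>. For \<open>p \<in> closure D\<close>, \<open>D\<close> open, that value does
  not depend on the representative.\<close>

definition vanishes_at :: "'a::euclidean_space set \<Rightarrow> ('a \<Rightarrow> complex) \<Rightarrow> 'a \<Rightarrow> bool" where
  "vanishes_at D u p \<longleftrightarrow>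
     (\<exists>U. continuous_on (insert p D) U \<and> (AE x in lebesgue_on D. u x = U x) \<and> U p = 0)"

subsection \<open>The sector and its edge\<close>

type_synonym space = "(real^2) \<times> real"

definition polar_angle :: "real^2 \<Rightarrow> real" where
  "polar_angle y = Arg (Complex (y $ 1) (y $ 2))"

definition sector :: "real \<Rightarrow> real \<Rightarrow> (real^2) set" where
  "sector \<theta>m \<theta>M = {y. y \<noteq> 0 \<and> \<theta>m < polar_angle y \<and> polar_angle y < \<theta>M}"

definition ray :: "real \<Rightarrow> (real^2) set" where
  "ray \<theta> = {y. y \<noteq> 0 \<and> polar_angle y = \<theta>}"

definition Sh :: "real \<Rightarrow> real \<Rightarrow> real \<Rightarrow> (real^2) set" where
  "Sh \<theta>m \<theta>M h = sector \<theta>m \<theta>M \<inter> ball 0 h"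

definition \<Gamma>h :: "real \<Rightarrow> real \<Rightarrow> (real^2) set" where
  "\<Gamma>h \<theta> h = ray \<theta> \<inter> ball 0 h"

text \<open>Surface measure on the face \<open>\<Gamma>h \<theta> h \<times> (-M,M)\<close>, as the image of Lebesgue measure under the
  isometric parametrisation by \<open>(r, x\<^sub>3)\<close>.\<close>

definition face_measure :: "real \<Rightarrow> real \<Rightarrow> real \<Rightarrow> space measure" where
  "face_measure \<theta> h M =
     distr (lebesgue_on ({0<..<h} \<times> {-M<..<M})) (restrict_space borel (\<Gamma>h \<theta> h \<times> {-M<..<M}))
       (\<lambda>(r, t). (r *\<^sub>R vector [cos \<theta>, sin \<theta>], t))"

text \<open>Outward unit normals of the sector cylinder: on the face at \<open>\<theta>M\<close> the outward direction is
  that of increasing polar angle, on the face at \<open>\<theta>m\<close> that of decreasing polar angle.\<close>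

definition normal_upper :: "real \<Rightarrow> space" where
  "normal_upper \<theta>M = (vector [- sin \<theta>M, cos \<theta>M], 0)"

definition normal_lower :: "real \<Rightarrow> space" where
  "normal_lower \<theta>m = (vector [sin \<theta>m, - cos \<theta>m], 0)"

end

theory Submission
  imports Defs
begin

text \<open>
  Put \<open>u = v - w\<close>, so that \<open>u \<in> H\<^sup>2\<close> vanishes on both faces and its outward normal derivative there
  is \<open>- \<eta> v\<close>. Hence the tangential derivatives of \<open>u\<close> vanish on the
  faces, and the \<open>H\<^sup>1\<close> function \<open>\<partial>\<^sub>\<xi> u\<close> has traces \<open>(\<xi> \<bullet> \<nu>\<^sup>+) g\<close> and \<open>(\<xi> \<bullet> \<nu>\<^sup>-) g\<close> with
  \<open>g = - \<eta> v\<close>. In two dimensions an \<open>H\<^sup>1\<close> function cannot jump across a corner: averaging \<open>\<partial>\<^sub>\<xi> u\<close> against a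
  kernel of size \<open>r\<close> transversally to the edge changes its value, relative to either face trace, by
  at most the \<open>L\<^sup>2\<close> norm of its gradient on a region shrinking to the edge, which tends to 0.
  Since functions in \<open>H\<^sup>2\<close> are continuous up to the edge in dimension 3 and \<open>\<eta>\<close> is continuous,
  \<open>(\<xi> \<bullet> \<nu>\<^sup>+) \<eta> v = (\<xi> \<bullet> \<nu>\<^sup>-) \<eta> v\<close> at the edge point. For \<open>\<xi> = \<nu>\<^sup>+ - \<nu>\<^sup>-\<close> the two factors differ by
  \<open>\<bar>\<xi>\<bar>\<^sup>2\<close>, which is nonzero because the opening angle is not \<open>\<pi>\<close>, so \<open>v = 0\<close>; and \<open>u = 0\<close> gives \<open>w = 0\<close>.
\<close>

text \<open>Traces are only \<open>L2\<close> limits, so nothing is evaluated pointwise on a face.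
  All face information goes through \<open>trace_estimate\<close>: for a kernel K bounded by C and
  supported in a slab of depth B over the face, the volume integral of K f and the face integral of
  K times the trace differ by at most C B times the \<open>L1\<close> norm over the slab of one
  fixed \<open>L2\<close> function. Kernels shrink by r only transversally to the edge, so their
  mass and the slab volumes are of order \<open>r^2\<close>. Cauchy-Schwarz makes the
  \<open>L1\<close> norm o(r), the depth supplies another r, and the error o(\<open>r^2\<close>) is
  just negligible against the mass. The same kernels must serve both faces. A perpendicular to one
  face that starts near the edge can leave a narrow sector, so slabs are swept in oblique directions
  close to the bisector. The quantity compared is the integral of u against the \<xi>-derivative of
  the kernel: it does not mention the weak derivatives that the two boundary conditions supply
  separately. Continuity up to the edge is obtained by averaging over cubes displaced into the
  region, so no extension across the boundary is needed.\<close>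

section \<open>Smooth functions and test functions\<close>

lemma dir_deriv_eq:
  assumes "(f has_derivative f') (at x)"
  shows "dir_deriv b f x = f' b"
  using frechet_derivative_at[OF assms] by (simp add: dir_deriv_def)

lemma differentiable_has_dir_deriv:
  "f differentiable at x \<Longrightarrow> (f has_derivative (\<lambda>\<xi>. dir_deriv \<xi> f x)) (at x)"
  by (simp add: dir_deriv_def frechet_derivative_works)

lemma Ck_SucD: "Ck (Suc k) f \<Longrightarrow> Ck k f"
proof (induction k arbitrary: f)
  case 0
  then show ?case by (simp add: differentiable_imp_continuous_on)
next
  case (Suc k)
  then show ?case by (metis Ck.simps(2))
qed

lemma Ck_const: "Ck k (\<lambda>x. c)"
proof (induction k arbitrary: c)
  case (Suc k)
  have "dir_deriv b (\<lambda>x::'a. c) = (\<lambda>x. 0)" for b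
    by (simp add: dir_deriv_def fun_eq_iff)
  then show ?case using Suc by simp
qed simp

lemma Ck_add:
  assumes "Ck k f" "Ck k g"
  shows "Ck k (\<lambda>x. f x + g x)"
  using assms
proof (induction k arbitrary: f g)
  case 0
  then show ?case by (simp add: continuous_on_add)
next
  case (Suc k)
  have d: "f differentiable at x" "g differentiable at x" for x
    using Suc.prems by (auto simp: differentiable_on_def)
  have "dir_deriv b (\<lambda>x. f x + g x) = (\<lambda>x. dir_deriv b f x + dir_deriv b g x)" for b
    by (auto simp: fun_eq_iff intro!: dir_deriv_eq derivative_eq_intros differentiable_has_dir_deriv d)
  then show ?case using Suc by simp
qed

lemma Ck_mult:
  fixes f g :: "'a::euclidean_space \<Rightarrow> real"
  assumes "Ck k f" "Ck k g"
  shows "Ck k (\<lambda>x. f x * g x)"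
  using assms
proof (induction k arbitrary: f g)
  case 0
  then show ?case by (simp add: continuous_on_mult)
next
  case (Suc k)
  have d: "f differentiable at x" "g differentiable at x" for x
    using Suc.prems by (auto simp: differentiable_on_def)
  have "dir_deriv b (\<lambda>x. f x * g x) = (\<lambda>x. f x * dir_deriv b g x + dir_deriv b f x * g x)" for b
    by (auto simp: fun_eq_iff intro!: dir_deriv_eq derivative_eq_intros differentiable_has_dir_deriv d)
  then show ?case
    using Suc Ck_SucD[OF Suc.prems(1)] Ck_SucD[OF Suc.prems(2)]
    by (auto intro!: Ck_add Suc.IH differentiable_on_mult)
qed

lemma Ck_linear:
  assumes "bounded_linear f"
  shows "Ck k f"
proof (cases k)
  case 0
  then show ?thesis using assms by (simp add: linear_continuous_on)
next
  case (Suc n)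
  have "dir_deriv b f = (\<lambda>x. f b)" for b
    using dir_deriv_eq[OF bounded_linear_imp_has_derivative[OF assms]] by blast
  then show ?thesis
    using Suc bounded_linear_imp_differentiable_on[OF assms] by (simp add: Ck_const)
qed

lemma dir_deriv_compose:
  fixes f :: "'a::euclidean_space \<Rightarrow> real" and G :: "real \<Rightarrow> real"
  assumes "f differentiable at x" "G differentiable at (f x)"
  shows "dir_deriv b (\<lambda>x. G (f x)) x = dir_deriv 1 G (f x) * dir_deriv b f x"
proof -
  have "frechet_derivative (G \<circ> f) (at x) = frechet_derivative G (at (f x)) \<circ> frechet_derivative f (at x)"
    using assms by (intro frechet_derivative_compose) auto
  moreover have "frechet_derivative G (at (f x)) c = c * frechet_derivative G (at (f x)) 1" for c
    using linear_cmul[OF linear_frechet_derivative[OF assms(2)], of c 1] by simp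
  ultimately show ?thesis
    unfolding dir_deriv_def comp_def by (metis mult.commute)
qed

lemma Ck_compose:
  fixes f :: "'a::euclidean_space \<Rightarrow> real" and G :: "real \<Rightarrow> real"
  assumes "Ck k f" "Ck k G"
  shows "Ck k (\<lambda>x. G (f x))"
  using assms
proof (induction k arbitrary: G)
  case 0
  then show ?case by (auto intro: continuous_on_compose2)
next
  case (Suc k)
  have d: "f differentiable at x" "G differentiable at y" for x y
    using Suc.prems by (auto simp: differentiable_on_def)
  have "dir_deriv b (\<lambda>x. G (f x)) = (\<lambda>x. dir_deriv 1 G (f x) * dir_deriv b f x)" for b
    using d by (simp add: dir_deriv_compose fun_eq_iff)
  moreover have "(\<lambda>x. G (f x)) differentiable at x" for x
    using differentiable_chain_at[OF d(1) d(2)] by (simp add: comp_def)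
  ultimately show ?case
    using Suc Ck_SucD[OF Suc.prems(1)]
    by (auto intro!: Ck_mult simp: differentiable_on_def differentiable_at_withinI)
qed

lemma dir_deriv_real_eq:
  fixes f :: "real \<Rightarrow> real"
  assumes "(f has_real_derivative D) (at x)"
  shows "dir_deriv 1 f x = D"
  using dir_deriv_eq[OF assms[unfolded has_field_derivative_def], of 1] by simp

lemma Ck_Suc_realI:
  fixes f :: "real \<Rightarrow> real"
  assumes "\<And>x. (f has_real_derivative f' x) (at x)" "Ck k f'"
  shows "Ck (Suc k) f"
proof -
  have "dir_deriv 1 f = f'"
    using dir_deriv_real_eq[OF assms(1)] by (simp add: fun_eq_iff)
  moreover have "f differentiable at x" for x
    using assms(1) real_differentiable_def by blast
  ultimately show ?thesis
    using assms(2) by (simp add: differentiable_on_def differentiable_at_withinI)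
qed

lemma Ck_inverse:
  fixes f :: "'a::euclidean_space \<Rightarrow> real"
  assumes "Ck k f" "\<And>x. f x \<noteq> 0"
  shows "Ck k (\<lambda>x. inverse (f x))"
  using assms(1)
proof (induction k)
  case 0
  then show ?case using assms(2) by (auto intro!: continuous_intros)
next
  case (Suc k)
  have d: "(f has_derivative frechet_derivative f (at x)) (at x)" for x
    using Suc.prems by (auto simp: differentiable_on_def frechet_derivative_works)
  have i: "((\<lambda>x. inverse (f x)) has_derivative
      (\<lambda>h. - (inverse (f x) * frechet_derivative f (at x) h * inverse (f x)))) (at x)" for x
    using d assms(2) by (auto intro!: derivative_eq_intros)
  have "dir_deriv b (\<lambda>x. inverse (f x)) = (\<lambda>x. (-1) * (inverse (f x) * dir_deriv b f x * inverse (f x)))" for b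
    using dir_deriv_eq[OF i] by (simp add: dir_deriv_def fun_eq_iff)
  moreover have "Ck k (\<lambda>x. (-1) * (inverse (f x) * dir_deriv b f x * inverse (f x)))" if "b \<in> Basis" for b
    using Suc Ck_SucD[OF Suc.prems] that by (intro Ck_mult Ck_const) auto
  moreover have "(\<lambda>x. inverse (f x)) differentiable at x" for x
    using i by (auto simp: differentiable_def)
  ultimately show ?case
    by (simp add: differentiable_on_def differentiable_at_withinI)
qed

text \<open>\<open>Ck\<close> controls basis directions only; the directions of the rays and \<xi>
  are reached by linearity of the derivative.\<close>

lemma Ck_dir_deriv:
  fixes f :: "'a::euclidean_space \<Rightarrow> real"
  assumes "Ck (Suc k) f"
  shows "Ck k (dir_deriv \<xi> f)"
proof -
  have l: "linear (frechet_derivative f (at x))" for x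
    using assms by (auto simp: differentiable_on_def linear_frechet_derivative)
  have "dir_deriv \<xi> f x = (\<Sum>b\<in>Basis. (\<xi> \<bullet> b) * dir_deriv b f x)" for x
    using l[of x] by (simp add: dir_deriv_def) (subst euclidean_representation[of \<xi>, symmetric],
      simp add: linear_sum linear_cmul)
  then have *: "dir_deriv \<xi> f = (\<lambda>x. \<Sum>b\<in>Basis. (\<xi> \<bullet> b) * dir_deriv b f x)" by blast
  have "Ck k (\<lambda>x. \<Sum>b\<in>B. (\<xi> \<bullet> b) * dir_deriv b f x)" if "B \<subseteq> Basis" for B
    using finite_subset[OF that finite_Basis] that
    by (induction B) (use assms in \<open>auto intro!: Ck_const Ck_add Ck_mult\<close>)
  then show ?thesis unfolding * by blast
qed

lemma
  fixes f g :: "'a::euclidean_space \<Rightarrow> real" and G :: "real \<Rightarrow> real"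
  shows smooth_const: "smooth (\<lambda>x::'a. c::real)"
    and smooth_add: "smooth f \<Longrightarrow> smooth g \<Longrightarrow> smooth (\<lambda>x. f x + g x)"
    and smooth_mult: "smooth f \<Longrightarrow> smooth g \<Longrightarrow> smooth (\<lambda>x. f x * g x)"
    and smooth_compose: "smooth f \<Longrightarrow> smooth G \<Longrightarrow> smooth (\<lambda>x. G (f x))"
    and smooth_linear: "bounded_linear f \<Longrightarrow> smooth f"
    and smooth_dir_deriv: "smooth f \<Longrightarrow> smooth (dir_deriv \<xi> f)"
  by (simp_all add: smooth_def Ck_const Ck_add Ck_mult Ck_compose Ck_linear Ck_dir_deriv)

lemma smooth_differentiable: "smooth f \<Longrightarrow> f differentiable at x"
  using Ck.simps(2)[of 0 f] by (auto simp: smooth_def differentiable_on_def)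

lemma smooth_has_derivative:
  "smooth f \<Longrightarrow> (f has_derivative (\<lambda>\<xi>. dir_deriv \<xi> f x)) (at x)"
  by (intro differentiable_has_dir_deriv smooth_differentiable)

lemma smooth_continuous_on: "smooth f \<Longrightarrow> continuous_on S f"
  unfolding smooth_def by (metis Ck.simps(1) continuous_on_subset subset_UNIV)

lemma smooth_dir_deriv_continuous_on:
  assumes "smooth f" "b \<in> Basis"
  shows "continuous_on S (dir_deriv b f)"
  using assms unfolding smooth_def
  by (metis Ck.simps continuous_on_subset subset_UNIV)

lemma smooth_real_deriv:
  fixes f :: "real \<Rightarrow> real"
  assumes "smooth f"
  shows "(f has_real_derivative dir_deriv 1 f x) (at x)"
  using smooth_differentiable[OF assms, of x] dir_deriv_real_eq real_differentiable_def by blast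

lemma dir_deriv_sum_Basis:
  assumes "f differentiable at x"
  shows "dir_deriv \<xi> f x = (\<Sum>b\<in>Basis. (\<xi> \<bullet> b) *\<^sub>R dir_deriv b f x)"
  using linear_frechet_derivative[OF assms]
  by (simp add: dir_deriv_def) (subst euclidean_representation[of \<xi>, symmetric],
    simp add: linear_sum linear_cmul)

subsection \<open>A smooth step\<close>

text \<open>The powers of 1/x are carried along because this family, unlike exp(-1/x) alone, is
  closed under differentiation up to linear combinations. Smoothness then is one induction over all
  n at once.\<close>

definition flat_exp :: "nat \<Rightarrow> real \<Rightarrow> real" where
  "flat_exp n x = (if x > 0 then inverse x ^ n * exp (- inverse x) else 0)"

lemma flat_exp_deriv:
  "(flat_exp n has_real_derivative (- real n) * flat_exp (Suc n) x + flat_exp (n + 2) x) (at x)"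
proof -
  consider "x > 0" | "x < 0" | "x = 0" by linarith
  then show ?thesis
  proof cases
    case 1
    have "real n * inverse x ^ (n - Suc 0) * inverse x = real n * inverse x ^ n"
      by (cases n) auto
    then have "((\<lambda>x. inverse x ^ n * exp (- inverse x)) has_real_derivative
        (- real n) * flat_exp (Suc n) x + flat_exp (n + 2) x) (at x)"
      using 1
      by (auto intro!: derivative_eq_intros simp: flat_exp_def power2_eq_square algebra_simps)
    then show ?thesis
      by (rule DERIV_cong_ev[OF refl _ refl, THEN iffD1, rotated])
        (use 1 in \<open>auto simp: flat_exp_def intro!: eventually_mono[OF eventually_nhds_in_open[of "{0<..}"]]\<close>)
  next
    case 2
    have "((\<lambda>x. 0) has_real_derivative
        (- real n) * flat_exp (Suc n) x + flat_exp (n + 2) x) (at x)"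
      using 2 by (auto simp: flat_exp_def)
    then show ?thesis
      by (rule DERIV_cong_ev[OF refl _ refl, THEN iffD1, rotated])
        (use 2 in \<open>auto simp: flat_exp_def intro!: eventually_mono[OF eventually_nhds_in_open[of "{..<0}"]]\<close>)
  next
    case 3
    \<comment> \<open>With y replaced by 1/y this is the right difference quotient at 0, whose
      division by y raises the power from n to \<open>Suc n\<close>.\<close>
    have "((\<lambda>y::real. y ^ Suc n / exp y) \<longlongrightarrow> 0) at_top"
      by (rule tendsto_power_div_exp_0)
    then have "((\<lambda>y. inverse y ^ Suc n / exp (inverse y)) \<longlongrightarrow> 0) (at_right (0::real))"
      by (rule filterlim_compose) (rule filterlim_inverse_at_top_right)
    then have "((\<lambda>y. (flat_exp n y - flat_exp n 0) / (y - 0)) \<longlongrightarrow> 0) (at_right 0)"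
      by (rule Lim_transform_eventually)
        (auto simp: flat_exp_def eventually_at_right_less exp_minus field_simps
          intro!: eventually_mono[OF eventually_at_right_less])
    moreover have "((\<lambda>y. (flat_exp n y - flat_exp n 0) / (y - 0)) \<longlongrightarrow> 0) (at_left 0)"
      by (rule Lim_transform_eventually[OF tendsto_const])
        (auto simp: flat_exp_def eventually_at_left_field intro!: exI[of _ "-1"])
    ultimately have "((\<lambda>y. (flat_exp n y - flat_exp n 0) / (y - 0)) \<longlongrightarrow> 0) (at 0)"
      by (rule filterlim_split_at[rotated])
    then show ?thesis
      using 3 by (simp add: has_field_derivative_iff flat_exp_def)
  qed
qed

lemma smooth_flat_exp: "smooth (flat_exp n)"
proof -
  have "Ck k (flat_exp n)" for k
  proof (induction k arbitrary: n)
    case 0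
    show ?case
      using DERIV_continuous_on[OF has_field_derivative_at_within[OF flat_exp_deriv]] by simp
  next
    case (Suc k)
    show ?case
      by (rule Ck_Suc_realI[OF flat_exp_deriv]) (intro Ck_add Ck_mult Ck_const Suc)
  qed
  then show ?thesis by (simp add: smooth_def)
qed

lemma smooth_step_exists:
  fixes a b :: real
  assumes "a < b"
  obtains H where "smooth H" "\<And>x. x \<le> a \<Longrightarrow> H x = 0" "\<And>x. x \<ge> b \<Longrightarrow> H x = (1::real)"
    "\<And>x. a < x \<Longrightarrow> x < b \<Longrightarrow> 0 < H x \<and> H x < 1"
proof -
  let ?f = "flat_exp 0"
  \<comment> \<open>The denominator is positive because a < b forces one of x > a and x < b.
    Differences are spelled as sums and products so that the closure rules for \<open>smooth\<close>
    match.\<close>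
  define H where "H = (\<lambda>x. ?f (x + (-a)) * inverse (?f (x + (-a)) + ?f (b + (-1) * x)))"
  have s1: "smooth (\<lambda>x. ?f (x + (-a)))"
    by (intro smooth_compose[OF smooth_add smooth_flat_exp] smooth_const smooth_linear bounded_linear_ident)
  have s2: "smooth (\<lambda>x. ?f (b + (-1) * x))"
    by (intro smooth_compose[OF smooth_add smooth_flat_exp] smooth_const smooth_mult smooth_linear bounded_linear_ident)
  have pos: "?f (x + (-a)) + ?f (b + (-1) * x) > 0" for x
    using assms by (auto simp: flat_exp_def add_pos_pos)
  have "smooth H"
    unfolding H_def
    using s1 smooth_add[OF s1 s2] pos[THEN less_imp_neq] unfolding smooth_def
    by (auto intro!: Ck_mult Ck_inverse simp: order_less_imp_not_eq2)
  moreover have "H x = 0" if "x \<le> a" for x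
    using that by (simp add: H_def flat_exp_def)
  moreover have "H x = 1" if "x \<ge> b" for x
    using that assms by (simp add: H_def flat_exp_def)
  moreover have "0 < H x \<and> H x < 1" if "a < x" "x < b" for x
    using that unfolding H_def by (simp add: flat_exp_def divide_inverse[symmetric] add_pos_pos)
  ultimately show ?thesis using that by blast
qed

lemma dir_deriv_transform:
  assumes "open S" "x \<in> S" "\<And>y. y \<in> S \<Longrightarrow> f y = g y" "f differentiable at x"
  shows "dir_deriv b f x = dir_deriv b g x"
  using frechet_derivative_transform_within_open[OF assms(4,1,2,3)] by (simp add: dir_deriv_def)

text \<open>The chain rule turns the basis direction b into L b, which need not be a basis vector;
  the induction therefore rests on \<open>Ck_dir_deriv\<close>.\<close>

lemma smooth_compose_linear:
  fixes f :: "'b::euclidean_space \<Rightarrow> real" and L :: "'a::euclidean_space \<Rightarrow> 'b"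
  assumes "smooth f" "bounded_linear L"
  shows "smooth (\<lambda>x. f (L x))" and "dir_deriv \<xi> (\<lambda>x. f (L x)) x = dir_deriv (L \<xi>) f (L x)"
proof -
  have der: "((\<lambda>x. f (L x)) has_derivative (\<lambda>\<xi>. dir_deriv (L \<xi>) f (L x))) (at x)"
    if "f differentiable at (L x)" for x and f :: "'b \<Rightarrow> real"
    using diff_chain_at[OF bounded_linear_imp_has_derivative[OF assms(2)] differentiable_has_dir_deriv[OF that]]
    by (simp add: comp_def)
  show "dir_deriv \<xi> (\<lambda>x. f (L x)) x = dir_deriv (L \<xi>) f (L x)"
    using der[OF smooth_differentiable[OF assms(1)]] by (rule dir_deriv_eq)
  have "Ck k (\<lambda>x. f (L x))" if "Ck k f" for k and f :: "'b \<Rightarrow> real"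
    using that
  proof (induction k arbitrary: f)
    case 0
    then show ?case
      using linear_continuous_on[OF assms(2)] by (auto intro: continuous_on_compose2)
  next
    case (Suc k)
    have d: "f differentiable at y" for y
      using Suc.prems by (auto simp: differentiable_on_def)
    have "dir_deriv b (\<lambda>x. f (L x)) = (\<lambda>x. dir_deriv (L b) f (L x))" for b
      using dir_deriv_eq[OF der[OF d]] by blast
    moreover have "Ck k (\<lambda>x. dir_deriv (L b) f (L x))" for b
      by (rule Suc.IH[OF Ck_dir_deriv[OF Suc.prems]])
    moreover have "(\<lambda>x. f (L x)) differentiable_on UNIV"
      using der[OF d] by (auto simp: differentiable_on_def differentiable_def)
    ultimately show ?case by simp
  qed
  then show "smooth (\<lambda>x. f (L x))"
    using assms(1) by (simp add: smooth_def)
qed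

lemma smooth_real_affine:
  assumes "smooth (f :: real \<Rightarrow> real)"
  shows "smooth (\<lambda>x. c * f ((x - a) / r))"
    and "dir_deriv 1 (\<lambda>x. c * f ((x - a) / r)) = (\<lambda>x. (c / r) * dir_deriv 1 f ((x - a) / r))"
proof -
  have "smooth (\<lambda>x. (1 / r) * x + (- a / r))"
    by (intro smooth_add smooth_const smooth_mult smooth_linear bounded_linear_ident)
  moreover have "(\<lambda>x. (1 / r) * x + (- a / r)) = (\<lambda>x. (x - a) / r)"
    by (simp add: fun_eq_iff diff_divide_distrib)
  ultimately have "smooth (\<lambda>x. (x - a) / r)"
    by metis
  then show "smooth (\<lambda>x. c * f ((x - a) / r))"
    by (rule smooth_mult[OF smooth_const smooth_compose[OF _ assms]])
  have "((\<lambda>x. c * f ((x - a) / r)) has_real_derivative (c / r) * dir_deriv 1 f ((x - a) / r)) (at x)" for x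
  proof -
    have "((\<lambda>x. (x - a) / r) has_real_derivative 1 / r) (at x)"
      by (intro DERIV_cdivide derivative_eq_intros) auto
    from DERIV_cmult[OF DERIV_chain2[OF smooth_real_deriv[OF assms] this], of c] show ?thesis
      by (simp add: mult.commute)
  qed
  then show "dir_deriv 1 (\<lambda>x. c * f ((x - a) / r)) = (\<lambda>x. (c / r) * dir_deriv 1 f ((x - a) / r))"
    using dir_deriv_real_eq by blast
qed

lemma dir_deriv_real_diff:
  fixes f g :: "real \<Rightarrow> real"
  assumes "smooth f" "smooth g"
  shows "dir_deriv 1 (\<lambda>x. f x - g x) = (\<lambda>x. dir_deriv 1 f x - dir_deriv 1 g x)"
  using DERIV_diff[OF smooth_real_deriv[OF assms(1)] smooth_real_deriv[OF assms(2)]]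
    dir_deriv_real_eq by blast

text \<open>The averaging kernel \<open>b\<close> has mass 1 and vanishing first moment, which makes the difference of
  two of its rescalings a second derivative of a compactly supported function. It is found as
  \<open>\<theta>''\<close> with \<open>\<theta> y = 0\<close> to the left and \<open>\<theta> y = y\<close> to the right of an interval.\<close>

lemma averaging_kernel_exists:
  fixes c s l :: real
  assumes l: "0 < l" "l < 1" and s: "0 < s" "(1 - l) * (\<bar>c\<bar> + s) \<le> s / 2"
  obtains b \<beta> :: "real \<Rightarrow> real" where "smooth b" "smooth \<beta>"
    "\<And>x. \<bar>x - c\<bar> > s \<Longrightarrow> b x = 0" "\<And>x. \<bar>x - c\<bar> > s \<Longrightarrow> b (x / l) = 0"
    "\<And>x. \<bar>x - c\<bar> > s \<Longrightarrow> \<beta> x = 0" "integral\<^sup>L lborel b = 1"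
    "\<And>y. dir_deriv 1 (dir_deriv 1 \<beta>) y = b (y / l) / l - b y"
proof -
  have lt: "c - s/2 < c + s/2" using s(1) by simp
  obtain H where H: "smooth H" "\<And>x. x \<le> c - s/2 \<Longrightarrow> H x = 0" "\<And>x. x \<ge> c + s/2 \<Longrightarrow> H x = (1::real)"
    using smooth_step_exists[OF lt] by metis
  define \<theta> where "\<theta> = (\<lambda>x. x * H x)"
  have \<theta>: "smooth \<theta>"
    unfolding \<theta>_def by (rule smooth_mult[OF smooth_linear[OF bounded_linear_ident] H(1)])
  define b where "b = dir_deriv 1 (dir_deriv 1 \<theta>)"
  have \<theta>1: "smooth (dir_deriv 1 \<theta>)" and b: "smooth b"
    unfolding b_def by (intro smooth_dir_deriv \<theta>)+
  have lo1: "dir_deriv 1 \<theta> x = 0" if "x < c - s/2" for x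
  proof -
    have "dir_deriv 1 \<theta> x = dir_deriv 1 (\<lambda>x. 0) x"
      using that H(2) by (intro dir_deriv_transform[of "{..<c - s/2}"] smooth_differentiable \<theta>) (auto simp: \<theta>_def)
    then show ?thesis using dir_deriv_real_eq[OF DERIV_const] by metis
  qed
  have hi1: "dir_deriv 1 \<theta> x = 1" if "x > c + s/2" for x
  proof -
    have "dir_deriv 1 \<theta> x = dir_deriv 1 (\<lambda>x. x) x"
      using that H(3) by (intro dir_deriv_transform[of "{c + s/2<..}"] smooth_differentiable \<theta>) (auto simp: \<theta>_def)
    then show ?thesis using dir_deriv_real_eq[OF DERIV_ident] by metis
  qed
  have lo2: "b x = 0" if "x < c - s/2" for x
  proof -
    have "b x = dir_deriv 1 (\<lambda>x. 0) x"
      unfolding b_def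
      using that lo1 by (intro dir_deriv_transform[of "{..<c - s/2}"] smooth_differentiable \<theta>1) auto
    then show ?thesis using dir_deriv_real_eq[OF DERIV_const] by metis
  qed
  have hi2: "b x = 0" if "x > c + s/2" for x
  proof -
    have "b x = dir_deriv 1 (\<lambda>x. 1) x"
      unfolding b_def
      using that hi1 by (intro dir_deriv_transform[of "{c + s/2<..}"] smooth_differentiable \<theta>1) auto
    then show ?thesis using dir_deriv_real_eq[OF DERIV_const] by metis
  qed
  \<comment> \<open>Left of both transition intervals both terms vanish, right of them both equal x,
    so their difference has compact support. The trivial shift and factor bring it into the form of
    \<open>smooth_real_affine\<close>.\<close>
  define \<beta> where "\<beta> = (\<lambda>x. l * \<theta> ((x - 0) / l) - 1 * \<theta> ((x - 0) / 1))"
  have sub: "smooth (\<lambda>x. f x - g x)" if "smooth f" "smooth g" for f g :: "real \<Rightarrow> real"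
    using smooth_add[OF that(1) smooth_mult[OF smooth_const[of "-1"] that(2)]] by simp
  have \<beta>: "smooth \<beta>"
    unfolding \<beta>_def by (intro sub smooth_real_affine \<theta>)
  have \<beta>1: "dir_deriv 1 \<beta> = (\<lambda>x. 1 * dir_deriv 1 \<theta> ((x - 0) / l) - 1 * dir_deriv 1 \<theta> ((x - 0) / 1))"
    unfolding \<beta>_def using l
    by (subst dir_deriv_real_diff) (simp_all only: smooth_real_affine \<theta> divide_self_if, auto)
  have \<beta>2: "dir_deriv 1 (dir_deriv 1 \<beta>) = (\<lambda>x. b (x / l) / l - b x)"
    unfolding \<beta>1 b_def using l
    by (subst dir_deriv_real_diff) (simp_all only: smooth_real_affine \<theta>1, auto)
  \<comment> \<open>The transition interval has half-width s/2 only. The remaining margin s/2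
    absorbs the dilation by l, which is what the assumption on (1 - l) says: x and x / l lie on the
    same side.\<close>
  have scale: "(x / l < c - s/2 \<and> x < c - s/2) \<or> (x / l > c + s/2 \<and> x > c + s/2)" if "\<bar>x - c\<bar> > s" for x
  proof -
    have "\<bar>(1 - l) * c\<bar> + (1 - l) * s \<le> s/2"
      using s(2) l abs_mult[of "1 - l" c] by (simp add: distrib_left)
    moreover have "(1 - l) * s > 0" using l s(1) by simp
    ultimately have *: "c - s \<le> l * (c - s/2)" "l * (c + s/2) \<le> c + s"
      unfolding left_diff_distrib right_diff_distrib distrib_left
      using s(1) by (simp_all add: abs_le_iff; linarith)+
    from that consider "x < c - s" | "x > c + s" by linarith
    then show ?thesis
    proof cases
      case 1
      then have "x < l * (c - s/2)" "x < c - s/2" using * s(1) by linarith+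
      then show ?thesis using l(1) by (simp add: pos_divide_less_eq mult.commute)
    next
      case 2
      then have "x > l * (c + s/2)" "x > c + s/2" using * s(1) by linarith+
      then show ?thesis using l(1) by (simp add: pos_less_divide_eq mult.commute)
    qed
  qed
  \<comment> \<open>b is the derivative of \<theta>', which rises from 0 to 1.\<close>
  have int: "integral\<^sup>L lborel b = 1"
  proof -
    let ?m = "c - s" and ?M = "c + s"
    have "(\<integral>x. b x * indicator {?m..?M} x \<partial>lborel) = dir_deriv 1 \<theta> ?M - dir_deriv 1 \<theta> ?m"
    proof (rule integral_FTC_Icc_real)
      show "?m \<le> ?M" using s by simp
      show "DERIV (dir_deriv 1 \<theta>) x :> b x" for x
        unfolding b_def by (rule smooth_real_deriv[OF \<theta>1])
      show "isCont b x" for x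
        using smooth_continuous_on[OF b, of UNIV] by (simp add: continuous_on_eq_continuous_at)
    qed
    moreover have "(\<lambda>x. b x * indicator {?m..?M} x) = b"
    proof
      fix x show "b x * indicator {?m..?M} x = b x"
        using lo2[of x] hi2[of x] s(1) by (cases "x < c - s/2"; cases "x > c + s/2") (auto simp: indicator_def)
    qed
    ultimately show ?thesis using lo1 hi1 s(1) by simp
  qed
  show ?thesis
  proof (rule that[OF b \<beta> _ _ _ int])
    fix x assume "\<bar>x - c\<bar> > s"
    from scale[OF this] show "b x = 0" "b (x / l) = 0" "\<beta> x = 0"
      using lo2 hi2 l by (auto simp: \<beta>_def \<theta>_def H)
  qed (simp add: \<beta>2)
qed

subsection \<open>Tensor products\<close>

definition tensor :: "(real \<Rightarrow> real) \<Rightarrow> (real \<Rightarrow> real) \<Rightarrow> (real \<Rightarrow> real) \<Rightarrow> space \<Rightarrow> real" where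
  "tensor f1 f2 f3 x = f1 (fst x $ 1) * f2 (fst x $ 2) * f3 (snd x)"

definition cube :: "space \<Rightarrow> real \<Rightarrow> space set" where
  "cube c s = {x. \<bar>fst x $ 1 - fst c $ 1\<bar> \<le> s \<and> \<bar>fst x $ 2 - fst c $ 2\<bar> \<le> s \<and> \<bar>snd x - snd c\<bar> \<le> s}"

abbreviation e1 :: space where "e1 \<equiv> (axis 1 1, 0)"
abbreviation e2 :: space where "e2 \<equiv> (axis 2 1, 0)"
abbreviation e3 :: space where "e3 \<equiv> (0, 1)"

lemma Basis_space: "(Basis :: space set) = {e1, e2, e3}"
  by (auto simp: Basis_prod_def Basis_vec_def UNIV_2)

lemma e_in_Basis [simp]: "e1 \<in> Basis" "e2 \<in> Basis" "e3 \<in> Basis"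
  by (simp_all add: Basis_space)

lemma bounded_linear_coords:
  "bounded_linear (\<lambda>x::space. fst x $ i)" "bounded_linear (\<lambda>x::space. snd x)"
  by (auto intro: bounded_linear_compose[OF bounded_linear_vec_nth bounded_linear_fst] bounded_linear_snd)

lemma smooth_tensor:
  assumes "smooth f1" "smooth f2" "smooth f3"
  shows "smooth (tensor f1 f2 f3)"
  unfolding tensor_def
  by (rule smooth_mult[OF smooth_mult])
    (rule smooth_compose[OF smooth_linear] bounded_linear_coords assms)+

lemma dir_deriv_tensor:
  assumes "smooth f1" "smooth f2" "smooth f3"
  shows "dir_deriv e1 (tensor f1 f2 f3) = tensor (dir_deriv 1 f1) f2 f3"
    and "dir_deriv e2 (tensor f1 f2 f3) = tensor f1 (dir_deriv 1 f2) f3"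
    and "dir_deriv e3 (tensor f1 f2 f3) = tensor f1 f2 (dir_deriv 1 f3)"
proof -
  have d: "((\<lambda>x::space. f (L x)) has_derivative (\<lambda>h. L h * dir_deriv 1 f (L x))) (at x)"
    if "smooth f" "bounded_linear L" for f :: "real \<Rightarrow> real" and L x
  proof -
    have "(f has_derivative (\<lambda>h. h * dir_deriv 1 f (L x))) (at (L x))"
      using smooth_real_deriv[OF that(1)]
      by (rule has_derivative_eq_rhs[OF has_field_derivative_imp_has_derivative]) (simp add: fun_eq_iff)
    then show ?thesis
      using diff_chain_at[OF bounded_linear_imp_has_derivative[OF that(2)]] by (simp add: comp_def)
  qed
  have "((\<lambda>x. f1 (fst x $ 1) * f2 (fst x $ 2) * f3 (snd x)) has_derivative
      (\<lambda>h. fst h $ 1 * dir_deriv 1 f1 (fst x $ 1) * f2 (fst x $ 2) * f3 (snd x)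
         + f1 (fst x $ 1) * (fst h $ 2 * dir_deriv 1 f2 (fst x $ 2)) * f3 (snd x)
         + f1 (fst x $ 1) * f2 (fst x $ 2) * (snd h * dir_deriv 1 f3 (snd x)))) (at x)" for x :: space
    by (rule has_derivative_eq_rhs[OF has_derivative_mult[OF has_derivative_mult]],
        (rule d assms bounded_linear_coords)+) (simp add: algebra_simps)
  note * = dir_deriv_eq[OF this, folded tensor_def]
  show "dir_deriv e1 (tensor f1 f2 f3) = tensor (dir_deriv 1 f1) f2 f3"
    "dir_deriv e2 (tensor f1 f2 f3) = tensor f1 (dir_deriv 1 f2) f3"
    "dir_deriv e3 (tensor f1 f2 f3) = tensor f1 f2 (dir_deriv 1 f3)"
    by (auto simp: * fun_eq_iff tensor_def axis_def)
qed

lemma cube_eq_cbox: "cube c s = cbox (c - (vector [s, s], s)) (c + (vector [s, s], s))"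
  by (cases c) (auto simp: cube_def cbox_Pair_eq mem_box_cart forall_2 abs_le_iff)

lemma compact_cube: "compact (cube c s)"
  by (simp add: cube_eq_cbox)

lemma measure_cube:
  assumes "0 \<le> s"
  shows "emeasure lborel (cube c s) = ennreal (8 * s ^ 3)"
proof -
  have "(\<Prod>b\<in>Basis. (2 *\<^sub>R (vector [s, s], s) :: space) \<bullet> b) = 8 * s ^ 3"
    by (simp add: Basis_space inner_axis power3_eq_cube axis_eq_axis)
  moreover have "(c + (vector [s, s], s)) - (c - (vector [s, s], s)) = (2 *\<^sub>R (vector [s, s], s) :: space)"
    by (simp add: scaleR_2)
  moreover have "(c - (vector [s, s], s)) \<bullet> b \<le> (c + (vector [s, s], s)) \<bullet> b" if "b \<in> Basis" for b
    using that assms by (auto simp: Basis_space inner_axis inner_simps)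
  ultimately show ?thesis
    unfolding cube_eq_cbox by (subst emeasure_lborel_cbox) auto
qed

lemma test_function_tensor:
  assumes "smooth f1" "smooth f2" "smooth f3"
    and "\<And>x. \<bar>x - fst c $ 1\<bar> > s \<Longrightarrow> f1 x = 0" "\<And>x. \<bar>x - fst c $ 2\<bar> > s \<Longrightarrow> f2 x = 0"
      "\<And>x. \<bar>x - snd c\<bar> > s \<Longrightarrow> f3 x = 0"
    and "cube c s \<subseteq> D"
  shows "test_function D (tensor f1 f2 f3)"
proof -
  have "{x. tensor f1 f2 f3 x \<noteq> 0} \<subseteq> cube c s"
    using assms(4-6) by (auto simp: tensor_def cube_def not_le[symmetric])
  then have "closure {x. tensor f1 f2 f3 x \<noteq> 0} \<subseteq> cube c s"
    by (intro closure_minimal compact_imp_closed compact_cube)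
  then show ?thesis
    unfolding test_function_def compact_eq_bounded_closed
    using smooth_tensor[OF assms(1-3)] assms(7) compact_imp_bounded[OF compact_cube[of c s]]
    by (auto intro: bounded_subset)
qed

section \<open>Linear coordinates\<close>

lemma measurable_vec2 [measurable]:
  assumes [measurable]: "f \<in> borel_measurable M" "g \<in> borel_measurable M"
  shows "(\<lambda>x. vector [f x, g x] :: real^2) \<in> borel_measurable M"
proof -
  have "(\<lambda>x. f x *\<^sub>R axis 1 1 + g x *\<^sub>R axis 2 1 :: real^2) \<in> borel_measurable M"
    by measurable
  also have "(\<lambda>x. f x *\<^sub>R axis 1 1 + g x *\<^sub>R axis 2 1 :: real^2) = (\<lambda>x. vector [f x, g x])"
    by (auto simp: fun_eq_iff vec_eq_iff forall_2 axis_def)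
  finally show ?thesis .
qed

lemma lborel_vec2: "(lborel :: (real^2) measure) = distr (lborel \<Otimes>\<^sub>M lborel) borel (\<lambda>(a, b). vector [a, b])"
proof (rule lborel_eqI)
  have m: "(\<lambda>(a, b). vector [a, b] :: real^2) \<in> borel_measurable (borel \<Otimes>\<^sub>M borel)"
    unfolding split_beta by measurable
  fix l u :: "real^2"
  assume lu: "\<And>b. b \<in> Basis \<Longrightarrow> l \<bullet> b \<le> u \<bullet> b"
  have le: "l $ i \<le> u $ i" for i
    using lu[of "axis i 1"] by (simp add: inner_axis)
  have "(\<lambda>(a, b). vector [a, b] :: real^2) -` box l u = box (l $ 1) (u $ 1) \<times> box (l $ 2) (u $ 2)"
    by (auto simp: mem_box_cart forall_2)
  then have "emeasure (distr (lborel \<Otimes>\<^sub>M lborel) borel (\<lambda>(a, b). vector [a, b])) (box l u) =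
      emeasure lborel (box (l $ 1) (u $ 1)) * emeasure lborel (box (l $ 2) (u $ 2))"
    using m by (subst emeasure_distr) (auto simp: lborel.emeasure_pair_measure_Times space_pair_measure)
  also have "\<dots> = ennreal ((u $ 1 - l $ 1) * (u $ 2 - l $ 2))"
    using le by (simp add: emeasure_lborel_box_eq ennreal_mult)
  also have "(u $ 1 - l $ 1) * (u $ 2 - l $ 2) = (\<Prod>b\<in>Basis. (u - l) \<bullet> b)"
    by (simp add: Basis_vec_def UNIV_2 inner_axis axis_eq_axis)
  finally show "emeasure (distr (lborel \<Otimes>\<^sub>M lborel) borel (\<lambda>(a, b). vector [a, b])) (box l u) =
    ennreal (\<Prod>b\<in>Basis. (u - l) \<bullet> b)" .
qed simp

lemma nn_integral_vec2:
  assumes [measurable]: "h \<in> borel_measurable (borel :: (real^2) measure)"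
  shows "(\<integral>\<^sup>+y. h y \<partial>lborel) = (\<integral>\<^sup>+b. \<integral>\<^sup>+a. h (vector [a, b]) \<partial>lborel \<partial>lborel)"
proof -
  have "(\<integral>\<^sup>+y. h y \<partial>lborel) = (\<integral>\<^sup>+x. h (case x of (a, b) \<Rightarrow> vector [a, b]) \<partial>(lborel \<Otimes>\<^sub>M lborel))"
    by (subst lborel_vec2, subst nn_integral_distr) (auto simp: split_beta)
  also have "\<dots> = (\<integral>\<^sup>+b. \<integral>\<^sup>+a. h (vector [a, b]) \<partial>lborel \<partial>lborel)"
    by (subst lborel_pair.nn_integral_snd[symmetric]) (auto simp: split_beta)
  finally show ?thesis .
qed

definition det2 :: "real^2 \<Rightarrow> real^2 \<Rightarrow> real" where
  "det2 x y = x $ 1 * y $ 2 - x $ 2 * y $ 1"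

text \<open>Oblique coordinates ((a, t), b), grouped so that \<open>fst z\<close> names a point of
  the face and \<open>snd z\<close> the depth along y; traces depend on \<open>fst z\<close>
  only.\<close>

definition param :: "real^2 \<Rightarrow> real^2 \<Rightarrow> (real \<times> real) \<times> real \<Rightarrow> space" where
  "param x y z = (fst (fst z) *\<^sub>R x + snd z *\<^sub>R y, snd (fst z))"

lemma continuous_on_param: "continuous_on S (param x y)"
  unfolding param_def by (intro continuous_intros)

lemma measurable_param [measurable]: "param x y \<in> borel_measurable borel"
  by (intro borel_measurable_continuous_onI continuous_on_param)

text \<open>Gaussian elimination with pivot \<open>y $ 2\<close>: two one-dimensional affine
  substitutions with Fubini between them. Their factors \<open>det2 x y / y $ 2\<close> and
  \<open>y $ 2\<close> multiply to the determinant. A vanishing pivot leaves a triangular system,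
  treated separately.\<close>

lemma nn_integral_linear_coords:
  assumes [measurable]: "h \<in> borel_measurable (borel :: (real^2) measure)" and d: "det2 x y \<noteq> 0"
  shows "(\<integral>\<^sup>+z. h z \<partial>lborel) = ennreal \<bar>det2 x y\<bar> * (\<integral>\<^sup>+a. \<integral>\<^sup>+b. h (a *\<^sub>R x + b *\<^sub>R y) \<partial>lborel \<partial>lborel)"
proof (cases "y $ 2 = 0")
  case False
  have "(\<integral>\<^sup>+z. h z \<partial>lborel) = (\<integral>\<^sup>+q. \<integral>\<^sup>+p. h (vector [p, q]) \<partial>lborel \<partial>lborel)"
    by (rule nn_integral_vec2) simp
  also have "\<dots> = (\<integral>\<^sup>+q. ennreal \<bar>det2 x y / y $ 2\<bar> *
      (\<integral>\<^sup>+a. h (vector [q * (y $ 1 / y $ 2) + (det2 x y / y $ 2) * a, q]) \<partial>lborel) \<partial>lborel)"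
    using d False by (intro nn_integral_cong nn_integral_real_affine) auto
  also have "\<dots> = ennreal \<bar>det2 x y / y $ 2\<bar> *
      (\<integral>\<^sup>+q. \<integral>\<^sup>+a. h (vector [q * (y $ 1 / y $ 2) + (det2 x y / y $ 2) * a, q]) \<partial>lborel \<partial>lborel)"
    by (intro nn_integral_cmult) measurable
  also have "(\<integral>\<^sup>+q. \<integral>\<^sup>+a. h (vector [q * (y $ 1 / y $ 2) + (det2 x y / y $ 2) * a, q]) \<partial>lborel \<partial>lborel) =
     (\<integral>\<^sup>+a. \<integral>\<^sup>+q. h (vector [q * (y $ 1 / y $ 2) + (det2 x y / y $ 2) * a, q]) \<partial>lborel \<partial>lborel)"
    by (rule lborel_pair.Fubini') measurable
  also have "\<dots> = (\<integral>\<^sup>+a. ennreal \<bar>y $ 2\<bar> * (\<integral>\<^sup>+b. h (a *\<^sub>R x + b *\<^sub>R y) \<partial>lborel) \<partial>lborel)"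
  proof (rule nn_integral_cong)
    fix a
    have "(\<integral>\<^sup>+q. h (vector [q * (y $ 1 / y $ 2) + (det2 x y / y $ 2) * a, q]) \<partial>lborel) =
      ennreal \<bar>y $ 2\<bar> * (\<integral>\<^sup>+b. h (vector [(a * x $ 2 + y $ 2 * b) * (y $ 1 / y $ 2) +
         (det2 x y / y $ 2) * a, a * x $ 2 + y $ 2 * b]) \<partial>lborel)"
      using False by (intro nn_integral_real_affine) auto
    also have "(\<lambda>b. vector [(a * x $ 2 + y $ 2 * b) * (y $ 1 / y $ 2) +
         (det2 x y / y $ 2) * a, a * x $ 2 + y $ 2 * b]) = (\<lambda>b. a *\<^sub>R x + b *\<^sub>R y)"
      using False by (auto simp: fun_eq_iff vec_eq_iff forall_2 det2_def field_simps)
    finally show "(\<integral>\<^sup>+q. h (vector [q * (y $ 1 / y $ 2) + (det2 x y / y $ 2) * a, q]) \<partial>lborel) =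
      ennreal \<bar>y $ 2\<bar> * (\<integral>\<^sup>+b. h (a *\<^sub>R x + b *\<^sub>R y) \<partial>lborel)" by (simp add: fun_eq_iff)
  qed
  also have "\<dots> = ennreal \<bar>y $ 2\<bar> * (\<integral>\<^sup>+a. \<integral>\<^sup>+b. h (a *\<^sub>R x + b *\<^sub>R y) \<partial>lborel \<partial>lborel)"
    by (intro nn_integral_cmult) measurable
  finally show ?thesis
    using False by (simp add: mult.assoc[symmetric] ennreal_mult'[symmetric] abs_mult)
next
  case True
  then have nz: "y $ 1 \<noteq> 0" "x $ 2 \<noteq> 0" using d by (auto simp: det2_def)
  have "(\<integral>\<^sup>+z. h z \<partial>lborel) = (\<integral>\<^sup>+q. \<integral>\<^sup>+p. h (vector [p, q]) \<partial>lborel \<partial>lborel)"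
    by (rule nn_integral_vec2) simp
  also have "\<dots> = ennreal \<bar>x $ 2\<bar> * (\<integral>\<^sup>+a. \<integral>\<^sup>+p. h (vector [p, 0 + x $ 2 * a]) \<partial>lborel \<partial>lborel)"
    using nz by (intro nn_integral_real_affine) auto
  also have "(\<integral>\<^sup>+a. \<integral>\<^sup>+p. h (vector [p, 0 + x $ 2 * a]) \<partial>lborel \<partial>lborel) =
     (\<integral>\<^sup>+a. ennreal \<bar>y $ 1\<bar> * (\<integral>\<^sup>+b. h (a *\<^sub>R x + b *\<^sub>R y) \<partial>lborel) \<partial>lborel)"
  proof (rule nn_integral_cong)
    fix a
    have "(\<integral>\<^sup>+p. h (vector [p, 0 + x $ 2 * a]) \<partial>lborel) =
      ennreal \<bar>y $ 1\<bar> * (\<integral>\<^sup>+b. h (vector [a * x $ 1 + y $ 1 * b, 0 + x $ 2 * a]) \<partial>lborel)"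
      using nz by (intro nn_integral_real_affine) auto
    also have "(\<lambda>b. vector [a * x $ 1 + y $ 1 * b, 0 + x $ 2 * a]) = (\<lambda>b. a *\<^sub>R x + b *\<^sub>R y)"
      using True by (auto simp: fun_eq_iff vec_eq_iff forall_2)
    finally show "(\<integral>\<^sup>+p. h (vector [p, 0 + x $ 2 * a]) \<partial>lborel) =
      ennreal \<bar>y $ 1\<bar> * (\<integral>\<^sup>+b. h (a *\<^sub>R x + b *\<^sub>R y) \<partial>lborel)" by (simp add: fun_eq_iff)
  qed
  also have "\<dots> = ennreal \<bar>y $ 1\<bar> * (\<integral>\<^sup>+a. \<integral>\<^sup>+b. h (a *\<^sub>R x + b *\<^sub>R y) \<partial>lborel \<partial>lborel)"
    by (intro nn_integral_cmult) measurable
  finally show ?thesis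
    using True by (simp add: mult.assoc[symmetric] ennreal_mult'[symmetric] abs_mult[symmetric] det2_def)
qed

lemma nn_integral_param:
  assumes [measurable]: "h \<in> borel_measurable (borel :: space measure)" and d: "det2 x y \<noteq> 0"
  shows "(\<integral>\<^sup>+z. h z \<partial>lborel) = ennreal \<bar>det2 x y\<bar> * (\<integral>\<^sup>+z. h (param x y z) \<partial>lborel)"
proof -
  have [measurable]: "h \<in> borel_measurable (borel \<Otimes>\<^sub>M borel)" by (simp add: borel_prod)
  have "(\<integral>\<^sup>+z. h z \<partial>lborel) = (\<integral>\<^sup>+t. \<integral>\<^sup>+z. h (z, t) \<partial>lborel \<partial>lborel)"
    by (subst lborel_prod[symmetric], subst lborel_pair.nn_integral_snd[symmetric]) auto
  also have "\<dots> = (\<integral>\<^sup>+t. ennreal \<bar>det2 x y\<bar> *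
      (\<integral>\<^sup>+a. \<integral>\<^sup>+b. h (a *\<^sub>R x + b *\<^sub>R y, t) \<partial>lborel \<partial>lborel) \<partial>lborel)"
    using d by (intro nn_integral_cong nn_integral_linear_coords) auto
  also have "\<dots> = ennreal \<bar>det2 x y\<bar> *
      (\<integral>\<^sup>+t. \<integral>\<^sup>+a. \<integral>\<^sup>+b. h (a *\<^sub>R x + b *\<^sub>R y, t) \<partial>lborel \<partial>lborel \<partial>lborel)"
    by (intro nn_integral_cmult) measurable
  also have "(\<integral>\<^sup>+t. \<integral>\<^sup>+a. \<integral>\<^sup>+b. h (a *\<^sub>R x + b *\<^sub>R y, t) \<partial>lborel \<partial>lborel \<partial>lborel) =
      (\<integral>\<^sup>+w. \<integral>\<^sup>+b. h (param x y (w, b)) \<partial>lborel \<partial>(lborel \<Otimes>\<^sub>M lborel))"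
    by (subst lborel_pair.nn_integral_snd[symmetric]) (auto simp: param_def split_beta)
  also have "\<dots> = (\<integral>\<^sup>+z. h (param x y z) \<partial>lborel)"
  proof -
    have "(\<lambda>z. h (param x y z)) \<in> borel_measurable (lborel \<Otimes>\<^sub>M lborel)"
      by (simp add: lborel_prod)
    then have "(\<integral>\<^sup>+w. \<integral>\<^sup>+b. h (param x y (w, b)) \<partial>lborel \<partial>lborel) = (\<integral>\<^sup>+z. h (param x y z) \<partial>(lborel \<Otimes>\<^sub>M lborel))"
      by (rule lborel.nn_integral_fst)
    then show ?thesis by (simp only: lborel_prod)
  qed
  finally show ?thesis .
qed

lemma lborel_param:
  assumes "det2 x y \<noteq> 0"
  shows "(lborel :: space measure) = density (distr lborel borel (param x y)) (\<lambda>_. ennreal \<bar>det2 x y\<bar>)"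
proof (rule measure_eqI)
  fix A :: "space set"
  assume "A \<in> sets lborel"
  then have [measurable]: "A \<in> sets borel" by simp
  have "emeasure lborel A = (\<integral>\<^sup>+z. indicator A z \<partial>lborel)" by simp
  also have "\<dots> = ennreal \<bar>det2 x y\<bar> * (\<integral>\<^sup>+z. indicator A (param x y z) \<partial>lborel)"
    using assms by (intro nn_integral_param) auto
  also have "(\<integral>\<^sup>+z. indicator A (param x y z) \<partial>lborel) = (\<integral>\<^sup>+z. indicator A z \<partial>distr lborel borel (param x y))"
    by (subst nn_integral_distr) auto
  also have "ennreal \<bar>det2 x y\<bar> * \<dots> = emeasure (density (distr lborel borel (param x y)) (\<lambda>_. ennreal \<bar>det2 x y\<bar>)) A"
    by (simp add: emeasure_density nn_integral_cmult)
  finally show "emeasure lborel A = emeasure (density (distr lborel borel (param x y)) (\<lambda>_. ennreal \<bar>det2 x y\<bar>)) A" .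
qed simp

lemma integral_param:
  fixes f :: "space \<Rightarrow> 'b::{banach, second_countable_topology}"
  assumes "det2 x y \<noteq> 0" and [measurable]: "f \<in> borel_measurable borel"
  shows "integral\<^sup>L lborel f = \<bar>det2 x y\<bar> *\<^sub>R integral\<^sup>L lborel (\<lambda>z. f (param x y z))"
  using assms by (subst lborel_param[of x y]) (simp_all add: integral_density integral_distr)

lemma lborel_product_integral:
  fixes f :: "'a::euclidean_space \<Rightarrow> real" and g :: "'b::euclidean_space \<Rightarrow> real"
  assumes "integrable lborel f" "integrable lborel g"
  shows "integrable lborel (\<lambda>z. f (fst z) * g (snd z))"
    and "(\<integral>z. f (fst z) * g (snd z) \<partial>lborel) = integral\<^sup>L lborel f * integral\<^sup>L lborel g"
proof -
  have [measurable]: "f \<in> borel_measurable borel" "g \<in> borel_measurable borel"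
    using assms by (auto dest: borel_measurable_integrable)
  have i: "integrable (lborel \<Otimes>\<^sub>M lborel) (\<lambda>z. f (fst z) * g (snd z))"
    using assms by (intro lborel_pair.Fubini_integrable) (auto simp: abs_mult)
  then show "integrable lborel (\<lambda>z. f (fst z) * g (snd z))"
    by (simp only: lborel_prod)
  have "(\<integral>z. f (fst z) * g (snd z) \<partial>lborel) = (\<integral>x. \<integral>y. f x * g y \<partial>lborel \<partial>lborel)"
    using lborel_pair.integral_fst'[OF i] by (simp add: lborel_prod)
  also have "\<dots> = integral\<^sup>L lborel f * integral\<^sup>L lborel g" by simp
  finally show "(\<integral>z. f (fst z) * g (snd z) \<partial>lborel) = integral\<^sup>L lborel f * integral\<^sup>L lborel g" .
qed

lemma integral_tensor:
  assumes "integrable lborel f1" "integrable lborel f2" "integrable lborel f3"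
  shows "integral\<^sup>L lborel (tensor f1 f2 f3) =
    integral\<^sup>L lborel f1 * integral\<^sup>L lborel f2 * integral\<^sup>L lborel f3"
proof -
  have [measurable]: "f1 \<in> borel_measurable borel" "f2 \<in> borel_measurable borel" "f3 \<in> borel_measurable borel"
    using assms by (auto dest: borel_measurable_integrable)
  have [measurable]: "(\<lambda>x::space. fst x $ i) \<in> borel_measurable borel"
     "(\<lambda>x::space. snd x) \<in> borel_measurable borel" for i
    by (intro borel_measurable_continuous_onI continuous_intros)+
  have [measurable]: "tensor f1 f2 f3 \<in> borel_measurable borel"
    unfolding tensor_def by measurable
  have "integral\<^sup>L lborel (tensor f1 f2 f3) = (\<integral>z. tensor f1 f2 f3 (param (axis 1 1) (axis 2 1) z) \<partial>lborel)"
    by (subst integral_param[of "axis 1 1" "axis 2 1"]) (auto simp: det2_def axis_def)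
  also have "(\<lambda>z. tensor f1 f2 f3 (param (axis 1 1) (axis 2 1) z)) = (\<lambda>z. (\<lambda>w. f1 (fst w) * f3 (snd w)) (fst z) * f2 (snd z))"
    by (auto simp: fun_eq_iff tensor_def param_def axis_def)
  finally show ?thesis
    using lborel_product_integral(2)[OF lborel_product_integral(1)[OF assms(1,3)] assms(2)]
      lborel_product_integral(2)[OF assms(1,3)] by simp
qed

section \<open>Square integrable functions on finite measure spaces\<close>

lemma L2_D:
  assumes "f \<in> L2 N"
  shows "f \<in> borel_measurable N" "integrable N (\<lambda>x. (cmod (f x))\<^sup>2)"
  using assms by (auto simp: L2_def)

lemma L2_integrable:
  assumes "finite_measure N" "f \<in> L2 N"
  shows "integrable N f"
proof (rule Bochner_Integration.integrable_bound)
  interpret finite_measure N by fact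
  show "integrable N (\<lambda>x. 1 + (cmod (f x))\<^sup>2)"
    using L2_D[OF assms(2)] by auto
  have "t \<le> \<bar>1 + t\<^sup>2\<bar>" for t :: real
  proof -
    have "2 * t \<le> t\<^sup>2 + 1" using zero_le_power2[of "t - 1"] by (simp add: power2_diff)
    with zero_le_power2[of t] show ?thesis by linarith
  qed
  then show "AE x in N. cmod (f x) \<le> norm (1 + (cmod (f x))\<^sup>2)"
    by simp
qed (use L2_D[OF assms(2)] in auto)

lemma integrable_bounded_mult:
  fixes f :: "'a \<Rightarrow> complex" and K :: "'a \<Rightarrow> complex"
  assumes "integrable N f" "K \<in> borel_measurable N" "\<And>x. cmod (K x) \<le> c"
  shows "integrable N (\<lambda>x. K x * f x)"
proof (rule Bochner_Integration.integrable_bound)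
  show "integrable N (\<lambda>x. c * cmod (f x))"
    using assms(1) by auto
  have "c \<ge> 0" using assms(3) norm_ge_zero order_trans by blast
  then show "AE x in N. norm (K x * f x) \<le> norm (c * cmod (f x))"
    using assms(3) by (auto simp: norm_mult mult_right_mono)
qed (use assms in auto)

lemma integrable_bounded_scaleR:
  fixes f :: "'a \<Rightarrow> complex" and K :: "'a \<Rightarrow> real"
  assumes "integrable N f" "K \<in> borel_measurable N" "\<And>x. \<bar>K x\<bar> \<le> c"
  shows "integrable N (\<lambda>x. K x *\<^sub>R f x)"
  using integrable_bounded_mult[of N f "\<lambda>x. of_real (K x)" c] assms by (simp add: scaleR_conv_of_real)

lemma borel_measurable_lebesgue_on: "f \<in> borel_measurable borel \<Longrightarrow> f \<in> borel_measurable (lebesgue_on D)"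
  by (intro measurable_restrict_space1 measurable_completion) simp

lemma finite_measure_lebesgue_on_open:
  "open D \<Longrightarrow> bounded D \<Longrightarrow> finite_measure (lebesgue_on D)"
  by (intro finite_measure_lebesgue_on bounded_set_imp_lmeasurable) auto

text \<open>The weighted inequality 2 a \<le> t a^2 + 1/t stands in for Cauchy-Schwarz. The free
  weight t is later balanced against the volume 8 \<rho>^3 of the cube.\<close>

lemma cube_integral_bound:
  fixes D :: "space set"
  assumes D: "open D" "bounded D" and g: "g \<in> L2 (lebesgue_on D)"
    and T: "T \<in> borel_measurable borel" "\<And>z. \<bar>T z\<bar> \<le> c" "\<And>z. z \<notin> cube a \<rho> \<Longrightarrow> T z = (0::real)"
    and "0 < t" "0 \<le> \<rho>"
  shows "cmod (\<integral>z. T z *\<^sub>R g z \<partial>lebesgue_on D) \<le>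
    c / 2 * (t * (\<integral>z. (cmod (g z))\<^sup>2 \<partial>lebesgue_on D) + 8 * \<rho> ^ 3 / t)"
proof -
  let ?N = "lebesgue_on D"
  interpret finite_measure ?N
    by (rule finite_measure_lebesgue_on_open[OF D])
  have c: "c \<ge> 0" using T(2)[of 0] by simp
  have Dm: "D \<in> sets lebesgue" using D by auto
  have cs: "cube a \<rho> \<in> sets borel"
    using compact_cube by (intro borel_closed compact_imp_closed)
  then have cm: "cube a \<rho> \<inter> D \<in> sets ?N"
    using Dm by (subst sets_restrict_space_iff) auto
  have int: "integrable ?N (\<lambda>z. indicator (cube a \<rho> \<inter> D) z :: real)"
    by (rule integrable_real_indicator[OF cm]) (simp add: emeasure_eq_measure)
  have "cmod (\<integral>z. T z *\<^sub>R g z \<partial>?N) \<le> (\<integral>z. c / 2 * (t * (cmod (g z))\<^sup>2 + indicator (cube a \<rho> \<inter> D) z / t) \<partial>?N)"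
  proof (rule Bochner_Integration.integral_norm_bound_integral)
    show "integrable ?N (\<lambda>z. T z *\<^sub>R g z)"
      using T by (intro integrable_bounded_scaleR[of _ _ _ c] L2_integrable g borel_measurable_lebesgue_on finite_measure_axioms)
    show "integrable ?N (\<lambda>z. c / 2 * (t * (cmod (g z))\<^sup>2 + indicator (cube a \<rho> \<inter> D) z / t))"
      using L2_D[OF g] int by auto
    fix z assume "z \<in> space ?N"
    then have zD: "z \<in> D" by simp
    show "norm (T z *\<^sub>R g z) \<le> c / 2 * (t * (cmod (g z))\<^sup>2 + indicator (cube a \<rho> \<inter> D) z / t)"
    proof (cases "z \<in> cube a \<rho>")
      case True
      have "0 \<le> (t * cmod (g z) - 1)\<^sup>2 / t" using \<open>0 < t\<close> by simp
      also have "\<dots> = t * (cmod (g z))\<^sup>2 - 2 * cmod (g z) + 1 / t"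
        using \<open>0 < t\<close> by (simp add: power2_eq_square field_simps)
      finally have "2 * cmod (g z) \<le> t * (cmod (g z))\<^sup>2 + 1 / t" by simp
      then have "c / 2 * (2 * cmod (g z)) \<le> c / 2 * (t * (cmod (g z))\<^sup>2 + 1 / t)"
        using c by (intro mult_left_mono) auto
      moreover have "norm (T z *\<^sub>R g z) \<le> c * cmod (g z)"
        using T(2) by (simp add: mult_right_mono)
      ultimately show ?thesis using True zD by simp
    next
      case False
      then show ?thesis using T(3) c \<open>0 < t\<close> by (simp add: indicator_def)
    qed
  qed
  also have "\<dots> = c / 2 * (t * (\<integral>z. (cmod (g z))\<^sup>2 \<partial>?N) + measure ?N (cube a \<rho> \<inter> D) / t)"
    using L2_D[OF g] int cm by simp
  also have "measure ?N (cube a \<rho> \<inter> D) = measure lebesgue (cube a \<rho> \<inter> D)"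
    using Dm by (intro measure_restrict_space) auto
  also have "\<dots> \<le> measure lebesgue (cube a \<rho>)"
    using cs Dm compact_cube[of a \<rho>]
    by (intro measure_mono_fmeasurable) (auto intro: lmeasurable_compact)
  also have "\<dots> = 8 * \<rho> ^ 3"
    using cs measure_cube[OF \<open>0 \<le> \<rho>\<close>, of a] \<open>0 \<le> \<rho>\<close> by (simp add: measure_def)
  finally show ?thesis
    using c \<open>0 < t\<close> by (simp add: divide_right_mono mult_left_mono)
qed

lemma compactly_supported_bounded:
  fixes f :: "real \<Rightarrow> real"
  assumes "smooth f" "\<And>x. \<bar>x - c\<bar> > s \<Longrightarrow> f x = 0"
  obtains C where "\<And>x. \<bar>f x\<bar> \<le> C"
proof -
  have "bounded (f ` cball c s)"
    by (intro compact_imp_bounded compact_continuous_image smooth_continuous_on assms(1) compact_cball)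
  then obtain C where C: "\<And>x. x \<in> cball c s \<Longrightarrow> \<bar>f x\<bar> \<le> C"
    unfolding bounded_iff by (metis image_eqI real_norm_def)
  have "\<bar>f x\<bar> \<le> max C 0" for x
    using C[of x] assms(2)[of x] by (cases "\<bar>x - c\<bar> \<le> s") (auto simp: dist_real_def abs_minus_commute)
  then show ?thesis by (rule that)
qed

text \<open>Boxes form an intersection-stable generator of the Borel sets, so vanishing spreads to
  all of them by Dynkin's argument; the total integral settles complements.\<close>

lemma AE_zero_if_box_integrals_zero:
  fixes f :: "'a::euclidean_space \<Rightarrow> complex"
  assumes f: "integrable lborel f" and total: "integral\<^sup>L lborel f = 0"
    and box: "\<And>a b. set_lebesgue_integral lborel (box a b) f = 0"
  shows "AE x in lborel. f x = 0"
proof (rule sigma_finite_measure.density_zero[OF sigma_finite_lborel f])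
  fix A :: "'a set" assume A: "A \<in> sets lborel"
  have si: "set_integrable lborel B f" if "B \<in> sets borel" for B
    using f that by (simp add: set_integrable_def integrable_mult_indicator)
  have ss: "sigma_sets UNIV (range (\<lambda>(a, b). box a b :: 'a set)) = sets borel"
    by (simp add: borel_eq_box)
  have "Int_stable (range (\<lambda>(a, b). box a b :: 'a set))"
    by (auto simp: Int_stable_def box_Int_box)
  moreover have "range (\<lambda>(a, b). box a b :: 'a set) \<subseteq> Pow UNIV" by simp
  moreover have "A \<in> sigma_sets UNIV (range (\<lambda>(a, b). box a b))"
    using A ss by simp
  ultimately show "set_lebesgue_integral lborel A f = 0"
  proof (induction rule: sigma_sets_induct_disjoint)
    case (compl A)
    then have "A \<in> sets borel" using ss by simp
    then have "set_lebesgue_integral lborel (A \<union> (UNIV - A)) f =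
        set_lebesgue_integral lborel A f + set_lebesgue_integral lborel (UNIV - A) f"
      by (intro set_integral_Un si) auto
    then show ?case using compl total by (simp add: set_lebesgue_integral_def)
  next
    case (union A)
    then have "range A \<subseteq> sets borel" using ss by simp
    then have "set_lebesgue_integral lborel (\<Union>i. A i) f = (\<Sum>i. set_lebesgue_integral lborel (A i) f)"
      using union(1) by (intro lebesgue_integral_countable_add si sets.countable_UN)
        (auto simp: disjoint_family_on_def)
    then show ?case using union by simp
  next
    case empty
    then show ?case by (simp add: set_lebesgue_integral_def)
  qed (auto simp: box)
qed

section \<open>Continuity of functions with square integrable second derivatives\<close>

definition rescale :: "real \<Rightarrow> real \<Rightarrow> real \<Rightarrow> (real \<Rightarrow> real) \<Rightarrow> real \<Rightarrow> real" where
  "rescale c r a f = (\<lambda>t. c * f ((t - a) / r))"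

lemma smooth_rescale: "smooth f \<Longrightarrow> smooth (rescale c r a f)"
  unfolding rescale_def by (rule smooth_real_affine)

lemma dir_deriv_rescale: "smooth f \<Longrightarrow> dir_deriv 1 (rescale c r a f) = rescale (c / r) r a (dir_deriv 1 f)"
  unfolding rescale_def by (rule smooth_real_affine)

lemma rescale_zero:
  assumes "\<And>t. \<bar>t - e\<bar> > s \<Longrightarrow> f t = 0" "r > 0" "\<bar>t - (a + r * e)\<bar> > r * s"
  shows "rescale c r a f t = 0"
proof -
  have "(t - a) / r - e = (t - (a + r * e)) / r" using assms(2) by (simp add: field_simps)
  then have "\<bar>(t - a) / r - e\<bar> > s"
    using assms(2,3) by (simp add: abs_divide pos_less_divide_eq mult.commute)
  then show ?thesis using assms(1) by (simp add: rescale_def)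
qed

lemma borel_measurable_tensor:
  assumes "smooth f1" "smooth f2" "smooth f3"
  shows "tensor f1 f2 f3 \<in> borel_measurable borel"
  by (intro borel_measurable_continuous_onI smooth_continuous_on smooth_tensor assms)

text \<open>The kernels \<open>b1, b2, b3\<close> average \<open>u\<close> over the cube of side \<open>2 r s\<close> around \<open>x + r e\<close>, which lies in
  \<open>D\<close> even for \<open>x\<close> on the edge. As \<open>\<beta>1, \<beta>2, \<beta>3\<close> have compact support, averages at the scales \<open>r\<close> and \<open>r l\<close>
  differ by \<open>r\<^sup>2\<close> times an average of pure second derivatives, which is \<open>O(r powr (1/2))\<close> in dimension 3.\<close>

locale averaging =
  fixes D :: "space set" and u g1 g2 g3 :: "space \<Rightarrow> complex" and e :: space and s l C :: real
    and b1 b2 b3 \<beta>1 \<beta>2 \<beta>3 :: "real \<Rightarrow> real"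
  assumes D: "open D" "bounded D"
    and u: "u \<in> L2 (lebesgue_on D)" and u_borel [measurable]: "u \<in> borel_measurable borel"
    and g: "g1 \<in> L2 (lebesgue_on D)" "g2 \<in> L2 (lebesgue_on D)" "g3 \<in> L2 (lebesgue_on D)"
    and weak: "\<And>\<phi>. test_function D \<phi> \<Longrightarrow>
        (\<integral>z. dir_deriv e1 (dir_deriv e1 \<phi>) z *\<^sub>R u z \<partial>lebesgue_on D) = (\<integral>z. \<phi> z *\<^sub>R g1 z \<partial>lebesgue_on D)"
      "\<And>\<phi>. test_function D \<phi> \<Longrightarrow>
        (\<integral>z. dir_deriv e2 (dir_deriv e2 \<phi>) z *\<^sub>R u z \<partial>lebesgue_on D) = (\<integral>z. \<phi> z *\<^sub>R g2 z \<partial>lebesgue_on D)"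
      "\<And>\<phi>. test_function D \<phi> \<Longrightarrow>
        (\<integral>z. dir_deriv e3 (dir_deriv e3 \<phi>) z *\<^sub>R u z \<partial>lebesgue_on D) = (\<integral>z. \<phi> z *\<^sub>R g3 z \<partial>lebesgue_on D)"
    and l: "0 < l" "l < 1" and s: "0 < s" and C: "1 \<le> C"
    and smooth_kernels: "smooth b1" "smooth b2" "smooth b3" "smooth \<beta>1" "smooth \<beta>2" "smooth \<beta>3"
    and bound: "\<And>t. \<bar>b1 t\<bar> \<le> C" "\<And>t. \<bar>b2 t\<bar> \<le> C" "\<And>t. \<bar>b3 t\<bar> \<le> C"
      "\<And>t. \<bar>\<beta>1 t\<bar> \<le> C" "\<And>t. \<bar>\<beta>2 t\<bar> \<le> C" "\<And>t. \<bar>\<beta>3 t\<bar> \<le> C"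
    and supp1: "\<And>t. \<bar>t - fst e $ 1\<bar> > s \<Longrightarrow> b1 t = 0" "\<And>t. \<bar>t - fst e $ 1\<bar> > s \<Longrightarrow> b1 (t / l) = 0"
      "\<And>t. \<bar>t - fst e $ 1\<bar> > s \<Longrightarrow> \<beta>1 t = 0"
    and supp2: "\<And>t. \<bar>t - fst e $ 2\<bar> > s \<Longrightarrow> b2 t = 0" "\<And>t. \<bar>t - fst e $ 2\<bar> > s \<Longrightarrow> b2 (t / l) = 0"
      "\<And>t. \<bar>t - fst e $ 2\<bar> > s \<Longrightarrow> \<beta>2 t = 0"
    and supp3: "\<And>t. \<bar>t - snd e\<bar> > s \<Longrightarrow> b3 t = 0" "\<And>t. \<bar>t - snd e\<bar> > s \<Longrightarrow> b3 (t / l) = 0"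
      "\<And>t. \<bar>t - snd e\<bar> > s \<Longrightarrow> \<beta>3 t = 0"
    and mass: "integral\<^sup>L lborel b1 = 1" "integral\<^sup>L lborel b2 = 1" "integral\<^sup>L lborel b3 = 1"
    and \<beta>'': "\<And>y. dir_deriv 1 (dir_deriv 1 \<beta>1) y = b1 (y / l) / l - b1 y"
      "\<And>y. dir_deriv 1 (dir_deriv 1 \<beta>2) y = b2 (y / l) / l - b2 y"
      "\<And>y. dir_deriv 1 (dir_deriv 1 \<beta>3) y = b3 (y / l) / l - b3 y"
begin

abbreviation "N \<equiv> lebesgue_on D"

definition kernel :: "real \<Rightarrow> space \<Rightarrow> space \<Rightarrow> real" where
  "kernel r x = tensor (rescale (1 / r) r (fst x $ 1) b1) (rescale (1 / r) r (fst x $ 2) b2)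
     (rescale (1 / r) r (snd x) b3)"

definition avg :: "real \<Rightarrow> space \<Rightarrow> complex" where
  "avg r x = (\<integral>z. kernel r x z *\<^sub>R u z \<partial>N)"

text \<open>The three coordinate directions contribute one term each; 24 s^3 is three times the 8
  s^3 of the cube volume.\<close>

definition diff_const :: real where
  "diff_const = C ^ 3 / (2 * l ^ 2) * ((\<integral>z. (cmod (g1 z))\<^sup>2 \<partial>N) + (\<integral>z. (cmod (g2 z))\<^sup>2 \<partial>N)
     + (\<integral>z. (cmod (g3 z))\<^sup>2 \<partial>N) + 24 * s ^ 3)"

lemma rescale_l_zero:
  assumes "\<And>t. \<bar>t - a'\<bar> > s \<Longrightarrow> f (t / l) = 0" "r > 0" "\<bar>t - (a + r * a')\<bar> > r * s"
  shows "rescale c (l * r) a f t = 0"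
proof -
  have "rescale c (l * r) a f t = rescale c r a (\<lambda>t. f (t / l)) t"
    by (simp add: rescale_def mult.commute)
  then show ?thesis using rescale_zero[where e = a' and f = "\<lambda>t. f (t / l)", OF assms] by simp
qed

text \<open>The scale changes from r to l r one coordinate at a time. \<Psi>1 has its other factors
  at scale l r, \<Psi>3 at scale r, \<Psi>2 one of each kind, so the second derivatives telescope to
  the difference of the two kernels.\<close>

lemma avg_diff:
  assumes r: "0 < r" "r \<le> 1" and sub: "cube (x + r *\<^sub>R e) (r * s) \<subseteq> D"
  shows "cmod (avg (l * r) x - avg r x) \<le> diff_const * sqrt r"
proof -
  let ?x1 = "fst x $ 1" and ?x2 = "fst x $ 2" and ?x3 = "snd x"
  \<comment> \<open>The factor with \<beta>1 has amplitude r because two derivatives divide by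
    \<open>r^2\<close>, and the averaging kernels have amplitude 1 / r.\<close>
  define \<Psi>1 where "\<Psi>1 = tensor (rescale r r ?x1 \<beta>1) (rescale (1 / (l * r)) (l * r) ?x2 b2) (rescale (1 / (l * r)) (l * r) ?x3 b3)"
  define \<Psi>2 where "\<Psi>2 = tensor (rescale (1 / r) r ?x1 b1) (rescale r r ?x2 \<beta>2) (rescale (1 / (l * r)) (l * r) ?x3 b3)"
  define \<Psi>3 where "\<Psi>3 = tensor (rescale (1 / r) r ?x1 b1) (rescale (1 / r) r ?x2 b2) (rescale r r ?x3 \<beta>3)"
  have sm: "smooth \<Psi>1" "smooth \<Psi>2" "smooth \<Psi>3"
    unfolding \<Psi>1_def \<Psi>2_def \<Psi>3_def by (intro smooth_tensor smooth_rescale smooth_kernels)+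
  have center: "fst (x + r *\<^sub>R e) $ 1 = ?x1 + r * fst e $ 1" "fst (x + r *\<^sub>R e) $ 2 = ?x2 + r * fst e $ 2"
      "snd (x + r *\<^sub>R e) = ?x3 + r * snd e" by simp_all
  have zeros1: "rescale c r a b1 t = 0" "rescale c r a \<beta>1 t = 0" if "r * s < \<bar>t - (a + r * fst e $ 1)\<bar>" for c a t
    using that supp1 r(1) by (auto intro: rescale_zero)
  have zeros2: "rescale c r a b2 t = 0" "rescale c r a \<beta>2 t = 0" "rescale c (l * r) a b2 t = 0"
    if "r * s < \<bar>t - (a + r * fst e $ 2)\<bar>" for c a t
    using that supp2 r(1) by (auto intro: rescale_zero rescale_l_zero)
  have zeros3: "rescale c r a b3 t = 0" "rescale c r a \<beta>3 t = 0" "rescale c (l * r) a b3 t = 0"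
    if "r * s < \<bar>t - (a + r * snd e)\<bar>" for c a t
    using that supp3 r(1) by (auto intro: rescale_zero rescale_l_zero)
  note zeros = zeros1 zeros2 zeros3
  note test_tensor = test_function_tensor[OF _ _ _ _ _ _ sub, unfolded center]
  have test: "test_function D \<Psi>1" "test_function D \<Psi>2" "test_function D \<Psi>3"
  proof -
    show "test_function D \<Psi>1" unfolding \<Psi>1_def
      by (rule test_tensor) (intro smooth_rescale smooth_kernels | (rule zeros, assumption))+
    show "test_function D \<Psi>2" unfolding \<Psi>2_def
      by (rule test_tensor) (intro smooth_rescale smooth_kernels | (rule zeros, assumption))+
    show "test_function D \<Psi>3" unfolding \<Psi>3_def
      by (rule test_tensor) (intro smooth_rescale smooth_kernels | (rule zeros, assumption))+
  qed
  have supp: "\<Psi>1 z = 0" "\<Psi>2 z = 0" "\<Psi>3 z = 0" if "z \<notin> cube (x + r *\<^sub>R e) (r * s)" for z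
  proof -
    from that consider "\<bar>fst z $ 1 - (?x1 + r * fst e $ 1)\<bar> > r * s"
      | "\<bar>fst z $ 2 - (?x2 + r * fst e $ 2)\<bar> > r * s" | "\<bar>snd z - (?x3 + r * snd e)\<bar> > r * s"
      unfolding cube_def center by force
    then show "\<Psi>1 z = 0" "\<Psi>2 z = 0" "\<Psi>3 z = 0"
      unfolding \<Psi>1_def \<Psi>2_def \<Psi>3_def tensor_def
      by (cases; simp only: zeros mult_zero_left mult_zero_right)+
  qed
  have lr: "0 < l * r" using l r by simp
  \<comment> \<open>Factors at scale r are also bounded through 1 / (l r), so that all three
    products obey the same bound.\<close>
  have le: "1 / r \<le> 1 / (l * r)" using l r by (simp add: field_simps)
  have bd: "\<bar>rescale r r a f t\<bar> \<le> r * C" "\<bar>rescale (1 / (l * r)) r' a f t\<bar> \<le> 1 / (l * r) * C"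
    "\<bar>rescale (1 / r) r' a f t\<bar> \<le> 1 / (l * r) * C"
    if "\<And>t. \<bar>f t\<bar> \<le> C" for a f t r'
  proof -
    show "\<bar>rescale r r a f t\<bar> \<le> r * C" "\<bar>rescale (1 / (l * r)) r' a f t\<bar> \<le> 1 / (l * r) * C"
      using that r l by (auto simp: rescale_def abs_mult intro!: divide_right_mono)
    have "\<bar>rescale (1 / r) r' a f t\<bar> \<le> 1 / r * C"
      using that r by (auto simp: rescale_def abs_mult intro!: divide_right_mono)
    also have "\<dots> \<le> 1 / (l * r) * C" using le C by (intro mult_right_mono) auto
    finally show "\<bar>rescale (1 / r) r' a f t\<bar> \<le> 1 / (l * r) * C" .
  qed
  have prod3: "\<bar>p * q * m\<bar> \<le> P * Q * M'" if "\<bar>p\<bar> \<le> P" "\<bar>q\<bar> \<le> Q" "\<bar>m\<bar> \<le> M'" for p q m P Q M' :: real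
    unfolding abs_mult by (intro mult_mono that mult_nonneg_nonneg) (use that in auto)
  have Ceq: "r * C * (1 / (l * r) * C) * (1 / (l * r) * C) = C ^ 3 / (l\<^sup>2 * r)"
      "1 / (l * r) * C * (r * C) * (1 / (l * r) * C) = C ^ 3 / (l\<^sup>2 * r)"
      "1 / (l * r) * C * (1 / (l * r) * C) * (r * C) = C ^ 3 / (l\<^sup>2 * r)"
    using r l by (simp_all add: field_simps power2_eq_square power3_eq_cube)
  have bounds: "\<bar>\<Psi>1 z\<bar> \<le> C ^ 3 / (l\<^sup>2 * r)" "\<bar>\<Psi>2 z\<bar> \<le> C ^ 3 / (l\<^sup>2 * r)" "\<bar>\<Psi>3 z\<bar> \<le> C ^ 3 / (l\<^sup>2 * r)" for z
    unfolding \<Psi>1_def \<Psi>2_def \<Psi>3_def tensor_def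
    by (subst Ceq(1)[symmetric], intro prod3 bd bound,
        subst Ceq(2)[symmetric], intro prod3 bd bound,
        subst Ceq(3)[symmetric], intro prod3 bd bound)
  have second: "dir_deriv 1 (dir_deriv 1 (rescale r r a \<beta>)) = (\<lambda>t. rescale (1 / (l * r)) (l * r) a b t - rescale (1 / r) r a b t)"
    if "smooth \<beta>" "\<And>y. dir_deriv 1 (dir_deriv 1 \<beta>) y = b (y / l) / l - b y" for a \<beta> b
    using that r l by (simp add: dir_deriv_rescale smooth_dir_deriv)
      (simp add: rescale_def fun_eq_iff field_simps)
  have eq: "kernel (l * r) x z - kernel r x z = dir_deriv e1 (dir_deriv e1 \<Psi>1) z
      + dir_deriv e2 (dir_deriv e2 \<Psi>2) z + dir_deriv e3 (dir_deriv e3 \<Psi>3) z" for z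
    unfolding \<Psi>1_def \<Psi>2_def \<Psi>3_def
    by (simp only: dir_deriv_tensor smooth_rescale smooth_kernels smooth_dir_deriv second[OF smooth_kernels(4) \<beta>''(1)]
        second[OF smooth_kernels(5) \<beta>''(2)] second[OF smooth_kernels(6) \<beta>''(3)])
      (simp add: kernel_def tensor_def algebra_simps)
  have dd_smooth: "smooth (dir_deriv b (dir_deriv b \<Psi>))" if "smooth \<Psi>" for b and \<Psi> :: "space \<Rightarrow> real"
    by (intro smooth_dir_deriv that)
  have int: "integrable N (\<lambda>z. K z *\<^sub>R f z)" if f: "f \<in> L2 N" and K: "smooth K" for K :: "space \<Rightarrow> real" and f
  proof -
    have "bounded (K ` closure D)"
      using D by (intro compact_imp_bounded compact_continuous_image smooth_continuous_on K)
        (simp add: compact_closure)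
    then obtain B where "\<And>z. z \<in> closure D \<Longrightarrow> \<bar>K z\<bar> \<le> B"
      unfolding bounded_iff by (metis image_eqI real_norm_def)
    then have B: "\<bar>K z\<bar> \<le> B" if "z \<in> D" for z using that closure_subset by blast
    have "integrable N f" 
      by (intro L2_integrable f finite_measure_lebesgue_on_open D)
    then have "integrable N (\<lambda>z. B * cmod (f z))" by auto
    then show ?thesis
    proof (rule Bochner_Integration.integrable_bound)
      show "(\<lambda>z. K z *\<^sub>R f z) \<in> borel_measurable N"
        by (intro borel_measurable_scaleR L2_D(1)[OF f]
            borel_measurable_lebesgue_on[OF borel_measurable_continuous_onI[OF smooth_continuous_on[OF K]]])
      show "AE z in N. norm (K z *\<^sub>R f z) \<le> norm (B * cmod (f z))"
        using B abs_ge_zero[of "K _"] by (intro AE_I2) (auto simp: abs_mult intro!: mult_right_mono order_trans[OF B abs_ge_self])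
    qed
  qed
  have ksm: "smooth (kernel r' x)" for r'
    unfolding kernel_def by (intro smooth_tensor smooth_rescale smooth_kernels)
  have "avg (l * r) x - avg r x = (\<integral>z. (kernel (l * r) x z - kernel r x z) *\<^sub>R u z \<partial>N)"
    unfolding avg_def using int[OF u ksm] by (simp add: scaleR_diff_left)
  also have "\<dots> = (\<integral>z. dir_deriv e1 (dir_deriv e1 \<Psi>1) z *\<^sub>R u z + dir_deriv e2 (dir_deriv e2 \<Psi>2) z *\<^sub>R u z
      + dir_deriv e3 (dir_deriv e3 \<Psi>3) z *\<^sub>R u z \<partial>N)"
    unfolding eq by (simp add: scaleR_add_left)
  also have "\<dots> = (\<integral>z. \<Psi>1 z *\<^sub>R g1 z \<partial>N) + (\<integral>z. \<Psi>2 z *\<^sub>R g2 z \<partial>N) + (\<integral>z. \<Psi>3 z *\<^sub>R g3 z \<partial>N)"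
    using int[OF u dd_smooth] sm weak(1)[OF test(1)] weak(2)[OF test(2)] weak(3)[OF test(3)] by simp
  finally have sum3: "avg (l * r) x - avg r x = (\<integral>z. \<Psi>1 z *\<^sub>R g1 z \<partial>N) + (\<integral>z. \<Psi>2 z *\<^sub>R g2 z \<partial>N) + (\<integral>z. \<Psi>3 z *\<^sub>R g3 z \<partial>N)" .
  have "cmod (avg (l * r) x - avg r x) \<le> cmod (\<integral>z. \<Psi>1 z *\<^sub>R g1 z \<partial>N) + cmod (\<integral>z. \<Psi>2 z *\<^sub>R g2 z \<partial>N) + cmod (\<integral>z. \<Psi>3 z *\<^sub>R g3 z \<partial>N)"
    unfolding sum3 by (intro norm_triangle_le add_right_mono norm_triangle_ineq)
  moreover have "cmod (\<integral>z. \<Psi> z *\<^sub>R h z \<partial>N) \<le> C ^ 3 / (2 * l\<^sup>2) * ((\<integral>z. (cmod (h z))\<^sup>2 \<partial>N) + 8 * s ^ 3) * sqrt r"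
    if h: "h \<in> L2 N" and "smooth \<Psi>" "\<And>z. \<bar>\<Psi> z\<bar> \<le> C ^ 3 / (l\<^sup>2 * r)"
      "\<And>z. z \<notin> cube (x + r *\<^sub>R e) (r * s) \<Longrightarrow> \<Psi> z = 0" for h \<Psi>
  proof -
    have m: "\<Psi> \<in> borel_measurable borel"
      using smooth_continuous_on[OF that(2), of UNIV] by (rule borel_measurable_continuous_onI)
    \<comment> \<open>The weight r sqrt r gives both terms of \<open>cube_integral_bound\<close> the
      order r sqrt r; the supremum of \<Psi> costs one factor r, and sqrt r remains.\<close>
    have "cmod (\<integral>z. \<Psi> z *\<^sub>R h z \<partial>N) \<le> C ^ 3 / (l\<^sup>2 * r) / 2 *
        ((r * sqrt r) * (\<integral>z. (cmod (h z))\<^sup>2 \<partial>N) + 8 * (r * s) ^ 3 / (r * sqrt r))"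
      using r s by (intro cube_integral_bound[OF D h m that(3,4)]) auto
    also have "8 * (r * s) ^ 3 / (r * sqrt r) = (r * sqrt r) * (8 * s ^ 3)"
    proof -
      have "8 * (r * s) ^ 3 = (r * sqrt r) * (8 * s ^ 3) * (r * sqrt r)"
        using r by (simp add: power_mult_distrib power3_eq_cube)
      then show ?thesis using r by (simp add: field_simps)
    qed
    also have "C ^ 3 / (l\<^sup>2 * r) / 2 * ((r * sqrt r) * (\<integral>z. (cmod (h z))\<^sup>2 \<partial>N) + (r * sqrt r) * (8 * s ^ 3))
       = C ^ 3 / (2 * l\<^sup>2) * ((\<integral>z. (cmod (h z))\<^sup>2 \<partial>N) + 8 * s ^ 3) * sqrt r"
      using r l by (simp add: field_simps)
    finally show ?thesis .
  qed
  note this[OF g(1) sm(1) bounds(1) supp(1)] this[OF g(2) sm(2) bounds(2) supp(2)] this[OF g(3) sm(3) bounds(3) supp(3)]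
  ultimately show ?thesis
    unfolding diff_const_def by (simp add: algebra_simps add_divide_distrib)
qed

end

lemma cube_dist:
  assumes "z \<in> cube c \<rho>" "0 \<le> \<rho>"
  shows "dist c z \<le> 3 * \<rho>"
proof -
  have "norm (z - c) \<le> (\<Sum>b\<in>Basis. \<bar>(z - c) \<bullet> b\<bar>)"
    by (rule norm_le_l1)
  also have "\<dots> = \<bar>fst z $ 1 - fst c $ 1\<bar> + \<bar>fst z $ 2 - fst c $ 2\<bar> + \<bar>snd z - snd c\<bar>"
    by (cases z, cases c) (simp add: Basis_space axis_eq_axis inner_axis)
  also have "\<dots> \<le> 3 * \<rho>" using assms by (simp add: cube_def)
  finally show ?thesis by (simp add: dist_norm norm_minus_commute)
qed

lemma cube_subset_ball:
  assumes "0 < \<rho>" "0 < s"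
  shows "\<exists>r0>0. \<forall>y\<in>ball x (\<rho> / 2). \<forall>r. 0 < r \<and> r \<le> r0 \<longrightarrow> cube (y + r *\<^sub>R e) (r * s) \<subseteq> ball x \<rho>"
proof -
  \<comment> \<open>Every point of the displaced cube is within r (norm e + 3 s) of y; the added 1
    keeps m positive.\<close>
  define m where "m = norm e + 3 * s + 1"
  have m: "m > 0" using assms by (simp add: m_def add_nonneg_pos)
  have "cube (y + r *\<^sub>R e) (r * s) \<subseteq> ball x \<rho>" if y: "y \<in> ball x (\<rho> / 2)" and r: "0 < r" "r \<le> \<rho> / (2 * m)" for y r
  proof
    fix z assume z: "z \<in> cube (y + r *\<^sub>R e) (r * s)"
    have "dist (y + r *\<^sub>R e) z \<le> 3 * (r * s)" using cube_dist[OF z] r assms by simp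
    moreover have "dist y (y + r *\<^sub>R e) = r * norm e" using r by (simp add: dist_norm)
    ultimately have "dist y z \<le> r * norm e + 3 * (r * s)"
      using dist_triangle[of y z "y + r *\<^sub>R e"] by simp
    also have "\<dots> \<le> r * m" using r by (simp add: m_def algebra_simps)
    also have "\<dots> \<le> \<rho> / 2" using r m by (simp add: field_simps)
    finally show "z \<in> ball x \<rho>" using y dist_triangle[of x z y] by simp
  qed
  moreover have "\<rho> / (2 * m) > 0" using assms m by simp
  ultimately show ?thesis by blast
qed

section \<open>Uniform convergence of the averages\<close>

context averaging
begin

text \<open>One threshold \<open>r0\<close> serves all of X; this uniformity makes the convergence
  uniform and the limit continuous, also where X touches the boundary of D.\<close>

definition admissible :: "space set \<Rightarrow> bool" where
  "admissible X \<longleftrightarrow> (\<exists>r0>0. \<forall>x\<in>X. \<forall>r. 0 < r \<and> r \<le> r0 \<longrightarrow> cube (x + r *\<^sub>R e) (r * s) \<subseteq> D)"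

definition limit_avg :: "space \<Rightarrow> complex" where
  "limit_avg x = lim (\<lambda>n. avg (l ^ n) x)"

lemma D_sets [simp, measurable]: "D \<in> sets borel" "D \<in> sets lebesgue"
  using D by auto

lemma u_integrable: "integrable N u"
  by (intro L2_integrable u finite_measure_lebesgue_on_open D)

lemma kernel_bound: "0 < r \<Longrightarrow> \<bar>kernel r x z\<bar> \<le> (C / r) ^ 3"
proof -
  assume r: "0 < r"
  have "\<bar>rescale (1 / r) r a b t\<bar> \<le> C / r" if "\<And>t. \<bar>b t\<bar> \<le> C" for a t b
    using that r by (auto simp: rescale_def abs_mult intro!: divide_right_mono)
  note b = this[OF bound(1)] this[OF bound(2)] this[OF bound(3)]
  have "0 \<le> C / r" using C r by simp
  then show ?thesis
    unfolding kernel_def tensor_def abs_mult power3_eq_cube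
    by (intro mult_mono b mult_nonneg_nonneg) auto
qed

lemma kernel_supp:
  assumes "0 < r" "z \<notin> cube (x + r *\<^sub>R e) (r * s)"
  shows "kernel r x z = 0"
proof -
  from assms(2) consider "\<bar>fst z $ 1 - (fst x $ 1 + r * fst e $ 1)\<bar> > r * s"
    | "\<bar>fst z $ 2 - (fst x $ 2 + r * fst e $ 2)\<bar> > r * s" | "\<bar>snd z - (snd x + r * snd e)\<bar> > r * s"
    unfolding cube_def by force
  then show ?thesis
    unfolding kernel_def tensor_def
    using rescale_zero[where f = b1, OF _ assms(1)] rescale_zero[where f = b2, OF _ assms(1)]
      rescale_zero[where f = b3, OF _ assms(1)] supp1(1) supp2(1) supp3(1)
    by cases (metis mult_zero_left mult_zero_right)+
qed

lemma kernel_measurable [measurable]: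
  "(\<lambda>w. kernel r (fst w) (snd w)) \<in> borel_measurable borel"
  unfolding kernel_def tensor_def rescale_def divide_inverse
  by (intro borel_measurable_continuous_onI continuous_intros
      continuous_on_compose2[OF smooth_continuous_on[OF smooth_kernels(1), of UNIV]]
      continuous_on_compose2[OF smooth_continuous_on[OF smooth_kernels(2), of UNIV]]
      continuous_on_compose2[OF smooth_continuous_on[OF smooth_kernels(3), of UNIV]]) auto

text \<open>The integration is over the base point x, not over z, since the kernel will be
  integrated in x over a box. It depends on z - x only, so this is the mass of the reflected kernel,
  and the substitution has the negative slope - 1 / r.\<close>

lemma kernel_mass: 
  assumes "0 < r"
  shows "(\<integral>x. kernel r x z \<partial>lborel) = 1"
proof -
  define f where "f a b t = b ((a - t) / r) / r" for a t :: real and b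
  have i: "integrable lborel b" if "integral\<^sup>L lborel b = 1" for b :: "real \<Rightarrow> real"
    using that not_integrable_integral_eq by fastforce
  have f: "integrable lborel (f a b)" "integral\<^sup>L lborel (f a b) = 1" 
    if "integral\<^sup>L lborel b = 1" for a and b :: "real \<Rightarrow> real"
  proof -
    have "(\<lambda>t. b ((a - t) / r)) = (\<lambda>t. b (a / r + (- (1 / r)) * t))"
      by (simp add: diff_divide_distrib)
    then show "integrable lborel (f a b)" "integral\<^sup>L lborel (f a b) = 1"
      using lborel_integrable_real_affine[OF i[OF that], of "- (1 / r)" "a / r"]
        lborel_integral_real_affine[of "- (1 / r)" b "a / r"] that assms
      by (simp_all add: f_def[abs_def] field_simps)
  qed
  have "(\<lambda>x. kernel r x z) = tensor (f (fst z $ 1) b1) (f (fst z $ 2) b2) (f (snd z) b3)"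
    by (simp add: fun_eq_iff kernel_def tensor_def rescale_def f_def)
  then show ?thesis
    using integral_tensor[OF f(1)[OF mass(1)] f(1)[OF mass(2)] f(1)[OF mass(3)]] f(2) mass by simp
qed

lemma kernel_measurable_z: "kernel r x \<in> borel_measurable borel"
  unfolding kernel_def by (intro borel_measurable_tensor smooth_rescale smooth_kernels)

lemma integrable_kernel_mult: "0 < r \<Longrightarrow> integrable N (\<lambda>z. kernel r x z *\<^sub>R u z)"
  by (rule integrable_bounded_scaleR[OF u_integrable borel_measurable_lebesgue_on[OF kernel_measurable_z] kernel_bound])

lemma avg_bound: "0 < r \<Longrightarrow> cmod (avg r x) \<le> (C / r) ^ 3 * (\<integral>z. cmod (u z) \<partial>N)"
proof -
  assume r: "0 < r"
  have "cmod (avg r x) \<le> (\<integral>z. (C / r) ^ 3 * cmod (u z) \<partial>N)"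
    unfolding avg_def using u_integrable
    by (intro Bochner_Integration.integral_norm_bound_integral integrable_kernel_mult r)
      (auto simp: kernel_bound[OF r] mult_right_mono)
  then show ?thesis by simp
qed

lemma avg_continuous: 
  assumes r: "0 < r"
  shows "continuous_on UNIV (avg r)"
proof (rule continuous_on_sequentiallyI)
  fix X :: "nat \<Rightarrow> space" and a assume X: "X \<longlonglongrightarrow> a"
  show "(\<lambda>n. avg r (X n)) \<longlonglongrightarrow> avg r a"
    unfolding avg_def
  proof (rule integral_dominated_convergence)
    show "integrable N (\<lambda>z. (C / r) ^ 3 * cmod (u z))" using u_integrable by auto
    have "(\<lambda>n. kernel r (X n) z) \<longlonglongrightarrow> kernel r a z" for z
    proof -
      have "isCont b t" if "smooth b" for b :: "real \<Rightarrow> real" and t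
        using smooth_continuous_on[OF that, of UNIV] by (simp add: continuous_on_eq_continuous_at)
      note ic = isCont_tendsto_compose[OF this[OF smooth_kernels(1)]] isCont_tendsto_compose[OF this[OF smooth_kernels(2)]]
        isCont_tendsto_compose[OF this[OF smooth_kernels(3)]]
      show ?thesis
        unfolding kernel_def tensor_def rescale_def
        using r by (intro tendsto_intros ic X) auto
    qed
    then show "AE z in N. (\<lambda>n. kernel r (X n) z *\<^sub>R u z) \<longlonglongrightarrow> kernel r a z *\<^sub>R u z"
      by (intro AE_I2 tendsto_intros)
    show "AE z in N. norm (kernel r (X n) z *\<^sub>R u z) \<le> (C / r) ^ 3 * cmod (u z)" for n
      by (auto simp: kernel_bound[OF r] mult_right_mono)
  qed (use integrable_kernel_mult[OF r] in \<open>auto dest: borel_measurable_integrable\<close>)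
qed

lemma l_power: "0 < l ^ n" "l ^ n \<le> 1"
  using l by (auto intro: power_le_one)

text \<open>Along the scales l^n the bound of \<open>avg_diff\<close> is a geometric series in sqrt
  l, so the telescoping sum converges by the Weierstrass test.\<close>

lemma uniform_limit_avg:
  assumes "admissible X"
  shows "uniform_limit X (\<lambda>n. avg (l ^ n)) limit_avg sequentially"
proof -
  obtain r0 where r0: "0 < r0" "\<And>x r. x \<in> X \<Longrightarrow> 0 < r \<Longrightarrow> r \<le> r0 \<Longrightarrow> cube (x + r *\<^sub>R e) (r * s) \<subseteq> D"
    using assms unfolding admissible_def by blast
  have "(\<lambda>n. l ^ n) \<longlonglongrightarrow> 0" using l by (intro LIMSEQ_power_zero) simp
  then have "eventually (\<lambda>n. l ^ n < r0) sequentially"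
    using r0(1) by (rule order_tendstoD)
  then have "eventually (\<lambda>n. \<forall>x\<in>X. norm (avg (l ^ Suc n) x - avg (l ^ n) x) \<le> diff_const * sqrt l ^ n) sequentially"
  proof eventually_elim
    case (elim n)
    then show ?case
      using avg_diff[OF l_power(1)[of n] l_power(2)[of n]] r0(2)[of _ "l ^ n"] l_power[of n] by (simp add: real_sqrt_power)
  qed
  moreover have "summable (\<lambda>n. diff_const * sqrt l ^ n)"
    using l by (intro summable_mult summable_geometric) simp
  ultimately have "uniform_limit X (\<lambda>n x. \<Sum>i<n. avg (l ^ Suc i) x - avg (l ^ i) x)
      (\<lambda>x. \<Sum>i. avg (l ^ Suc i) x - avg (l ^ i) x) sequentially"
    by (rule Weierstrass_m_test_ev)
  then have "uniform_limit X (\<lambda>n x. (\<Sum>i<n. avg (l ^ Suc i) x - avg (l ^ i) x) + avg 1 x)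
      (\<lambda>x. (\<Sum>i. avg (l ^ Suc i) x - avg (l ^ i) x) + avg 1 x) sequentially"
    by (intro uniform_limit_add uniform_limit_const)
  then have "uniformly_convergent_on X (\<lambda>n. avg (l ^ n))"
    unfolding uniformly_convergent_on_def
    by (subst (asm) sum_lessThan_telescope) (auto intro!: exI)
  then show ?thesis
    unfolding uniformly_convergent_uniform_limit_iff limit_avg_def[abs_def] .
qed

lemma continuous_on_limit_avg:
  assumes "\<And>x. x \<in> S \<Longrightarrow> \<exists>\<delta>>0. admissible (S \<inter> ball x \<delta>)"
  shows "continuous_on S limit_avg"
  unfolding continuous_on_eq_continuous_within
proof
  fix x assume x: "x \<in> S"
  then obtain \<delta> where \<delta>: "\<delta> > 0" "admissible (S \<inter> ball x \<delta>)" using assms by blast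
  have "continuous_on (S \<inter> ball x \<delta>) limit_avg"
  proof (rule uniform_limit_theorem[OF _ uniform_limit_avg[OF \<delta>(2)]])
    show "\<forall>\<^sub>F n in sequentially. continuous_on (S \<inter> ball x \<delta>) (avg (l ^ n))"
      using avg_continuous[OF l_power(1)] continuous_on_subset by (intro always_eventually) blast
  qed simp
  then have "continuous (at x within (S \<inter> ball x \<delta>)) limit_avg"
    using x \<delta>(1) by (simp add: continuous_on_eq_continuous_within)
  moreover have "at x within (S \<inter> ball x \<delta>) = at x within S"
    using \<delta>(1) by (intro at_within_nhd[of x "ball x \<delta>"]) auto
  ultimately show "continuous (at x within S) limit_avg" by simp
qed

lemma admissible_ball:
  assumes "ball x \<rho> \<subseteq> D" "0 < \<rho>"
  shows "admissible (ball x (\<rho> / 2))"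
  using cube_subset_ball[OF assms(2) s, of x e] assms(1) unfolding admissible_def by (meson order_trans)

end

section \<open>The limit of the averages is a representative\<close>

context averaging
begin

text \<open>Extension by zero, so that Fubini can be applied with \<open>lborel\<close> in both
  variables.\<close>

definition u0 :: "space \<Rightarrow> complex" where
  "u0 z = indicator D z *\<^sub>R u z"

lemma u0_measurable [measurable]: "u0 \<in> borel_measurable borel"
  unfolding u0_def[abs_def] by measurable

lemma integral_N: "f \<in> borel_measurable borel \<Longrightarrow> (\<integral>z. f z \<partial>N) = (\<integral>z. indicator D z *\<^sub>R f z \<partial>lborel)"
  for f :: "space \<Rightarrow> complex"
  by (subst integral_restrict_space) (auto intro!: integral_completion)

lemma u0_integrable: "integrable lborel u0"
proof -
  have "integrable lebesgue u0"
    using u_integrable unfolding u0_def[abs_def] by (subst (asm) integrable_restrict_space) auto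
  then show ?thesis
    by (subst (asm) integrable_completion) auto
qed

lemma avg_eq: "0 < r \<Longrightarrow> avg r x = (\<integral>z. kernel r x z *\<^sub>R u0 z \<partial>lborel)"
proof -
  have [measurable]: "kernel r x \<in> borel_measurable borel" by (rule kernel_measurable_z)
  show ?thesis
    unfolding avg_def by (subst integral_N) (auto simp: u0_def mult.commute intro!: Bochner_Integration.integral_cong)
qed

lemma box_average:
  assumes r: "0 < r" and Q: "Q \<in> sets borel" "bounded Q"
  shows "(\<integral>x. indicator Q x *\<^sub>R avg r x \<partial>lborel) =
    (\<integral>z. (\<integral>x. indicator Q x * kernel r x z \<partial>lborel) *\<^sub>R u0 z \<partial>lborel)"
proof -
  have [measurable]: "Q \<in> sets borel" by fact
  have [measurable]: "(\<lambda>w. kernel r (fst w) (snd w)) \<in> borel_measurable (borel \<Otimes>\<^sub>M borel)"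
    using kernel_measurable[of r] by (simp add: borel_prod)
  have Qi: "integrable lborel (\<lambda>x. indicator Q x :: real)"
    using Q emeasure_bounded_finite[of Q] by (intro integrable_real_indicator) auto
  have Qk: "integrable lborel (\<lambda>x. indicator Q x * kernel r x z)" for z
  proof (rule Bochner_Integration.integrable_bound[OF integrable_mult_left[OF Qi, of "(C / r) ^ 3"]])
    have "(\<lambda>x. kernel r (fst (x, z)) (snd (x, z))) \<in> borel_measurable borel"
      by measurable
    then show "(\<lambda>x. indicator Q x * kernel r x z) \<in> borel_measurable lborel"
      by simp
    show "AE x in lborel. norm (indicator Q x * kernel r x z) \<le> norm (indicator Q x * (C / r) ^ 3)"
      using order_trans[OF kernel_bound[OF r] abs_ge_self] by (auto simp: indicator_def)
  qed
  have prod: "integrable (lborel \<Otimes>\<^sub>M lborel) (\<lambda>w. (indicator Q (fst w) * cmod (u0 (snd w))) * (C / r) ^ 3)"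
    using lborel_product_integral(1)[OF Qi integrable_norm[OF u0_integrable]]
    by (intro integrable_mult_left) (simp add: lborel_prod)
  have "integrable (lborel \<Otimes>\<^sub>M lborel) (\<lambda>w. (indicator Q (fst w) * kernel r (fst w) (snd w)) *\<^sub>R u0 (snd w))"
  proof (rule Bochner_Integration.integrable_bound[OF prod])
    show "AE w in lborel \<Otimes>\<^sub>M lborel. norm ((indicator Q (fst w) * kernel r (fst w) (snd w)) *\<^sub>R u0 (snd w))
        \<le> norm ((indicator Q (fst w) * cmod (u0 (snd w))) * (C / r) ^ 3)"
    proof (rule AE_I2)
      fix w
      have "\<bar>kernel r (fst w) (snd w)\<bar> * cmod (u0 (snd w)) \<le> (C / r) ^ 3 * cmod (u0 (snd w))"
        by (rule mult_right_mono[OF kernel_bound[OF r]]) simp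
      then show "norm ((indicator Q (fst w) * kernel r (fst w) (snd w)) *\<^sub>R u0 (snd w))
        \<le> norm ((indicator Q (fst w) * cmod (u0 (snd w))) * (C / r) ^ 3)"
        using C r by (cases "fst w \<in> Q") (simp_all add: abs_mult mult.commute)
    qed
  qed measurable
  then have int: "integrable (lborel \<Otimes>\<^sub>M lborel) (case_prod (\<lambda>x z. (indicator Q x * kernel r x z) *\<^sub>R u0 z))"
    unfolding case_prod_unfold .
  have "(\<integral>x. indicator Q x *\<^sub>R avg r x \<partial>lborel) = (\<integral>x. \<integral>z. (indicator Q x * kernel r x z) *\<^sub>R u0 z \<partial>lborel \<partial>lborel)"
    by (intro Bochner_Integration.integral_cong refl) (simp add: avg_eq[OF r] scaleR_scaleR[symmetric] del: scaleR_scaleR)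
  also have "\<dots> = (\<integral>z. \<integral>x. (indicator Q x * kernel r x z) *\<^sub>R u0 z \<partial>lborel \<partial>lborel)"
    by (rule lborel_pair.Fubini_integral[OF int, symmetric])
  finally show ?thesis using Qk by simp
qed

text \<open>Height (C / r)^3 times volume 8 (r s)^3 is independent of r, which makes it a dominating
  constant for r tending to 0.\<close>

lemma kernel_window_bound:
  assumes "0 < r" "Q \<in> sets borel"
  shows "\<bar>\<integral>x. indicator Q x * kernel r x z \<partial>lborel\<bar> \<le> 8 * C ^ 3 * s ^ 3"
proof -
  have [measurable]: "cube a \<rho> \<in> sets borel" for a \<rho>
    using compact_cube by (intro borel_closed compact_imp_closed)
  let ?c = "cube (z - r *\<^sub>R e) (r * s)"
  have eq: "z \<in> cube (x + r *\<^sub>R e) (r * s) \<longleftrightarrow> x \<in> ?c" for x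
    by (auto simp: cube_def abs_le_iff algebra_simps)
  have "\<bar>\<integral>x. indicator Q x * kernel r x z \<partial>lborel\<bar> \<le> (\<integral>x. (C / r) ^ 3 * indicator ?c x \<partial>lborel)"
  proof (cases "integrable lborel (\<lambda>x. indicator Q x * kernel r x z)")
    case True
    have "norm (\<integral>x. indicator Q x * kernel r x z \<partial>lborel) \<le> (\<integral>x. (C / r) ^ 3 * indicator ?c x \<partial>lborel)"
    proof (rule Bochner_Integration.integral_norm_bound_integral[OF True])
      show "integrable lborel (\<lambda>x. (C / r) ^ 3 * indicator ?c x)"
        using emeasure_bounded_finite[OF compact_imp_bounded[OF compact_cube]]
        by (intro integrable_mult_right integrable_real_indicator) auto
      show "norm (indicator Q x * kernel r x z) \<le> (C / r) ^ 3 * indicator ?c x" for x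
      proof (cases "x \<in> ?c")
        case True
        then show ?thesis using kernel_bound[OF assms(1), of x z] C assms(1) by (auto simp: indicator_def)
      next
        case False
        then show ?thesis using kernel_supp[OF assms(1), of z x] eq by simp
      qed
    qed
    then show ?thesis by simp
  next
    case False
    then show ?thesis using C assms by (simp add: not_integrable_integral_eq)
  qed
  also have "\<dots> = (C / r) ^ 3 * (8 * (r * s) ^ 3)"
    using measure_cube[of "r * s" "z - r *\<^sub>R e"] assms s by (simp add: measure_def)
  also have "\<dots> = 8 * C ^ 3 * s ^ 3"
    using assms by (simp add: power_mult_distrib power_divide)
  finally show ?thesis .
qed

text \<open>Off the frontier, all x whose kernel reaches z lie on the same side of Q as z once the
  scale is small. The integral then equals the indicator exactly, because the mass is 1.\<close>

lemma kernel_window_limit: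
  assumes "z \<notin> frontier Q"
  shows "(\<lambda>n. \<integral>x. indicator Q x * kernel (l ^ n) x z \<partial>lborel) \<longlonglongrightarrow> indicator Q z"
proof -
  obtain \<epsilon> where \<epsilon>: "\<epsilon> > 0" "\<And>x. dist z x < \<epsilon> \<Longrightarrow> x \<in> Q \<longleftrightarrow> z \<in> Q"
  proof (cases "z \<in> Q")
    case True
    then have "z \<in> interior Q" using assms closure_subset[of Q] by (auto simp: frontier_def)
    then show ?thesis using that True by (auto simp: mem_interior subset_iff)
  next
    case False
    then have "z \<in> interior (- Q)" using assms interior_subset[of Q] by (auto simp: frontier_def interior_complement)
    then show ?thesis using that False by (auto simp: mem_interior subset_iff)
  qed
  define m where "m = norm e + 3 * s + 1"
  have m: "m > 0" using s by (simp add: m_def add_nonneg_pos)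
  have "(\<lambda>n. l ^ n) \<longlonglongrightarrow> 0" using l by (intro LIMSEQ_power_zero) simp
  then have "eventually (\<lambda>n. l ^ n < \<epsilon> / m) sequentially"
    using \<epsilon>(1) m by (intro order_tendstoD(2)[of _ 0]) auto
  then have "eventually (\<lambda>n. (\<integral>x. indicator Q x * kernel (l ^ n) x z \<partial>lborel) = indicator Q z) sequentially"
  proof eventually_elim
    case (elim n)
    let ?r = "l ^ n"
    have r: "0 < ?r" by (rule l_power)
    have "indicator Q x * kernel ?r x z = indicator Q z * kernel ?r x z" for x
    proof (cases "z \<in> cube (x + ?r *\<^sub>R e) (?r * s)")
      case True
      have "dist (x + ?r *\<^sub>R e) z \<le> 3 * (?r * s)" using cube_dist[OF True] r s by simp
      moreover have "dist x (x + ?r *\<^sub>R e) = ?r * norm e" using r by (simp add: dist_norm)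
      ultimately have "dist x z \<le> ?r * norm e + 3 * (?r * s)"
        using dist_triangle[of x z "x + ?r *\<^sub>R e"] by simp
      also have "\<dots> < ?r * m" using r by (simp add: m_def algebra_simps)
      also have "\<dots> < \<epsilon>" using elim m by (simp add: field_simps)
      finally have "x \<in> Q \<longleftrightarrow> z \<in> Q" using \<epsilon>(2)[of x] by (simp add: dist_commute)
      then show ?thesis by (simp add: indicator_def)
    next
      case False
      then show ?thesis using kernel_supp[OF r] by simp
    qed
    then have "(\<lambda>x. indicator Q x * kernel ?r x z) = (\<lambda>x. indicator Q z * kernel ?r x z)" by blast
    then show ?case using kernel_mass[OF r] by simp
  qed
  then show ?thesis by (rule tendsto_eventually)
qed

text \<open>The integral of an average over a box is computed in two ways: directly, by convergence
  of the averages, and after Fubini, where the averaging has moved to the indicator of the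
  box.\<close>

lemma box_integral_limit_avg:
  assumes X: "admissible X" and Q: "box a b \<subseteq> X"
  shows "integrable lborel (\<lambda>x. indicator (box a b) x *\<^sub>R limit_avg x)"
    and "(\<integral>x. indicator (box a b) x *\<^sub>R limit_avg x \<partial>lborel) = (\<integral>x. indicator (box a b) x *\<^sub>R u0 x \<partial>lborel)"
proof -
  let ?Q = "box a b"
  have avg_m [measurable]: "avg r \<in> borel_measurable borel" if "0 < r" for r
    by (intro borel_measurable_continuous_onI avg_continuous that)
  have lim: "(\<lambda>n. avg (l ^ n) x) \<longlonglongrightarrow> limit_avg x" if "x \<in> X" for x
    using tendsto_uniform_limitI[OF uniform_limit_avg[OF X] that] .
  obtain n0 where n0: "\<And>n x. n \<ge> n0 \<Longrightarrow> x \<in> X \<Longrightarrow> dist (avg (l ^ n) x) (limit_avg x) < 1"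
    using uniform_limitD[OF uniform_limit_avg[OF X], of 1] unfolding eventually_sequentially by auto
  \<comment> \<open>\<open>avg_bound\<close> degenerates for small r, so it is used at the fixed
    scale l^n0 only. Later averages stay within 1 + 1 of that one through their common
    limit.\<close>
  define B where "B = (C / l ^ n0) ^ 3 * (\<integral>z. cmod (u z) \<partial>N) + 2"
  have B: "cmod (avg (l ^ n) x) \<le> B" if "n \<ge> n0" "x \<in> X" for n x
  proof -
    have "dist (avg (l ^ n) x) (avg (l ^ n0) x) < 2"
      using n0[OF that] n0[OF order_refl that(2)] dist_triangle2[of "avg (l ^ n) x" "avg (l ^ n0) x" "limit_avg x"] by simp
    then show ?thesis
      using avg_bound[OF l_power(1), of n0 x] norm_triangle_ineq2[of "avg (l ^ n) x" "avg (l ^ n0) x"]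
      by (simp add: B_def dist_norm)
  qed
  have B0: "B \<ge> 0" unfolding B_def using C l_power(1)[of n0] by (intro add_nonneg_nonneg mult_nonneg_nonneg) auto
  let ?f = "\<lambda>n x. indicator ?Q x *\<^sub>R avg (l ^ (n + n0)) x"
  have wi: "integrable lborel (\<lambda>x. B * indicator ?Q x)"
    using emeasure_bounded_finite[OF bounded_box]
    by (intro integrable_mult_right integrable_real_indicator) auto
  have fm: "?f n \<in> borel_measurable lborel" for n
    using avg_m[OF l_power(1), of "n + n0"] by measurable
  have ptw: "(\<lambda>n. ?f n x) \<longlonglongrightarrow> indicator ?Q x *\<^sub>R limit_avg x" for x
  proof (cases "x \<in> ?Q")
    case True
    then show ?thesis using LIMSEQ_ignore_initial_segment[OF lim, of x n0] Q by auto
  qed auto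
  have gm: "(\<lambda>x. indicator ?Q x *\<^sub>R limit_avg x) \<in> borel_measurable lborel"
    by (rule borel_measurable_LIMSEQ_metric[OF fm ptw])
  have dom: "norm (?f n x) \<le> B * indicator ?Q x" for n x
    using B[of "n + n0" x] Q B0 by (auto simp: indicator_def)
  show "integrable lborel (\<lambda>x. indicator (box a b) x *\<^sub>R limit_avg x)"
    by (rule integrable_dominated_convergence[OF gm fm wi]) (rule AE_I2, rule ptw dom)+
  have 1: "(\<lambda>n. integral\<^sup>L lborel (?f n)) \<longlonglongrightarrow> (\<integral>x. indicator ?Q x *\<^sub>R limit_avg x \<partial>lborel)"
    by (rule integral_dominated_convergence[OF gm fm wi]) (rule AE_I2, rule ptw dom)+
  let ?h = "\<lambda>n z. (\<integral>x. indicator ?Q x * kernel (l ^ n) x z \<partial>lborel) *\<^sub>R u0 z"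
  have "(\<lambda>n. integral\<^sup>L lborel (?h n)) \<longlonglongrightarrow> (\<integral>z. indicator ?Q z *\<^sub>R u0 z \<partial>lborel)"
  proof (rule integral_dominated_convergence)
    show "integrable lborel (\<lambda>z. 8 * C ^ 3 * s ^ 3 * cmod (u0 z))"
      using u0_integrable by auto
    show "?h n \<in> borel_measurable lborel" for n
    proof -
      have [measurable]: "(\<lambda>w. kernel (l ^ n) (fst w) (snd w)) \<in> borel_measurable (borel \<Otimes>\<^sub>M borel)"
        using kernel_measurable[of "l ^ n"] by (simp add: borel_prod)
      have "(\<lambda>w. indicator ?Q (snd w) * kernel (l ^ n) (snd w) (fst w)) \<in> borel_measurable (lborel \<Otimes>\<^sub>M lborel)"
        using measurable_compose[OF measurable_pair_swap', of "\<lambda>w. kernel (l ^ n) (fst w) (snd w)" borel borel borel]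
        by (simp add: split_beta)
      then have [measurable]: "(\<lambda>z. \<integral>x. indicator ?Q x * kernel (l ^ n) x z \<partial>lborel) \<in> borel_measurable lborel"
        by (intro lborel.borel_measurable_lebesgue_integral) (simp add: split_beta)
      show ?thesis by measurable
    qed
    have "frontier ?Q \<in> null_sets lborel"
    proof -
      have "negligible (frontier ?Q)" by (intro negligible_convex_frontier convex_box)
      then show ?thesis
        by (simp add: negligible_iff_null_sets null_sets_completion_iff borel_closed frontier_closed)
    qed
    then show "AE z in lborel. (\<lambda>n. ?h n z) \<longlonglongrightarrow> indicator ?Q z *\<^sub>R u0 z"
      by (rule AE_mp[OF AE_not_in]) (auto intro!: AE_I2 tendsto_intros kernel_window_limit)
    show "AE z in lborel. norm (?h n z) \<le> 8 * C ^ 3 * s ^ 3 * cmod (u0 z)" for n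
      using kernel_window_bound[OF l_power(1), of ?Q n] by (auto intro!: AE_I2 mult_right_mono)
  qed measurable
  moreover have "integral\<^sup>L lborel (?h n) = (\<integral>x. indicator ?Q x *\<^sub>R avg (l ^ n) x \<partial>lborel)" for n
    by (rule box_average[symmetric, OF l_power(1)]) auto
  ultimately have "(\<lambda>n. \<integral>x. indicator ?Q x *\<^sub>R avg (l ^ n) x \<partial>lborel) \<longlonglongrightarrow> (\<integral>z. indicator ?Q z *\<^sub>R u0 z \<partial>lborel)"
    by simp
  from LIMSEQ_unique[OF 1 LIMSEQ_ignore_initial_segment[OF this, of n0]]
  show "(\<integral>x. indicator (box a b) x *\<^sub>R limit_avg x \<partial>lborel) = (\<integral>x. indicator (box a b) x *\<^sub>R u0 x \<partial>lborel)" .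
qed

text \<open>Box integrals determine an integrable function almost everywhere, and every point of D
  has a box on which \<open>box_integral_limit_avg\<close> applies.\<close>

lemma AE_limit_avg: "AE x in N. u x = limit_avg x"
proof -
  have loc: "\<exists>a b. x \<in> box a b \<and> (AE z in lborel. z \<in> box a b \<longrightarrow> u0 z = limit_avg z)" if x: "x \<in> D" for x
  proof -
    obtain \<rho> where \<rho>: "\<rho> > 0" "ball x \<rho> \<subseteq> D" using D(1) x open_contains_ball by blast
    obtain a b where ab: "x \<in> box a b" "box a b \<subseteq> ball x (\<rho> / 2)"
      using rational_boxes[of "\<rho> / 2" x] \<rho>(1) by auto
    note adm = admissible_ball[OF \<rho>(2,1)]
    let ?f = "\<lambda>z. indicator (box a b) z *\<^sub>R (limit_avg z - u0 z)"
    have u0i: "integrable lborel (\<lambda>z. indicator (box c d) z *\<^sub>R u0 z)" for c d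
      by (intro integrable_mult_indicator u0_integrable) auto
    have fi: "integrable lborel (\<lambda>z. indicator (box c d) z *\<^sub>R (limit_avg z - u0 z))"
       and f0: "(\<integral>z. indicator (box c d) z *\<^sub>R (limit_avg z - u0 z) \<partial>lborel) = 0" if "box c d \<subseteq> box a b" for c d
      using box_integral_limit_avg[OF adm, of c d] u0i[of c d] that ab(2)
      by (auto simp: scaleR_diff_right)
    have "AE z in lborel. ?f z = 0"
    proof (rule AE_zero_if_box_integrals_zero)
      fix c d
      obtain c' d' where cd: "box c d \<inter> box a b = box c' d'" using box_Int_box[of c d a b] by blast
      have "set_lebesgue_integral lborel (box c d) ?f = (\<integral>z. indicator (box c' d') z *\<^sub>R (limit_avg z - u0 z) \<partial>lborel)"
        unfolding set_lebesgue_integral_def cd[symmetric]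
        by (intro Bochner_Integration.integral_cong) (auto simp: indicator_def)
      also have "\<dots> = 0" by (rule f0) (use cd in auto)
      finally show "set_lebesgue_integral lborel (box c d) ?f = 0" .
    qed (use fi f0 in auto)
    then show ?thesis using ab(1) by (intro exI[of _ a] exI[of _ b]) (auto simp: indicator_def)
  qed
  \<comment> \<open>Lindelof reduces the local statements to countably many, so that the exceptional
    sets still form a null set.\<close>
  define \<F> where "\<F> = {box a b |a b. AE z in lborel. z \<in> box a b \<longrightarrow> u0 z = limit_avg z}"
  have "\<And>S. S \<in> \<F> \<Longrightarrow> open S" by (auto simp: \<F>_def)
  then obtain \<F>' where \<F>': "\<F>' \<subseteq> \<F>" "countable \<F>'" "\<Union>\<F>' = \<Union>\<F>" by (rule Lindelof)
  have "AE z in lborel. \<forall>S\<in>\<F>'. z \<in> S \<longrightarrow> u0 z = limit_avg z"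
    using \<F>'(1,2) by (subst AE_ball_countable) (auto simp: \<F>_def)
  then have "AE z in lborel. z \<in> D \<longrightarrow> u z = limit_avg z"
  proof (rule AE_mp, intro AE_I2 impI)
    fix z assume *: "\<forall>S\<in>\<F>'. z \<in> S \<longrightarrow> u0 z = limit_avg z" and z: "z \<in> D"
    have "z \<in> \<Union>\<F>" using loc[OF z] unfolding \<F>_def by blast
    then have "u0 z = limit_avg z" using * \<F>'(3) by blast
    then show "u z = limit_avg z" using z by (simp add: u0_def)
  qed
  then show ?thesis
    by (subst AE_restrict_space_iff) (auto intro: AE_completion)
qed

end

section \<open>Test functions and Sobolev spaces on subdomains\<close>

lemma test_functionD:
  assumes "test_function D \<phi>"
  shows "smooth \<phi>" "\<And>x. x \<notin> D \<Longrightarrow> \<phi> x = 0"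
  using assms closure_subset[of "{x. \<phi> x \<noteq> 0}"] by (auto simp: test_function_def)

lemma test_function_mono: "test_function D \<phi> \<Longrightarrow> D \<subseteq> E \<Longrightarrow> test_function E \<phi>"
  by (auto simp: test_function_def)

lemma test_function_dir_deriv:
  assumes "test_function D \<phi>"
  shows "test_function D (dir_deriv b \<phi>)"
proof -
  let ?S = "closure {x. \<phi> x \<noteq> 0}"
  have sm: "smooth \<phi>" using assms by (rule test_functionD)
  have "dir_deriv b \<phi> x = 0" if "x \<notin> ?S" for x
  proof -
    have "dir_deriv b \<phi> x = dir_deriv b (\<lambda>x. 0) x"
      using that closure_subset[of "{x. \<phi> x \<noteq> 0}"]
      by (intro dir_deriv_transform[of "- ?S"] smooth_differentiable[OF sm]) (auto intro: open_Compl)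
    then show ?thesis using dir_deriv_eq[OF has_derivative_const, of b 0 x] by metis
  qed
  then have "closure {x. dir_deriv b \<phi> x \<noteq> 0} \<subseteq> ?S"
    by (intro closure_minimal) auto
  then show ?thesis
    using assms smooth_dir_deriv[OF sm, of b] unfolding test_function_def compact_eq_bounded_closed
    by (auto intro: bounded_subset)
qed

lemma integral_lebesgue_on_subset:
  fixes f :: "'a::euclidean_space \<Rightarrow> 'b::{banach, second_countable_topology}"
  assumes "D \<in> sets lebesgue" "E \<in> sets lebesgue" "D \<subseteq> E" "\<And>x. x \<notin> D \<Longrightarrow> f x = 0"
  shows "(\<integral>x. f x \<partial>lebesgue_on D) = (\<integral>x. f x \<partial>lebesgue_on E)"
proof -
  have "(\<lambda>x. indicator D x *\<^sub>R f x) = (\<lambda>x. indicator E x *\<^sub>R f x)"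
    using assms(3,4) by (auto simp: fun_eq_iff indicator_def)
  then show ?thesis
    using integral_restrict_space[of D lebesgue f] integral_restrict_space[of E lebesgue f] assms(1,2) by simp
qed

lemma L2_subset:
  fixes f :: "'a::euclidean_space \<Rightarrow> complex"
  assumes "D \<in> sets lebesgue" "E \<in> sets lebesgue" "D \<subseteq> E" "f \<in> L2 (lebesgue_on E)"
  shows "f \<in> L2 (lebesgue_on D)"
proof -
  have "f \<in> borel_measurable (lebesgue_on D)"
    using measurable_restrict_mono[OF L2_D(1)[OF assms(4)] assms(3)] .
  moreover have "integrable lebesgue (\<lambda>x. indicator E x *\<^sub>R (cmod (f x))\<^sup>2)"
    using L2_D(2)[OF assms(4)] assms by (subst (asm) integrable_restrict_space) auto
  then have "integrable lebesgue (\<lambda>x. indicator D x *\<^sub>R (indicator E x *\<^sub>R (cmod (f x))\<^sup>2))"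
    by (rule integrable_mult_indicator[OF assms(1)])
  then have "integrable lebesgue (\<lambda>x. indicator D x *\<^sub>R (cmod (f x))\<^sup>2)"
    using assms(3) by (simp only: scaleR_scaleR indicator_inter_arith[symmetric] Int_absorb2)
  then have "integrable (lebesgue_on D) (\<lambda>x. (cmod (f x))\<^sup>2)"
    using assms by (subst integrable_restrict_space) auto
  ultimately show ?thesis by (simp add: L2_def)
qed

lemma weak_partial_subset:
  assumes "D \<in> sets lebesgue" "E \<in> sets lebesgue" "D \<subseteq> E" "weak_partial E b u g"
  shows "weak_partial D b u g"
proof -
  have "(\<integral>x. dir_deriv b \<phi> x *\<^sub>R u x \<partial>lebesgue_on D) = - (\<integral>x. \<phi> x *\<^sub>R g x \<partial>lebesgue_on D)"
    if t: "test_function D \<phi>" for \<phi>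
  proof -
    have "(\<integral>x. dir_deriv b \<phi> x *\<^sub>R u x \<partial>lebesgue_on D) = (\<integral>x. dir_deriv b \<phi> x *\<^sub>R u x \<partial>lebesgue_on E)"
      using test_functionD(2)[OF test_function_dir_deriv[OF t]]
      by (intro integral_lebesgue_on_subset assms) simp
    also have "\<dots> = - (\<integral>x. \<phi> x *\<^sub>R g x \<partial>lebesgue_on E)"
      using assms(4) test_function_mono[OF t assms(3)] by (simp add: weak_partial_def)
    also have "(\<integral>x. \<phi> x *\<^sub>R g x \<partial>lebesgue_on E) = (\<integral>x. \<phi> x *\<^sub>R g x \<partial>lebesgue_on D)"
      using test_functionD(2)[OF t] by (intro integral_lebesgue_on_subset[symmetric] assms) simp
    finally show ?thesis .
  qed
  then show ?thesis
    using assms L2_subset[OF assms(1-3)] unfolding weak_partial_def by blast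
qed

lemma sobolev_H_subset:
  assumes "D \<in> sets lebesgue" "E \<in> sets lebesgue" "D \<subseteq> E" "u \<in> sobolev_H k E"
  shows "u \<in> sobolev_H k D"
  using assms(4)
proof (induction k arbitrary: u)
  case 0
  then show ?case using L2_subset[OF assms(1-3)] by simp
next
  case (Suc k)
  then show ?case
    using L2_subset[OF assms(1-3)] weak_partial_subset[OF assms(1-3)] by fastforce
qed

lemma sobolev_H2_second_derivative:
  assumes "u \<in> sobolev_H 2 D" "b \<in> Basis"
  obtains g where "g \<in> L2 (lebesgue_on D)"
    "\<And>\<phi>. test_function D \<phi> \<Longrightarrow>
      (\<integral>x. dir_deriv b (dir_deriv b \<phi>) x *\<^sub>R u x \<partial>lebesgue_on D) = (\<integral>x. \<phi> x *\<^sub>R g x \<partial>lebesgue_on D)"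
proof -
  obtain g1 where g1: "g1 \<in> sobolev_H (Suc 0) D" "weak_partial D b u g1"
    using assms by (auto simp: numeral_2_eq_2)
  then obtain g where g: "weak_partial D b g1 g"
    using assms(2) by auto
  show ?thesis
  proof (rule that)
    show "g \<in> L2 (lebesgue_on D)" using g by (simp add: weak_partial_def)
    show "(\<integral>x. dir_deriv b (dir_deriv b \<phi>) x *\<^sub>R u x \<partial>lebesgue_on D) = (\<integral>x. \<phi> x *\<^sub>R g x \<partial>lebesgue_on D)"
      if "test_function D \<phi>" for \<phi>
      using g g1(2) that test_function_dir_deriv[OF that, of b] unfolding weak_partial_def by simp
  qed
qed

text \<open>Members of \<open>L2\<close> are only Lebesgue measurable on D, while the product
  measure arguments above need Borel functions. Real and imaginary part are treated
  separately.\<close>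

lemma L2_borel_representative:
  fixes u :: "'a::euclidean_space \<Rightarrow> complex"
  assumes D: "D \<in> sets lebesgue" and u: "u \<in> L2 (lebesgue_on D)"
  obtains u' where "u' \<in> borel_measurable borel" "AE x in lebesgue_on D. u x = u' x" "u' \<in> L2 (lebesgue_on D)"
proof -
  have "(\<lambda>x. if x \<in> D then u x else 0) \<in> borel_measurable lebesgue"
    by (rule borel_measurable_if_I[OF L2_D(1)[OF u] D])
  then have m: "(\<lambda>x. Re (if x \<in> D then u x else 0)) \<in> borel_measurable lebesgue"
    "(\<lambda>x. Im (if x \<in> D then u x else 0)) \<in> borel_measurable lebesgue" by measurable
  obtain r i where ri: "r \<in> borel_measurable lborel" "AE x in lborel. Re (if x \<in> D then u x else 0) = r x"
    "i \<in> borel_measurable lborel" "AE x in lborel. Im (if x \<in> D then u x else 0) = i x"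
    using completion_ex_borel_measurable_real[OF m(1)] completion_ex_borel_measurable_real[OF m(2)] by blast
  define u' where "u' x = Complex (r x) (i x)" for x
  have m': "u' \<in> borel_measurable borel"
    using ri(1,3) unfolding u'_def[abs_def] Complex_eq by simp
  have "AE x in lborel. (if x \<in> D then u x else 0) = u' x"
    using ri(2,4) by eventually_elim (auto simp: u'_def complex_eq_iff)
  then have "AE x in lebesgue. (if x \<in> D then u x else 0) = u' x" by (rule AE_completion)
  then have ae: "AE x in lebesgue_on D. u x = u' x"
    using D by (subst AE_restrict_space_iff) auto
  have "integrable (lebesgue_on D) (\<lambda>x. (cmod (u' x))\<^sup>2)"
    using L2_D[OF u] borel_measurable_lebesgue_on[OF m', of D] ae
    by (subst integrable_cong_AE[of _ _ "\<lambda>x. (cmod (u x))\<^sup>2"]) auto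
  then have "u' \<in> L2 (lebesgue_on D)"
    using borel_measurable_lebesgue_on[OF m', of D] by (simp add: L2_def)
  with m' ae show ?thesis by (rule that)
qed

text \<open>\<open>cone\<close> is a locally uniform cone condition: small cubes displaced from y in
  direction e stay in D. It may hold at boundary points, where the averages then reach the value
  from inside.\<close>

theorem sobolev_H2_continuous:
  fixes D S :: "space set" and e :: space
  assumes D: "open D" "bounded D" and u: "u \<in> sobolev_H 2 D" and s: "0 < s"
    and cone: "\<And>x. x \<in> S \<Longrightarrow> \<exists>\<delta>>0. \<exists>r0>0. \<forall>y\<in>S \<inter> ball x \<delta>. \<forall>r. 0 < r \<and> r \<le> r0 \<longrightarrow>
        cube (y + r *\<^sub>R e) (r * s) \<subseteq> D"
  shows "\<exists>U. continuous_on S U \<and> (AE x in lebesgue_on D. u x = U x)"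
proof -
  have Dm: "D \<in> sets lebesgue" using D by auto
  have uL: "u \<in> L2 (lebesgue_on D)" using u by (simp add: numeral_2_eq_2)
  obtain u' where u': "u' \<in> borel_measurable borel" "AE x in lebesgue_on D. u x = u' x" "u' \<in> L2 (lebesgue_on D)"
    by (rule L2_borel_representative[OF Dm uL])
  have rep: "(\<integral>x. K x *\<^sub>R u' x \<partial>lebesgue_on D) = (\<integral>x. K x *\<^sub>R u x \<partial>lebesgue_on D)" if "smooth K" for K
  proof (rule integral_cong_AE)
    have "K \<in> borel_measurable (lebesgue_on D)"
      by (intro borel_measurable_lebesgue_on borel_measurable_continuous_onI smooth_continuous_on that)
    then show "(\<lambda>x. K x *\<^sub>R u' x) \<in> borel_measurable (lebesgue_on D)" "(\<lambda>x. K x *\<^sub>R u x) \<in> borel_measurable (lebesgue_on D)"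
      using L2_D(1)[OF uL] L2_D(1)[OF u'(3)] by auto
    show "AE x in lebesgue_on D. K x *\<^sub>R u' x = K x *\<^sub>R u x"
      using u'(2) by eventually_elim simp
  qed
  have rep2: "(\<integral>x. dir_deriv b (dir_deriv b \<phi>) x *\<^sub>R u' x \<partial>lebesgue_on D) = (\<integral>x. dir_deriv b (dir_deriv b \<phi>) x *\<^sub>R u x \<partial>lebesgue_on D)"
    if "test_function D \<phi>" for b \<phi>
    by (intro rep smooth_dir_deriv test_functionD[OF that])
  obtain g1 where g1: "g1 \<in> L2 (lebesgue_on D)"
    "\<And>\<phi>. test_function D \<phi> \<Longrightarrow> (\<integral>x. dir_deriv e1 (dir_deriv e1 \<phi>) x *\<^sub>R u x \<partial>lebesgue_on D) = (\<integral>x. \<phi> x *\<^sub>R g1 x \<partial>lebesgue_on D)"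
    by (rule sobolev_H2_second_derivative[OF u e_in_Basis(1)]) blast
  obtain g2 where g2: "g2 \<in> L2 (lebesgue_on D)"
    "\<And>\<phi>. test_function D \<phi> \<Longrightarrow> (\<integral>x. dir_deriv e2 (dir_deriv e2 \<phi>) x *\<^sub>R u x \<partial>lebesgue_on D) = (\<integral>x. \<phi> x *\<^sub>R g2 x \<partial>lebesgue_on D)"
    by (rule sobolev_H2_second_derivative[OF u e_in_Basis(2)]) blast
  obtain g3 where g3: "g3 \<in> L2 (lebesgue_on D)"
    "\<And>\<phi>. test_function D \<phi> \<Longrightarrow> (\<integral>x. dir_deriv e3 (dir_deriv e3 \<phi>) x *\<^sub>R u x \<partial>lebesgue_on D) = (\<integral>x. \<phi> x *\<^sub>R g3 x \<partial>lebesgue_on D)"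
    by (rule sobolev_H2_second_derivative[OF u e_in_Basis(3)]) blast
  define E where "E = \<bar>fst e $ 1\<bar> + \<bar>fst e $ 2\<bar> + \<bar>snd e\<bar>"
  have E: "\<bar>fst e $ 1\<bar> \<le> E" "\<bar>fst e $ 2\<bar> \<le> E" "\<bar>snd e\<bar> \<le> E" by (simp_all add: E_def)
  \<comment> \<open>Chosen to give (1 - l) (E + s) = s / 2, hence the requirement of
    \<open>averaging_kernel_exists\<close> for all three coordinates of e at once.\<close>
  define l where "l = 1 - (s / 2) / (E + s)"
  have Es: "E + s > 0" using E(1) s abs_ge_zero[of "fst e $ 1"] by linarith
  have l: "0 < l" "l < 1" using Es s E(1) abs_ge_zero[of "fst e $ 1"] unfolding l_def by (simp_all add: field_simps)
  have ls: "(1 - l) * (\<bar>c\<bar> + s) \<le> s / 2" if "\<bar>c\<bar> \<le> E" for c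
  proof -
    have "(1 - l) * (\<bar>c\<bar> + s) \<le> (1 - l) * (E + s)" using that l by (intro mult_left_mono) auto
    also have "\<dots> = s / 2" using Es unfolding l_def by (simp add: nonzero_divide_eq_eq del: distrib_left)
    finally show ?thesis .
  qed
  obtain b1 \<beta>1 where b1: "smooth b1" "smooth \<beta>1"
    "\<And>x. \<bar>x - fst e $ 1\<bar> > s \<Longrightarrow> b1 x = 0" "\<And>x. \<bar>x - fst e $ 1\<bar> > s \<Longrightarrow> b1 (x / l) = 0"
    "\<And>x. \<bar>x - fst e $ 1\<bar> > s \<Longrightarrow> \<beta>1 x = 0" "integral\<^sup>L lborel b1 = 1"
    "\<And>y. dir_deriv 1 (dir_deriv 1 \<beta>1) y = b1 (y / l) / l - b1 y"
    using averaging_kernel_exists[OF l s ls[OF E(1)]] by metis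
  obtain b2 \<beta>2 where b2: "smooth b2" "smooth \<beta>2"
    "\<And>x. \<bar>x - fst e $ 2\<bar> > s \<Longrightarrow> b2 x = 0" "\<And>x. \<bar>x - fst e $ 2\<bar> > s \<Longrightarrow> b2 (x / l) = 0"
    "\<And>x. \<bar>x - fst e $ 2\<bar> > s \<Longrightarrow> \<beta>2 x = 0" "integral\<^sup>L lborel b2 = 1"
    "\<And>y. dir_deriv 1 (dir_deriv 1 \<beta>2) y = b2 (y / l) / l - b2 y"
    using averaging_kernel_exists[OF l s ls[OF E(2)]] by metis
  obtain b3 \<beta>3 where b3: "smooth b3" "smooth \<beta>3"
    "\<And>x. \<bar>x - snd e\<bar> > s \<Longrightarrow> b3 x = 0" "\<And>x. \<bar>x - snd e\<bar> > s \<Longrightarrow> b3 (x / l) = 0"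
    "\<And>x. \<bar>x - snd e\<bar> > s \<Longrightarrow> \<beta>3 x = 0" "integral\<^sup>L lborel b3 = 1"
    "\<And>y. dir_deriv 1 (dir_deriv 1 \<beta>3) y = b3 (y / l) / l - b3 y"
    using averaging_kernel_exists[OF l s ls[OF E(3)]] by metis
  obtain C1 C2 C3 B1 B2 B3 where C: "\<And>x. \<bar>b1 x\<bar> \<le> C1" "\<And>x. \<bar>b2 x\<bar> \<le> C2" "\<And>x. \<bar>b3 x\<bar> \<le> C3"
    "\<And>x. \<bar>\<beta>1 x\<bar> \<le> B1" "\<And>x. \<bar>\<beta>2 x\<bar> \<le> B2" "\<And>x. \<bar>\<beta>3 x\<bar> \<le> B3"
    using compactly_supported_bounded[OF b1(1,3)] compactly_supported_bounded[OF b2(1,3)]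
      compactly_supported_bounded[OF b3(1,3)] compactly_supported_bounded[OF b1(2,5)]
      compactly_supported_bounded[OF b2(2,5)] compactly_supported_bounded[OF b3(2,5)] by metis
  define C where "C = Max {1, C1, C2, C3, B1, B2, B3}"
  have CC: "1 \<le> C" "C1 \<le> C" "C2 \<le> C" "C3 \<le> C" "B1 \<le> C" "B2 \<le> C" "B3 \<le> C"
    unfolding C_def by (rule Max_ge; simp)+
  interpret averaging D u' g1 g2 g3 e s l C b1 b2 b3 \<beta>1 \<beta>2 \<beta>3
    by (unfold_locales; (rule D u'(1) u'(3) g1 g2 g3 l s CC(1) b1 b2 b3 order_trans[OF C(1) CC(2)]
        order_trans[OF C(2) CC(3)] order_trans[OF C(3) CC(4)] order_trans[OF C(4) CC(5)]
        order_trans[OF C(5) CC(6)] order_trans[OF C(6) CC(7)])?)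
      (simp_all add: rep2 g1(2) g2(2) g3(2) b1 b2 b3)
  have "continuous_on S limit_avg"
  proof (rule continuous_on_limit_avg)
    fix x assume "x \<in> S"
    from cone[OF this] show "\<exists>\<delta>>0. admissible (S \<inter> ball x \<delta>)"
      unfolding admissible_def by blast
  qed
  moreover have "AE x in lebesgue_on D. u x = limit_avg x"
    using u'(2) AE_limit_avg by eventually_elim simp
  ultimately show ?thesis by blast
qed

section \<open>Traces on a face tested against kernels\<close>

lemma L2_tendsto_L1:
  fixes F :: "nat \<Rightarrow> 'a \<Rightarrow> complex"
  assumes "finite_measure N" "\<And>n. F n \<in> borel_measurable N" "f \<in> borel_measurable N" "L2_tendsto N F f"
  shows "(\<lambda>n. \<integral>\<^sup>+x. ennreal (cmod (F n x - f x)) \<partial>N) \<longlonglongrightarrow> 0"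
proof -
  interpret finite_measure N by fact
  let ?a = "\<lambda>n. \<integral>\<^sup>+x. ennreal (cmod (F n x - f x)) \<partial>N"
  have "(?a n)\<^sup>2 \<le> (\<integral>\<^sup>+x. ennreal ((cmod (F n x - f x))\<^sup>2) \<partial>N) * emeasure N (space N)" for n
    using Cauchy_Schwarz_nn_integral[of "\<lambda>x. ennreal (cmod (F n x - f x))" N "\<lambda>x. 1"] assms(2)[of n] assms(3)
    by (simp add: ennreal_power)
  moreover have "(\<lambda>n. (\<integral>\<^sup>+x. ennreal ((cmod (F n x - f x))\<^sup>2) \<partial>N) * emeasure N (space N)) \<longlonglongrightarrow> 0 * emeasure N (space N)"
    using assms(4) emeasure_finite[of "space N"] unfolding L2_tendsto_def
    by (intro tendsto_mult_ennreal tendsto_const) (auto simp: top_unique)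
  ultimately have sq: "(\<lambda>n. (?a n)\<^sup>2) \<longlonglongrightarrow> 0"
    by (intro tendsto_sandwich[where f = "\<lambda>_. 0" and g = "\<lambda>n. (?a n)\<^sup>2" and
      h = "\<lambda>n. (\<integral>\<^sup>+x. ennreal ((cmod (F n x - f x))\<^sup>2) \<partial>N) * emeasure N (space N)"]) auto
  show ?thesis
  proof (rule order_tendstoI)
    fix y :: ennreal assume "0 < y"
    then have "0 < y\<^sup>2" by (simp add: power2_eq_square ennreal_zero_less_mult_iff)
    from order_tendstoD(2)[OF sq this] show "\<forall>\<^sub>F n in sequentially. ?a n < y"
      by eventually_elim (meson leD leI power_mono zero_le)
  qed auto
qed

lemma L2_tendsto_integral_mult:
  fixes F :: "nat \<Rightarrow> 'a \<Rightarrow> complex"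
  assumes N: "finite_measure N" and F: "\<And>n. integrable N (F n)" and f: "integrable N f" and "L2_tendsto N F f"
    and K: "K \<in> borel_measurable N" "\<And>x. cmod (K x) \<le> C"
  shows "(\<lambda>n. \<integral>x. K x * F n x \<partial>N) \<longlonglongrightarrow> (\<integral>x. K x * f x \<partial>N)"
proof -
  have C: "C \<ge> 0" using K(2) norm_ge_zero order_trans by blast
  have L1: "(\<lambda>n. ennreal C * (\<integral>\<^sup>+x. ennreal (cmod (F n x - f x)) \<partial>N)) \<longlonglongrightarrow> ennreal C * 0"
    using F f by (intro tendsto_mult_ennreal tendsto_const L2_tendsto_L1 assms) auto
  have "ennreal (dist (\<integral>x. K x * F n x \<partial>N) (\<integral>x. K x * f x \<partial>N)) \<le> ennreal C * (\<integral>\<^sup>+x. ennreal (cmod (F n x - f x)) \<partial>N)" for n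
  proof -
    have i: "integrable N (\<lambda>x. K x * F n x)" "integrable N (\<lambda>x. K x * f x)"
      by (rule integrable_bounded_mult[OF _ K]; fact F f)+
    have "dist (\<integral>x. K x * F n x \<partial>N) (\<integral>x. K x * f x \<partial>N) = cmod (\<integral>x. K x * (F n x - f x) \<partial>N)"
      using i by (simp add: dist_norm right_diff_distrib)
    also have "ennreal \<dots> \<le> (\<integral>\<^sup>+x. ennreal (cmod (K x * (F n x - f x))) \<partial>N)"
      using i by (intro integral_norm_bound_ennreal) (simp add: right_diff_distrib)
    also have "\<dots> \<le> (\<integral>\<^sup>+x. ennreal C * ennreal (cmod (F n x - f x)) \<partial>N)"
      by (intro nn_integral_mono) (simp add: norm_mult ennreal_mult'[symmetric] ennreal_leI mult_right_mono K(2) C)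
    also have "\<dots> = ennreal C * (\<integral>\<^sup>+x. ennreal (cmod (F n x - f x)) \<partial>N)"
      using F f by (intro nn_integral_cmult) (auto dest!: borel_measurable_integrable)
    finally show ?thesis .
  qed
  then have le: "\<forall>\<^sub>F n in sequentially. ennreal (dist (\<integral>x. K x * F n x \<partial>N) (\<integral>x. K x * f x \<partial>N))
      \<le> ennreal C * (\<integral>\<^sup>+x. ennreal (cmod (F n x - f x)) \<partial>N)" by (rule always_eventually[OF allI])
  have "(\<lambda>n. ennreal (dist (\<integral>x. K x * F n x \<partial>N) (\<integral>x. K x * f x \<partial>N))) \<longlonglongrightarrow> 0"
    by (rule tendsto_sandwich[OF _ le tendsto_const]) (use L1 in simp_all)
  then show ?thesis
    unfolding tendsto_dist_iff[of "\<lambda>n. \<integral>x. K x * F n x \<partial>N"] by (subst (asm) ennreal_tendsto_0_iff) auto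
qed

lemma integrable_continuous_lebesgue_on:
  fixes F :: "'a::euclidean_space \<Rightarrow> complex"
  assumes "open D" "bounded D" "continuous_on UNIV F"
  shows "integrable (lebesgue_on D) F"
proof -
  interpret finite_measure "lebesgue_on D" by (rule finite_measure_lebesgue_on_open[OF assms(1,2)])
  have "bounded (F ` closure D)"
    using assms(2,3) by (intro compact_imp_bounded compact_continuous_image continuous_on_subset[OF assms(3)])
      (auto simp: compact_closure)
  then obtain B where "\<And>z. z \<in> closure D \<Longrightarrow> cmod (F z) \<le> B"
    unfolding bounded_iff by (metis image_eqI)
  then have B: "cmod (F z) \<le> B" if "z \<in> D" for z using that closure_subset by blast
  show ?thesis
    using B borel_measurable_lebesgue_on[OF borel_measurable_continuous_onI[OF assms(3)]]
    by (intro integrable_const_bound[where B = B]) auto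
qed

section \<open>Oblique coordinates over a face\<close>

definition coord1 :: "real^2 \<Rightarrow> real^2 \<Rightarrow> space \<Rightarrow> real" where
  "coord1 \<tau> d x = det2 (fst x) d / det2 \<tau> d"

definition coord2 :: "real^2 \<Rightarrow> real^2 \<Rightarrow> space \<Rightarrow> real" where
  "coord2 \<tau> d x = det2 \<tau> (fst x) / det2 \<tau> d"

text \<open>The prism swept from the strip of length A and height 2 M of the face by segments in
  direction d, up to depth B. By Cramer's rule \<open>coord1\<close> and \<open>coord2\<close> are
  the coefficients of \<open>fst x\<close> in the basis \<tau>, d.\<close>

definition slab :: "real^2 \<Rightarrow> real^2 \<Rightarrow> real \<Rightarrow> real \<Rightarrow> real \<Rightarrow> space set" where
  "slab \<tau> d M A B = {x. coord1 \<tau> d x \<in> {0<..<A} \<and> coord2 \<tau> d x \<in> {0<..<B} \<and> snd x \<in> {-M<..<M}}"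

lemma det2_linear:
  "det2 (a *\<^sub>R x + b *\<^sub>R y) z = a * det2 x z + b * det2 y z"
  "det2 z (a *\<^sub>R x + b *\<^sub>R y) = a * det2 z x + b * det2 z y" "det2 x x = 0"
  by (simp_all add: det2_def algebra_simps)

lemma coord_param:
  assumes "det2 \<tau> d \<noteq> 0"
  shows "coord1 \<tau> d (param \<tau> d z) = fst (fst z)" "coord2 \<tau> d (param \<tau> d z) = snd z"
    "snd (param \<tau> d z) = snd (fst z)"
  using assms by (simp_all add: coord1_def coord2_def param_def det2_linear)

lemma param_coord:
  assumes "det2 \<tau> d \<noteq> 0"
  shows "param \<tau> d ((coord1 \<tau> d x, snd x), coord2 \<tau> d x) = x"
proof -
  have "coord1 \<tau> d x *\<^sub>R \<tau> + coord2 \<tau> d x *\<^sub>R d = fst x"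
    using assms by (simp add: vec_eq_iff forall_2 coord1_def coord2_def field_simps)
      (simp add: det2_def algebra_simps)
  then show ?thesis by (simp add: param_def prod_eq_iff)
qed

lemma continuous_on_coord: "continuous_on S (coord1 \<tau> d)" "continuous_on S (coord2 \<tau> d)"
  unfolding coord1_def coord2_def det2_def divide_inverse by (intro continuous_intros)+

lemma open_slab: "open (slab \<tau> d M A B)"
proof -
  have "slab \<tau> d M A B = coord1 \<tau> d -` {0<..<A} \<inter> (coord2 \<tau> d -` {0<..<B} \<inter> snd -` {-M<..<M})"
    by (auto simp: slab_def)
  then show ?thesis
    by (auto intro!: open_Int open_vimage continuous_on_coord continuous_on_snd continuous_on_id)
qed

lemma param_in_slab:
  assumes "det2 \<tau> d \<noteq> 0"
  shows "param \<tau> d z \<in> slab \<tau> d M A B \<longleftrightarrow> z \<in> ({0<..<A} \<times> {-M<..<M}) \<times> {0<..<B}"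
  using assms by (cases z) (auto simp: slab_def coord_param)

definition face_param :: "real \<Rightarrow> real^2" where "face_param \<theta> = vector [cos \<theta>, sin \<theta>]"

text \<open>The trace in face coordinates (r, t), extended by zero so that it can be integrated over
  the whole plane.\<close>

definition trace_pullback :: "real^2 \<Rightarrow> real \<Rightarrow> real \<Rightarrow> (space \<Rightarrow> complex) \<Rightarrow> real \<times> real \<Rightarrow> complex" where
  "trace_pullback \<tau> h M g w = indicator ({0<..<h} \<times> {-M<..<M}) w *\<^sub>R g (fst w *\<^sub>R \<tau>, snd w)"

text \<open>Integrated form of the statement that f has the trace T in face coordinates. It is what
  the fundamental theorem of calculus along d leaves after passage to the limit: g stands for the
  derivative of f along d, does not depend on K, A, B or C, and the determinant is the Jacobian of
  \<open>param\<close>. The condition A \<le> h keeps the base of the slab within the face.\<close>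

definition trace_estimate ::
  "space set \<Rightarrow> real^2 \<Rightarrow> real^2 \<Rightarrow> real \<Rightarrow> real \<Rightarrow> (space \<Rightarrow> complex) \<Rightarrow> (real \<times> real \<Rightarrow> complex) \<Rightarrow> bool" where
  "trace_estimate D \<tau> d h M f T \<longleftrightarrow>
    f \<in> L2 (lebesgue_on D) \<and> integrable lborel T \<and>
    (\<exists>g \<in> L2 (lebesgue_on D).
      (\<forall>K A B C. K \<in> borel_measurable borel \<and> (\<forall>x. cmod (K x) \<le> C) \<and> (\<forall>x. x \<notin> slab \<tau> d M A B \<longrightarrow> K x = 0)
         \<and> slab \<tau> d M A B \<subseteq> D \<and> 0 < A \<and> A \<le> h \<and> 0 < B \<longrightarrow>
        cmod ((\<integral>x. K x * f x \<partial>lebesgue_on D)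
            - \<bar>det2 \<tau> d\<bar> *\<^sub>R (\<integral>z. K (param \<tau> d z) * T (fst z) \<partial>lborel))
          \<le> C * B * (\<integral>x. indicator (slab \<tau> d M A B) x * cmod (g x) \<partial>lebesgue_on D)))"

text \<open>Integrating along the segments from the face in direction \<open>d\<close>.\<close>

lemma smooth_trace_estimate:
  fixes F :: "space \<Rightarrow> complex"
  assumes F: "smooth F" and det: "det2 \<tau> d \<noteq> 0"
    and K: "K \<in> borel_measurable borel" "\<And>x. cmod (K x) \<le> C" "\<And>x. x \<notin> slab \<tau> d M A B \<Longrightarrow> K x = 0"
    and AB: "0 < A" "0 < B" 
  shows "ennreal (cmod ((\<integral>x. K x * F x \<partial>lborel) - \<bar>det2 \<tau> d\<bar> *\<^sub>R (\<integral>z. K (param \<tau> d z) * F (param \<tau> d (fst z, 0)) \<partial>lborel)))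
     \<le> ennreal (C * B) * (\<integral>\<^sup>+x. indicator (slab \<tau> d M A B) x * ennreal (cmod (dir_deriv (d, 0) F x)) \<partial>lborel)"
proof -
  note [measurable] = K(1)
  have C: "C \<ge> 0" using K(2) norm_ge_zero order_trans by blast
  have Fc: "continuous_on UNIV F" by (rule smooth_continuous_on[OF F])
  have [measurable]: "F \<in> borel_measurable borel" by (rule borel_measurable_continuous_onI[OF Fc])
  define G where "G = dir_deriv (d, 0) F"
  have Gc: "continuous_on UNIV G"
  proof -
    have "G = (\<lambda>x. \<Sum>b\<in>Basis. ((d, 0) \<bullet> b) *\<^sub>R dir_deriv b F x)"
      unfolding G_def using dir_deriv_sum_Basis[OF smooth_differentiable[OF F]] by blast
    then show ?thesis
      by (simp only:) (intro continuous_on_sum continuous_on_scaleR continuous_on_const smooth_dir_deriv_continuous_on F)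
  qed
  have [measurable]: "G \<in> borel_measurable borel" by (rule borel_measurable_continuous_onI[OF Gc])
  let ?P = "param \<tau> d" and ?J = "\<bar>det2 \<tau> d\<bar>"
  let ?W = "{0<..<A} \<times> {-M<..<M}" and ?I = "{0<..<B}"
  define Z where "Z = ?W \<times> ?I"
  have KZ: "K (?P z) = 0" if "z \<notin> Z" for z
    using K(3) param_in_slab[OF det] that unfolding Z_def by blast
  have Zb: "bounded Z" unfolding Z_def by (intro bounded_Times bounded_box[where 'a=real, unfolded box_real])
  have Zm [measurable]: "Z \<in> sets borel"
    unfolding Z_def by (intro borel_open open_Times) auto
  have [measurable]: "?W \<in> sets borel" by (intro borel_open open_Times) auto
  have P0c: "continuous_on UNIV (\<lambda>z. ?P (fst z, 0))"
    unfolding param_def by (intro continuous_intros)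
  have int: "integrable lborel (\<lambda>z. K (?P z) * H z)" if H: "continuous_on UNIV H" for H :: "(real \<times> real) \<times> real \<Rightarrow> complex"
  proof -
    have "integrable lborel (\<lambda>z. indicator (closure Z) z *\<^sub>R H z)"
      using Zb by (intro borel_integrable_compact continuous_on_subset[OF H]) (auto simp: compact_closure)
    then have "integrable lborel (\<lambda>z. K (?P z) * (indicator (closure Z) z *\<^sub>R H z))"
      using K(2) by (intro integrable_bounded_mult[of _ _ _ C]) auto
    moreover have "K (?P z) * (indicator (closure Z) z *\<^sub>R H z) = K (?P z) * H z" for z
      using KZ[of z] closure_subset[of Z] by (cases "z \<in> Z") (auto simp: indicator_def)
    ultimately show ?thesis by simp
  qed
  have i1: "integrable lborel (\<lambda>z. K (?P z) * F (?P z))"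
    by (intro int continuous_on_compose2[OF Fc continuous_on_param]) auto
  have i2: "integrable lborel (\<lambda>z. K (?P z) * F (?P (fst z, 0)))"
    by (intro int continuous_on_compose2[OF Fc P0c]) auto
  have line: "ennreal (cmod (F (?P (w, b)) - F (?P (w, 0)))) \<le> (\<integral>\<^sup>+b'. indicator ?I b' * ennreal (cmod (G (?P (w, b')))) \<partial>lborel)"
    if b: "b \<in> ?I" for w b
  proof -
    have Gl: "continuous_on UNIV (\<lambda>b'. G (?P (w, b')))"
      unfolding param_def by (intro continuous_on_compose2[OF Gc] continuous_intros) auto
    have der: "((\<lambda>b'. F (?P (w, b'))) has_vector_derivative G (?P (w, b'))) (at b' within {0..b})" for b'
    proof -
      have "((\<lambda>b'. ?P (w, b')) has_derivative (\<lambda>h. (h *\<^sub>R d, 0))) (at b' within {0..b})"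
        unfolding param_def by (auto intro!: derivative_eq_intros)
      then have "((\<lambda>b'. F (?P (w, b'))) has_derivative (\<lambda>h. dir_deriv (h *\<^sub>R d, 0) F (?P (w, b')))) (at b' within {0..b})"
        by (rule has_derivative_compose[OF _ smooth_has_derivative[OF F]])
      moreover have "dir_deriv (h *\<^sub>R d, 0) F x = h *\<^sub>R G x" for h x
        unfolding G_def dir_deriv_def
        using linear_cmul[OF linear_frechet_derivative[OF smooth_differentiable[OF F, of x]], of h "(d, 0)"] by simp
      ultimately show ?thesis by (simp add: has_vector_derivative_def)
    qed
    have "((\<lambda>b'. G (?P (w, b'))) has_integral (F (?P (w, b)) - F (?P (w, 0)))) {0..b}"
      using b by (intro fundamental_theorem_of_calculus der) auto
    moreover have si: "set_integrable lborel {0..b} (\<lambda>b'. G (?P (w, b')))"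
      unfolding set_integrable_def
      by (intro borel_integrable_compact continuous_on_subset[OF Gl]) auto
    ultimately have "F (?P (w, b)) - F (?P (w, 0)) = (\<integral>b'. indicator {0..b} b' *\<^sub>R G (?P (w, b')) \<partial>lborel)"
      using set_borel_integral_eq_integral(2)[OF si] by (simp add: set_lebesgue_integral_def integral_unique)
    then have "ennreal (cmod (F (?P (w, b)) - F (?P (w, 0)))) \<le> (\<integral>\<^sup>+b'. ennreal (cmod (indicator {0..b} b' *\<^sub>R G (?P (w, b')))) \<partial>lborel)"
      using integral_norm_bound_ennreal[OF si[unfolded set_integrable_def]] by simp
    also have "\<dots> \<le> (\<integral>\<^sup>+b'. indicator ?I b' * ennreal (cmod (G (?P (w, b')))) \<partial>lborel)"
    proof (rule nn_integral_mono_AE)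
      \<comment> \<open>The closed interval from the fundamental theorem contains the endpoint 0,
        which the open depth interval lacks.\<close>
      have "AE b' in lborel. b' \<noteq> (0::real)" by (rule AE_lborel_singleton)
      then show "AE b' in lborel. ennreal (cmod (indicator {0..b} b' *\<^sub>R G (?P (w, b')))) \<le> indicator ?I b' * ennreal (cmod (G (?P (w, b'))))"
        by eventually_elim (use b in \<open>auto simp: indicator_def\<close>)
    qed
    finally show ?thesis .
  qed
  \<comment> \<open>The bound extends over the full segment and no longer depends on the depth b, so
    integrating it over b yields the factor B.\<close>
  define I where "I w = (\<integral>\<^sup>+b'. indicator ?I b' * ennreal (cmod (G (?P (w, b')))) \<partial>lborel)" for w
  have PGm: "(\<lambda>z. indicator Z z * ennreal (cmod (G (?P z)))) \<in> borel_measurable (lborel \<Otimes>\<^sub>M lborel)"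
    by (simp add: lborel_prod)
  have GPm: "(\<lambda>z. indicator ?I (snd z) * ennreal (cmod (G (?P z)))) \<in> borel_measurable (lborel \<Otimes>\<^sub>M lborel)"
  proof -
    have [measurable]: "(\<lambda>z. G (?P z)) \<in> borel_measurable (borel \<Otimes>\<^sub>M borel)"
      by (simp add: borel_prod)
    show ?thesis by measurable
  qed
  have Im [measurable]: "I \<in> borel_measurable lborel"
    using lborel.borel_measurable_nn_integral_fst[OF GPm] by (simp add: I_def[abs_def])
  have "(\<integral>x. K x * F x \<partial>lborel) - ?J *\<^sub>R (\<integral>z. K (?P z) * F (?P (fst z, 0)) \<partial>lborel)
      = ?J *\<^sub>R (\<integral>z. K (?P z) * (F (?P z) - F (?P (fst z, 0))) \<partial>lborel)"
    using i1 i2 by (subst integral_param[OF det]) (auto simp: right_diff_distrib scaleR_diff_right)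
  also have "ennreal (cmod \<dots>) = ennreal ?J * ennreal (cmod (\<integral>z. K (?P z) * (F (?P z) - F (?P (fst z, 0))) \<partial>lborel))"
    by (simp add: ennreal_mult)
  also have "\<dots> \<le> ennreal ?J * (\<integral>\<^sup>+z. ennreal (cmod (K (?P z) * (F (?P z) - F (?P (fst z, 0))))) \<partial>lborel)"
    using i1 i2 by (intro mult_left_mono integral_norm_bound_ennreal) (auto simp: right_diff_distrib)
  also have "\<dots> \<le> ennreal ?J * (\<integral>\<^sup>+z. (ennreal C * (indicator ?W (fst z) * I (fst z))) * indicator ?I (snd z) \<partial>lborel)"
  proof (intro mult_left_mono nn_integral_mono)
    fix z :: "(real \<times> real) \<times> real"
    show "ennreal (cmod (K (?P z) * (F (?P z) - F (?P (fst z, 0))))) \<le> (ennreal C * (indicator ?W (fst z) * I (fst z))) * indicator ?I (snd z)"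
    proof (cases "z \<in> Z")
      case True
      then have 1: "fst z \<in> ?W" "snd z \<in> ?I" by (auto simp: Z_def)
      have "ennreal (cmod (K (?P z) * (F (?P z) - F (?P (fst z, 0))))) \<le> ennreal C * ennreal (cmod (F (?P z) - F (?P (fst z, 0))))"
        using C K(2)[of "?P z"] by (simp add: norm_mult ennreal_mult'[symmetric] ennreal_leI mult_right_mono)
      also have "\<dots> \<le> ennreal C * I (fst z)"
        using line[OF 1(2), of "fst z"] by (intro mult_left_mono) (auto simp: I_def)
      finally show ?thesis using 1 by simp
    qed (simp add: KZ)
  qed auto
  also have "(\<integral>\<^sup>+z. (ennreal C * (indicator ?W (fst z) * I (fst z))) * indicator ?I (snd z) \<partial>lborel)
      = (\<integral>\<^sup>+w. \<integral>\<^sup>+b. (ennreal C * (indicator ?W w * I w)) * indicator ?I b \<partial>lborel \<partial>lborel)"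
    by (subst lborel_prod[symmetric], subst lborel.nn_integral_fst[symmetric]) auto
  also have "\<dots> = (\<integral>\<^sup>+w. ennreal (C * B) * (indicator ?W w * I w) \<partial>lborel)"
    using AB C by (intro nn_integral_cong) (subst nn_integral_cmult_indicator; simp add: ennreal_mult mult_ac)
  also have "\<dots> = ennreal (C * B) * (\<integral>\<^sup>+w. indicator ?W w * I w \<partial>lborel)"
    by (intro nn_integral_cmult) measurable
  also have "(\<integral>\<^sup>+w. indicator ?W w * I w \<partial>lborel) = (\<integral>\<^sup>+w. \<integral>\<^sup>+b. indicator Z (w, b) * ennreal (cmod (G (?P (w, b)))) \<partial>lborel \<partial>lborel)"
  proof (rule nn_integral_cong)
    fix w
    show "indicator ?W w * I w = (\<integral>\<^sup>+b. indicator Z (w, b) * ennreal (cmod (G (?P (w, b)))) \<partial>lborel)"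
      by (cases "w \<in> ?W") (auto simp: I_def Z_def indicator_def intro!: nn_integral_cong)
  qed
  also have "\<dots> = (\<integral>\<^sup>+z. indicator Z z * ennreal (cmod (G (?P z))) \<partial>lborel)"
    using lborel.nn_integral_fst[OF PGm] by (simp add: lborel_prod)
  also have "ennreal ?J * (ennreal (C * B) * \<dots>) = ennreal (C * B) * (ennreal ?J * \<dots>)"
    by (simp add: mult_ac)
  also have "ennreal ?J * (\<integral>\<^sup>+z. indicator Z z * ennreal (cmod (G (?P z))) \<partial>lborel) =
      (\<integral>\<^sup>+x. indicator (slab \<tau> d M A B) x * ennreal (cmod (G x)) \<partial>lborel)"
  proof -
    have sm [measurable]: "slab \<tau> d M A B \<in> sets borel" by (intro borel_open open_slab)
    have "indicator (slab \<tau> d M A B) (?P z) = (indicator Z z :: ennreal)" for z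
      using param_in_slab[OF det] by (auto simp: Z_def indicator_def)
    moreover have "(\<integral>\<^sup>+x. indicator (slab \<tau> d M A B) x * ennreal (cmod (G x)) \<partial>lborel) =
        ennreal ?J * (\<integral>\<^sup>+z. indicator (slab \<tau> d M A B) (?P z) * ennreal (cmod (G (?P z))) \<partial>lborel)"
      by (rule nn_integral_param[OF _ det]) measurable
    ultimately show ?thesis by simp
  qed
  finally show ?thesis by (simp add: G_def)
qed

lemma L2_add:
  assumes "f \<in> L2 N" "g \<in> L2 N"
  shows "(\<lambda>x. f x + g x) \<in> L2 N"
proof -
  have "integrable N (\<lambda>x. (cmod (f x + g x))\<^sup>2)"
  proof (rule Bochner_Integration.integrable_bound)
    show "integrable N (\<lambda>x. 2 * (cmod (f x))\<^sup>2 + 2 * (cmod (g x))\<^sup>2)"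
      using L2_D(2)[OF assms(1)] L2_D(2)[OF assms(2)] by auto
    have "(cmod (f x + g x))\<^sup>2 \<le> 2 * (cmod (f x))\<^sup>2 + 2 * (cmod (g x))\<^sup>2" for x
    proof -
      have "(cmod (f x + g x))\<^sup>2 \<le> (cmod (f x) + cmod (g x))\<^sup>2"
        by (intro power_mono norm_triangle_ineq) auto
      also have "\<dots> \<le> 2 * (cmod (f x))\<^sup>2 + 2 * (cmod (g x))\<^sup>2"
        using zero_le_power2[of "cmod (f x) - cmod (g x)"] by (simp add: power2_eq_square algebra_simps)
      finally show ?thesis .
    qed
    then show "AE x in N. norm ((cmod (f x + g x))\<^sup>2) \<le> norm (2 * (cmod (f x))\<^sup>2 + 2 * (cmod (g x))\<^sup>2)"
      by (intro AE_I2) simp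
  qed (use L2_D(1)[OF assms(1)] L2_D(1)[OF assms(2)] in measurable)
  then show ?thesis
    using L2_D(1)[OF assms(1)] L2_D(1)[OF assms(2)] by (simp add: L2_def)
qed

lemma L2_cmult:
  assumes "f \<in> L2 N"
  shows "(\<lambda>x. c * f x) \<in> L2 N"
  using assms by (auto simp: L2_def norm_mult power_mult_distrib)

lemma L2_norm:
  assumes "f \<in> L2 N"
  shows "(\<lambda>x. of_real (cmod (f x))) \<in> L2 N"
  using assms by (auto simp: L2_def)

lemma L2_sum:
  assumes "finite B" "\<And>b. b \<in> B \<Longrightarrow> f b \<in> L2 N"
  shows "(\<lambda>x. \<Sum>b\<in>B. f b x) \<in> L2 N"
  using assms
proof (induction B)
  case empty
  then show ?case by (simp add: L2_def)
next
  case (insert b B)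
  then show ?case by (auto intro!: L2_add)
qed

section \<open>Surface measure and traces in face coordinates\<close>

lemma norm_face_param: "norm (face_param \<theta>) = 1"
  by (simp add: face_param_def norm_eq_sqrt_inner inner_vec_def sum_2 flip: power2_eq_square)

lemma face_param_in_ray:
  assumes "-pi < \<theta>" "\<theta> < pi" "0 < r" "r < h"
  shows "r *\<^sub>R face_param \<theta> \<in> \<Gamma>h \<theta> h"
proof -
  have "Arg (Complex (r * cos \<theta>) (r * sin \<theta>)) = \<theta>"
    using assms by (intro Arg_unique[of r]) (auto simp: exp_eq_polar complex_eq_iff)
  moreover have "r *\<^sub>R face_param \<theta> \<noteq> 0"
    using norm_face_param[of \<theta>] assms(3) by (metis norm_zero scaleR_eq_0_iff less_irrefl zero_neq_one)
  ultimately show ?thesis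
    using assms norm_face_param[of \<theta>]
    by (simp add: \<Gamma>h_def ray_def polar_angle_def) (simp add: face_param_def)
qed

locale cylinder_face =
  fixes \<theta> h M :: real
  assumes \<theta>: "-pi < \<theta>" "\<theta> < pi" and h: "0 < h" and M: "0 < M"
begin

abbreviation "W0 \<equiv> {0<..<h} \<times> {-M<..<M}"
abbreviation "\<tau> \<equiv> face_param \<theta>"
abbreviation "\<sigma> \<equiv> face_measure \<theta> h M"
abbreviation "face \<equiv> (\<lambda>w::real \<times> real. (fst w *\<^sub>R \<tau>, snd w) :: space)"

lemma W0_sets [measurable]: "W0 \<in> sets borel" "W0 \<in> sets lebesgue"
proof -
  have "open W0" by (intro open_Times) auto
  then show "W0 \<in> sets borel" "W0 \<in> sets lebesgue" by auto
qed

lemma W0_bounded: "bounded W0"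
  by (intro bounded_Times bounded_box[where 'a=real, unfolded box_real])

text \<open>Beside the Lebesgue version below, this one makes \<open>trace_pullback\<close> Borel
  measurable, as needed for integrals over products.\<close>

lemma face_measurable_borel: "face \<in> restrict_space borel W0 \<rightarrow>\<^sub>M restrict_space borel (\<Gamma>h \<theta> h \<times> {-M<..<M})"
proof (rule measurable_restrict_space2)
  show "face \<in> space (restrict_space borel W0) \<rightarrow> \<Gamma>h \<theta> h \<times> {-M<..<M}"
    using face_param_in_ray[OF \<theta>] by (auto simp: space_restrict_space)
  show "face \<in> restrict_space borel W0 \<rightarrow>\<^sub>M borel"
    by (intro measurable_restrict_space1 borel_measurable_continuous_onI continuous_intros)
qed

lemma face_measurable: "face \<in> lebesgue_on W0 \<rightarrow>\<^sub>M restrict_space borel (\<Gamma>h \<theta> h \<times> {-M<..<M})"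
proof (rule measurable_restrict_space2)
  show "face \<in> space (lebesgue_on W0) \<rightarrow> \<Gamma>h \<theta> h \<times> {-M<..<M}"
    using face_param_in_ray[OF \<theta>] by auto
  show "face \<in> lebesgue_on W0 \<rightarrow>\<^sub>M borel"
    by (intro borel_measurable_lebesgue_on borel_measurable_continuous_onI continuous_intros)
qed

lemma face_measure_eq: "\<sigma> = distr (lebesgue_on W0) (restrict_space borel (\<Gamma>h \<theta> h \<times> {-M<..<M})) face"
  unfolding face_measure_def face_param_def by (simp add: split_beta')

lemma finite_face_measure: "finite_measure \<sigma>"
proof -
  interpret finite_measure "lebesgue_on W0"
    by (intro finite_measure_lebesgue_on bounded_set_imp_lmeasurable W0_bounded W0_sets)
  show ?thesis unfolding face_measure_eq by (rule finite_measure_distr[OF face_measurable])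
qed

lemma borel_measurable_face: "g \<in> borel_measurable borel \<Longrightarrow> g \<in> borel_measurable \<sigma>"
  unfolding face_measure_eq by (simp add: measurable_restrict_space1)

lemma nn_integral_face:
  assumes "H \<in> borel_measurable \<sigma>"
  shows "(\<integral>\<^sup>+x. H x \<partial>\<sigma>) = (\<integral>\<^sup>+w. indicator W0 w * H (face w) \<partial>lborel)"
proof -
  have H: "H \<in> borel_measurable (restrict_space borel (\<Gamma>h \<theta> h \<times> {-M<..<M}))"
    using assms unfolding face_measure_eq by simp
  have "(\<integral>\<^sup>+x. H x \<partial>\<sigma>) = (\<integral>\<^sup>+w. H (face w) \<partial>lebesgue_on W0)"
    unfolding face_measure_eq by (rule nn_integral_distr[OF face_measurable]) (use H in simp)
  also have "\<dots> = (\<integral>\<^sup>+w. H (face w) * indicator W0 w \<partial>lebesgue)"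
    by (rule nn_integral_restrict_space) auto
  finally show ?thesis by (simp add: nn_integral_completion mult.commute)
qed

lemma AE_face:
  assumes "AE x in \<sigma>. P x"
  shows "AE w in lebesgue_on W0. P (face w)"
  using assms unfolding face_measure_eq by (rule AE_distrD[OF face_measurable])

lemma trace_pullback_measurable:
  assumes "g \<in> borel_measurable \<sigma>"
  shows "trace_pullback \<tau> h M g \<in> borel_measurable borel"
proof -
  have "(\<lambda>w. g (face w)) \<in> borel_measurable (restrict_space borel W0)"
    using assms by (intro measurable_compose[OF face_measurable_borel]) (simp add: face_measure_eq)
  then show ?thesis
    unfolding trace_pullback_def[abs_def] by (subst (asm) borel_measurable_restrict_space_iff) auto
qed

lemma trace_pullback_integrable:
  assumes "integrable \<sigma> g"
  shows "integrable lborel (trace_pullback \<tau> h M g)"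
proof -
  have gm: "g \<in> borel_measurable \<sigma>" using assms by auto
  have "(\<integral>\<^sup>+w. ennreal (cmod (trace_pullback \<tau> h M g w)) \<partial>lborel) = (\<integral>\<^sup>+x. ennreal (cmod (g x)) \<partial>\<sigma>)"
    using gm by (subst nn_integral_face)
      (auto simp: trace_pullback_def indicator_def intro!: nn_integral_cong)
  then show ?thesis
    using assms trace_pullback_measurable[OF gm] by (simp add: integrable_iff_bounded)
qed

end

lemma nn_integral_window:
  fixes H :: "'a::euclidean_space \<Rightarrow> ennreal"
  assumes [measurable]: "H \<in> borel_measurable borel" and "0 < B"
  shows "(\<integral>\<^sup>+z. H (fst z) * indicator {0<..<B::real} (snd z) \<partial>lborel) = ennreal B * (\<integral>\<^sup>+w. H w \<partial>lborel)"
proof -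
  have "(\<integral>\<^sup>+z. H (fst z) * indicator {0<..<B} (snd z) \<partial>lborel) =
      (\<integral>\<^sup>+w. \<integral>\<^sup>+b. H w * indicator {0<..<B} b \<partial>lborel \<partial>lborel)"
    by (subst lborel_prod[symmetric], subst lborel.nn_integral_fst[symmetric]) auto
  also have "\<dots> = (\<integral>\<^sup>+w. ennreal B * H w \<partial>lborel)"
    using assms(2) by (intro nn_integral_cong) (subst nn_integral_cmult_indicator; simp add: mult.commute)
  also have "\<dots> = ennreal B * (\<integral>\<^sup>+w. H w \<partial>lborel)"
    by (intro nn_integral_cmult) measurable
  finally show ?thesis .
qed

text \<open>T does not depend on the depth and the kernel lives on depths below B; hence the factor
  B in front of the \<open>L1\<close> norm of T.\<close>

lemma kernel_trace_integrable:
  fixes T :: "real \<times> real \<Rightarrow> complex"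
  assumes T: "integrable lborel T" and det: "det2 \<tau> d \<noteq> 0"
    and K: "K \<in> borel_measurable borel" "\<And>x. cmod (K x) \<le> C" "\<And>x. x \<notin> slab \<tau> d M A B \<Longrightarrow> K x = 0" and B: "0 < B"
  shows "integrable lborel (\<lambda>z. K (param \<tau> d z) * T (fst z))"
    and "ennreal (cmod (\<integral>z. K (param \<tau> d z) * T (fst z) \<partial>lborel)) \<le> ennreal (C * B) * (\<integral>\<^sup>+w. ennreal (cmod (T w)) \<partial>lborel)"
proof -
  note [measurable] = K(1)
  have [measurable]: "T \<in> borel_measurable borel" using borel_measurable_integrable[OF T] by simp
  have C: "C \<ge> 0" using K(2) norm_ge_zero order_trans by blast
  have "(\<lambda>z::(real \<times> real) \<times> real. T (fst z)) \<in> borel_measurable (borel \<Otimes>\<^sub>M borel)" by measurable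
  then have [measurable]: "(\<lambda>z::(real \<times> real) \<times> real. T (fst z)) \<in> borel_measurable borel"
    by (simp add: borel_prod)
  have "(\<integral>\<^sup>+z. ennreal (cmod (K (param \<tau> d z) * T (fst z))) \<partial>lborel) \<le>
      (\<integral>\<^sup>+z. (ennreal C * ennreal (cmod (T (fst z)))) * indicator {0<..<B} (snd z) \<partial>lborel)"
  proof (rule nn_integral_mono)
    fix z
    show "ennreal (cmod (K (param \<tau> d z) * T (fst z))) \<le> (ennreal C * ennreal (cmod (T (fst z)))) * indicator {0<..<B} (snd z)"
    proof (cases "snd z \<in> {0<..<B}")
      case True
      then show ?thesis using C K(2)[of "param \<tau> d z"]
        by (simp add: norm_mult ennreal_mult'[symmetric] ennreal_leI mult_right_mono)
    next
      case False
      then have "param \<tau> d z \<notin> slab \<tau> d M A B" using param_in_slab[OF det] by (cases z) auto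
      then show ?thesis using K(3) by simp
    qed
  qed
  also have "\<dots> = ennreal B * (\<integral>\<^sup>+w. ennreal C * ennreal (cmod (T w)) \<partial>lborel)"
    by (rule nn_integral_window[OF _ B]) measurable
  also have "\<dots> = ennreal (C * B) * (\<integral>\<^sup>+w. ennreal (cmod (T w)) \<partial>lborel)"
    using C B by (simp add: nn_integral_cmult ennreal_mult mult_ac)
  finally have le: "(\<integral>\<^sup>+z. ennreal (cmod (K (param \<tau> d z) * T (fst z))) \<partial>lborel) \<le>
      ennreal (C * B) * (\<integral>\<^sup>+w. ennreal (cmod (T w)) \<partial>lborel)" .
  also have "\<dots> < \<infinity>" using T by (simp add: integrable_iff_bounded ennreal_mult_less_top)
  finally show int: "integrable lborel (\<lambda>z. K (param \<tau> d z) * T (fst z))"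
    by (simp add: integrable_iff_bounded)
  show "ennreal (cmod (\<integral>z. K (param \<tau> d z) * T (fst z) \<partial>lborel)) \<le> ennreal (C * B) * (\<integral>\<^sup>+w. ennreal (cmod (T w)) \<partial>lborel)"
    using integral_norm_bound_ennreal[OF int] le by (rule order_trans)
qed

lemma integrable_indicator_norm:
  assumes "integrable (lebesgue_on D) g" "S \<in> sets borel"
  shows "integrable (lebesgue_on D) (\<lambda>x. indicator S x * cmod (g x))"
proof (rule Bochner_Integration.integrable_bound)
  show "integrable (lebesgue_on D) (\<lambda>x. cmod (g x))" using assms(1) by auto
  have "(indicator S :: _ \<Rightarrow> real) \<in> borel_measurable (lebesgue_on D)"
    by (intro borel_measurable_lebesgue_on borel_measurable_indicator assms(2))
  then show "(\<lambda>x. indicator S x * cmod (g x)) \<in> borel_measurable (lebesgue_on D)"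
    using assms(1) by (intro borel_measurable_times) auto
  show "AE x in lebesgue_on D. norm (indicator S x * cmod (g x)) \<le> norm (cmod (g x))"
    by (intro AE_I2) (simp add: indicator_def)
qed

context cylinder_face
begin

text \<open>\<open>smooth_trace_estimate\<close> for the approximating functions passes to the
  limit. The integral over D, the face integral and the derivative bound each need only
  \<open>L1\<close> convergence, which \<open>L2\<close> convergence gives on finite measure
  spaces.\<close>

lemma has_trace_estimate:
  assumes D: "open D" "bounded D" and det: "det2 \<tau> d \<noteq> 0" and tr: "has_trace D \<sigma> f g"
  shows "trace_estimate D \<tau> d h M f (trace_pullback \<tau> h M g)"
proof -
  let ?N = "lebesgue_on D" and ?T = "trace_pullback \<tau> h M g" and ?P = "param \<tau> d"
  let ?J = "\<bar>det2 \<tau> d\<bar>"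
  obtain G F where wp: "\<And>b. b \<in> Basis \<Longrightarrow> weak_partial D b f (G b)" and F: "\<And>n. smooth (F n)"
    and conv: "L2_tendsto ?N F f" and convG: "\<And>b. b \<in> Basis \<Longrightarrow> L2_tendsto ?N (\<lambda>n. dir_deriv b (F n)) (G b)"
    and convT: "L2_tendsto \<sigma> F g"
    using tr unfolding has_trace_def by metis
  have Dm: "D \<in> sets lebesgue" using D by auto
  have gL: "g \<in> L2 \<sigma>" using tr by (simp add: has_trace_def)
  have fL: "f \<in> L2 ?N" using wp[OF e_in_Basis(1)] by (simp add: weak_partial_def)
  have GL: "G b \<in> L2 ?N" if "b \<in> Basis" for b using wp[OF that] by (simp add: weak_partial_def)
  have fin: "finite_measure ?N" by (rule finite_measure_lebesgue_on_open[OF D])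
  have gi: "integrable \<sigma> g" by (rule L2_integrable[OF finite_face_measure gL])
  note fi = L2_integrable[OF fin fL]
  have Fb: "F n \<in> borel_measurable borel" for n
    by (intro borel_measurable_continuous_onI smooth_continuous_on F)
  have Fi: "integrable ?N (F n)" for n
    by (intro integrable_continuous_lebesgue_on D smooth_continuous_on F)
  have Ti: "integrable lborel ?T" by (rule trace_pullback_integrable[OF gi])
  have gm: "g \<in> borel_measurable \<sigma>" using gi by auto
  \<comment> \<open>The weak derivative of f in direction (d, 0), assembled from the partial ones
    that come with the trace.\<close>
  define g' where "g' x = (\<Sum>b\<in>Basis. of_real ((d, 0) \<bullet> b) * G b x)" for x
  have g'L: "g' \<in> L2 ?N"
    unfolding g'_def[abs_def] by (intro L2_sum L2_cmult GL) auto
  have g'm: "g' \<in> borel_measurable ?N" using L2_D(1)[OF g'L] .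
  define Gn where "Gn n = dir_deriv (d, 0) (F n)" for n
  have Gn_eq: "Gn n x = (\<Sum>b\<in>Basis. of_real ((d, 0) \<bullet> b) * dir_deriv b (F n) x)" for n x
    unfolding Gn_def scaleR_conv_of_real[symmetric]
    by (rule dir_deriv_sum_Basis[OF smooth_differentiable[OF F]])
  have dFb: "dir_deriv b (F n) \<in> borel_measurable borel" if "b \<in> Basis" for b n
    by (intro borel_measurable_continuous_onI smooth_dir_deriv_continuous_on F that)
  have Gnb: "Gn n \<in> borel_measurable borel" for n
    unfolding Gn_eq[abs_def] by (intro borel_measurable_sum borel_measurable_times borel_measurable_const dFb)
  have dist0: "(\<lambda>n. \<integral>\<^sup>+x. ennreal (cmod (Gn n x - g' x)) \<partial>?N) \<longlonglongrightarrow> 0"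
  proof (rule tendsto_sandwich[OF _ _ tendsto_const])
    have "(\<lambda>n. \<Sum>b\<in>Basis. ennreal \<bar>(d, 0) \<bullet> b\<bar> * (\<integral>\<^sup>+x. ennreal (cmod (dir_deriv b (F n) x - G b x)) \<partial>?N))
        \<longlonglongrightarrow> (\<Sum>b\<in>(Basis :: space set). ennreal \<bar>(d, 0) \<bullet> b\<bar> * 0)"
      using borel_measurable_lebesgue_on[OF dFb] L2_D(1)[OF GL] convG
      by (intro tendsto_sum tendsto_mult_ennreal tendsto_const L2_tendsto_L1[OF fin]) auto
    then show "(\<lambda>n. \<Sum>b\<in>Basis. ennreal \<bar>(d, 0) \<bullet> b\<bar> * (\<integral>\<^sup>+x. ennreal (cmod (dir_deriv b (F n) x - G b x)) \<partial>?N)) \<longlonglongrightarrow> 0"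
      by simp
    show "\<forall>\<^sub>F n in sequentially. (\<integral>\<^sup>+x. ennreal (cmod (Gn n x - g' x)) \<partial>?N) \<le>
        (\<Sum>b\<in>Basis. ennreal \<bar>(d, 0) \<bullet> b\<bar> * (\<integral>\<^sup>+x. ennreal (cmod (dir_deriv b (F n) x - G b x)) \<partial>?N))"
    proof (intro always_eventually allI)
      fix n
      have m: "(\<lambda>x. ennreal (cmod (dir_deriv b (F n) x - G b x))) \<in> borel_measurable ?N" if "b \<in> Basis" for b
        using borel_measurable_lebesgue_on[OF dFb[OF that]] L2_D(1)[OF GL[OF that]] by measurable
      have "(\<integral>\<^sup>+x. ennreal (cmod (Gn n x - g' x)) \<partial>?N) \<le>
        (\<integral>\<^sup>+x. (\<Sum>b\<in>Basis. ennreal \<bar>(d, 0) \<bullet> b\<bar> * ennreal (cmod (dir_deriv b (F n) x - G b x))) \<partial>?N)"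
      proof (rule nn_integral_mono)
        fix x
        have "Gn n x - g' x = (\<Sum>b\<in>Basis. of_real ((d, 0) \<bullet> b) * (dir_deriv b (F n) x - G b x))"
          by (simp add: Gn_eq g'_def right_diff_distrib sum_subtractf)
        then have "cmod (Gn n x - g' x) \<le> (\<Sum>b\<in>Basis. \<bar>(d, 0) \<bullet> b\<bar> * cmod (dir_deriv b (F n) x - G b x))"
          using norm_sum[of "\<lambda>b. of_real ((d, 0) \<bullet> b) * (dir_deriv b (F n) x - G b x)" Basis] by (simp add: norm_mult)
        then show "ennreal (cmod (Gn n x - g' x)) \<le> (\<Sum>b\<in>Basis. ennreal \<bar>(d, 0) \<bullet> b\<bar> * ennreal (cmod (dir_deriv b (F n) x - G b x)))"
          by (simp add: ennreal_mult[symmetric] sum_ennreal ennreal_leI)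
      qed
      also have "\<dots> = (\<Sum>b\<in>Basis. ennreal \<bar>(d, 0) \<bullet> b\<bar> * (\<integral>\<^sup>+x. ennreal (cmod (dir_deriv b (F n) x - G b x)) \<partial>?N))"
        using m by (subst nn_integral_sum) (auto simp: nn_integral_cmult intro!: sum.cong)
      finally show "(\<integral>\<^sup>+x. ennreal (cmod (Gn n x - g' x)) \<partial>?N) \<le>
        (\<Sum>b\<in>Basis. ennreal \<bar>(d, 0) \<bullet> b\<bar> * (\<integral>\<^sup>+x. ennreal (cmod (dir_deriv b (F n) x - G b x)) \<partial>?N))" .
    qed
  qed simp
  have face0: "?P (w, 0) = face w" for w by (simp add: param_def)
  have "cmod ((\<integral>x. K x * f x \<partial>?N) - ?J *\<^sub>R (\<integral>z. K (?P z) * ?T (fst z) \<partial>lborel))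
          \<le> C * B * (\<integral>x. indicator (slab \<tau> d M A B) x * cmod (g' x) \<partial>?N)"
    if K: "K \<in> borel_measurable borel" "\<And>x. cmod (K x) \<le> C" "\<And>x. x \<notin> slab \<tau> d M A B \<Longrightarrow> K x = 0"
      and sub: "slab \<tau> d M A B \<subseteq> D" and AB: "0 < A" "A \<le> h" "0 < B" for K A B C
  proof -
    let ?S = "slab \<tau> d M A B"
    have C: "C \<ge> 0" using K(2) norm_ge_zero order_trans by blast
    have Sb [measurable]: "?S \<in> sets borel" by (intro borel_open open_slab)
    have Sm: "(indicator ?S :: space \<Rightarrow> ennreal) \<in> borel_measurable ?N" "(indicator ?S :: space \<Rightarrow> real) \<in> borel_measurable ?N"
      by (intro borel_measurable_lebesgue_on borel_measurable_indicator Sb)+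
    have KN: "(\<integral>x. K x * F n x \<partial>lborel) = (\<integral>x. K x * F n x \<partial>?N)" for n
    proof -
      have "(\<integral>x. K x * F n x \<partial>?N) = (\<integral>x. indicator D x *\<^sub>R (K x * F n x) \<partial>lebesgue)"
        using Dm by (subst integral_restrict_space) auto
      also have "\<dots> = (\<integral>x. K x * F n x \<partial>lebesgue)"
        using K(3) sub by (intro Bochner_Integration.integral_cong) (auto simp: indicator_def)
      also have "\<dots> = (\<integral>x. K x * F n x \<partial>lborel)"
        using K(1) Fb[of n] by (intro integral_completion) auto
      finally show ?thesis by simp
    qed
    define Tn where "Tn n w = indicator W0 w *\<^sub>R F n (face w)" for n w
    have Tn_pb: "Tn n = trace_pullback \<tau> h M (F n)" for n by (simp add: Tn_def trace_pullback_def fun_eq_iff)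
    have Tn_i: "integrable lborel (Tn n)" for n
      unfolding Tn_pb
    proof (rule trace_pullback_integrable)
      interpret finite_measure \<sigma> by (rule finite_face_measure)
      have "continuous_on (closure W0) (\<lambda>w. F n (face w))"
        by (rule continuous_on_compose2[OF smooth_continuous_on[OF F, of UNIV]]) (auto intro!: continuous_intros)
      then have "bounded ((\<lambda>w. F n (face w)) ` closure W0)"
        using W0_bounded by (intro compact_imp_bounded compact_continuous_image) (simp_all add: compact_closure)
      then obtain Q where "\<forall>y \<in> (\<lambda>w. F n (face w)) ` closure W0. cmod y \<le> Q"
        unfolding bounded_iff by (elim exE)
      then have "cmod (F n (face w)) \<le> Q" if "w \<in> closure W0" for w
        using that by (rule bspec[OF _ imageI])
      then have Q: "cmod (F n (face w)) \<le> Q" if "w \<in> W0" for w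
        using that closure_subset[of W0] by blast
      have "(\<integral>\<^sup>+x. ennreal (cmod (F n x)) \<partial>\<sigma>) = (\<integral>\<^sup>+w. indicator W0 w * ennreal (cmod (F n (face w))) \<partial>lborel)"
        using borel_measurable_face[OF Fb] by (intro nn_integral_face) auto
      also have "\<dots> \<le> (\<integral>\<^sup>+w. ennreal Q * indicator W0 w \<partial>lborel)"
        by (intro nn_integral_mono) (simp add: indicator_def ennreal_leI Q del: mem_Times_iff)
      also have "\<dots> < \<infinity>"
        using emeasure_bounded_finite[OF W0_bounded] by (simp add: nn_integral_cmult_indicator ennreal_mult_less_top)
      finally show "integrable \<sigma> (F n)"
        using borel_measurable_face[OF Fb] by (simp add: integrable_iff_bounded)
    qed
    have KT: "(\<integral>z. K (?P z) * F n (?P (fst z, 0)) \<partial>lborel) = (\<integral>z. K (?P z) * Tn n (fst z) \<partial>lborel)" for n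
    proof (rule Bochner_Integration.integral_cong)
      fix z
      show "K (?P z) * F n (?P (fst z, 0)) = K (?P z) * Tn n (fst z)"
      proof (cases "z \<in> ({0<..<A} \<times> {-M<..<M}) \<times> {0<..<B}")
        case True
        then have "fst z \<in> W0" using AB by auto
        then show ?thesis by (simp add: Tn_def face0)
      next
        case False
        then show ?thesis using K(3) param_in_slab[OF det] by simp
      qed
    qed simp
    have a: "(\<lambda>n. \<integral>x. K x * F n x \<partial>?N) \<longlonglongrightarrow> (\<integral>x. K x * f x \<partial>?N)"
      by (rule L2_tendsto_integral_mult[OF fin Fi fi conv borel_measurable_lebesgue_on[OF K(1)] K(2)])
    have b: "(\<lambda>n. \<integral>z. K (?P z) * Tn n (fst z) \<partial>lborel) \<longlonglongrightarrow> (\<integral>z. K (?P z) * ?T (fst z) \<partial>lborel)"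
    proof -
      have L: "(\<lambda>n. ennreal (C * B) * (\<integral>\<^sup>+x. ennreal (cmod (F n x - g x)) \<partial>\<sigma>)) \<longlonglongrightarrow> ennreal (C * B) * 0"
        using borel_measurable_face[OF Fb] gm convT
        by (intro tendsto_mult_ennreal tendsto_const L2_tendsto_L1[OF finite_face_measure]) auto
      have le: "ennreal (dist (\<integral>z. K (?P z) * Tn n (fst z) \<partial>lborel) (\<integral>z. K (?P z) * ?T (fst z) \<partial>lborel))
          \<le> ennreal (C * B) * (\<integral>\<^sup>+x. ennreal (cmod (F n x - g x)) \<partial>\<sigma>)" for n
      proof -
        have "dist (\<integral>z. K (?P z) * Tn n (fst z) \<partial>lborel) (\<integral>z. K (?P z) * ?T (fst z) \<partial>lborel)
            = cmod (\<integral>z. K (?P z) * (Tn n (fst z) - ?T (fst z)) \<partial>lborel)"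
          using kernel_trace_integrable(1)[OF Tn_i det K AB(3)] kernel_trace_integrable(1)[OF Ti det K AB(3)]
          by (simp add: dist_norm right_diff_distrib)
        also have "ennreal \<dots> \<le> ennreal (C * B) * (\<integral>\<^sup>+w. ennreal (cmod (Tn n w - ?T w)) \<partial>lborel)"
          using Tn_i Ti by (intro kernel_trace_integrable(2)[OF _ det K AB(3)]) auto
        also have "(\<integral>\<^sup>+w. ennreal (cmod (Tn n w - ?T w)) \<partial>lborel) = (\<integral>\<^sup>+x. ennreal (cmod (F n x - g x)) \<partial>\<sigma>)"
          using borel_measurable_face[OF Fb] gm
          by (subst nn_integral_face) (auto simp: Tn_def trace_pullback_def indicator_def intro!: nn_integral_cong)
        finally show ?thesis .
      qed
      have "(\<lambda>n. ennreal (dist (\<integral>z. K (?P z) * Tn n (fst z) \<partial>lborel) (\<integral>z. K (?P z) * ?T (fst z) \<partial>lborel))) \<longlonglongrightarrow> 0"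
        by (rule tendsto_sandwich[OF _ always_eventually[OF allI[OF le]] tendsto_const]) (use L in simp_all)
      then show ?thesis
        unfolding tendsto_dist_iff[of "\<lambda>n. \<integral>z. K (?P z) * Tn n (fst z) \<partial>lborel"] by (subst (asm) ennreal_tendsto_0_iff) auto
    qed
    \<comment> \<open>The derivative of F n is replaced by its limit g' on the slab, at the price of
      their \<open>L1\<close> distance over all of D, which \<open>dist0\<close> controls.\<close>
    have ineq: "ennreal (cmod ((\<integral>x. K x * F n x \<partial>?N) - ?J *\<^sub>R (\<integral>z. K (?P z) * Tn n (fst z) \<partial>lborel)))
        \<le> ennreal (C * B) * ((\<integral>\<^sup>+x. indicator ?S x * ennreal (cmod (g' x)) \<partial>?N) + (\<integral>\<^sup>+x. ennreal (cmod (Gn n x - g' x)) \<partial>?N))" for n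
    proof -
      have "ennreal (cmod ((\<integral>x. K x * F n x \<partial>?N) - ?J *\<^sub>R (\<integral>z. K (?P z) * Tn n (fst z) \<partial>lborel)))
          \<le> ennreal (C * B) * (\<integral>\<^sup>+x. indicator ?S x * ennreal (cmod (Gn n x)) \<partial>lborel)"
        using smooth_trace_estimate[OF F det K AB(1,3)] unfolding KN KT Gn_def .
      also have "(\<integral>\<^sup>+x. indicator ?S x * ennreal (cmod (Gn n x)) \<partial>lborel) = (\<integral>\<^sup>+x. indicator ?S x * ennreal (cmod (Gn n x)) \<partial>?N)"
      proof -
        have "(\<integral>\<^sup>+x. indicator ?S x * ennreal (cmod (Gn n x)) \<partial>?N) = (\<integral>\<^sup>+x. indicator ?S x * ennreal (cmod (Gn n x)) * indicator D x \<partial>lborel)"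
          using Dm by (subst nn_integral_restrict_space) (auto simp: nn_integral_completion)
        also have "\<dots> = (\<integral>\<^sup>+x. indicator ?S x * ennreal (cmod (Gn n x)) \<partial>lborel)"
          using sub by (intro nn_integral_cong) (auto simp: indicator_def)
        finally show ?thesis by simp
      qed
      also have "\<dots> \<le> (\<integral>\<^sup>+x. indicator ?S x * ennreal (cmod (g' x)) + ennreal (cmod (Gn n x - g' x)) \<partial>?N)"
      proof (rule nn_integral_mono)
        fix x
        have "cmod (Gn n x) \<le> cmod (g' x) + cmod (Gn n x - g' x)"
          using norm_triangle_ineq[of "g' x" "Gn n x - g' x"] by simp
        then have "ennreal (cmod (Gn n x)) \<le> ennreal (cmod (g' x)) + ennreal (cmod (Gn n x - g' x))"
          by (simp add: ennreal_plus[symmetric] ennreal_leI del: ennreal_plus)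
        then show "indicator ?S x * ennreal (cmod (Gn n x)) \<le> indicator ?S x * ennreal (cmod (g' x)) + ennreal (cmod (Gn n x - g' x))"
          by (simp add: indicator_def)
      qed
      also have "\<dots> = (\<integral>\<^sup>+x. indicator ?S x * ennreal (cmod (g' x)) \<partial>?N) + (\<integral>\<^sup>+x. ennreal (cmod (Gn n x - g' x)) \<partial>?N)"
      proof -
        have [measurable]: "Gn n \<in> borel_measurable ?N" by (rule borel_measurable_lebesgue_on[OF Gnb])
        note [measurable] = Sm g'm
        show ?thesis by (intro nn_integral_add) measurable
      qed
      finally show ?thesis by (simp add: mult_left_mono)
    qed
    have "ennreal (cmod ((\<integral>x. K x * f x \<partial>?N) - ?J *\<^sub>R (\<integral>z. K (?P z) * ?T (fst z) \<partial>lborel)))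
      \<le> ennreal (C * B) * ((\<integral>\<^sup>+x. indicator ?S x * ennreal (cmod (g' x)) \<partial>?N) + 0)"
    proof (rule LIMSEQ_le[OF _ _ exI[of _ 0]])
      show "(\<lambda>n. ennreal (cmod ((\<integral>x. K x * F n x \<partial>?N) - ?J *\<^sub>R (\<integral>z. K (?P z) * Tn n (fst z) \<partial>lborel)))) \<longlonglongrightarrow>
        ennreal (cmod ((\<integral>x. K x * f x \<partial>?N) - ?J *\<^sub>R (\<integral>z. K (?P z) * ?T (fst z) \<partial>lborel)))"
        by (intro tendsto_ennrealI tendsto_norm tendsto_diff a tendsto_scaleR tendsto_const b)
      show "(\<lambda>n. ennreal (C * B) * ((\<integral>\<^sup>+x. indicator ?S x * ennreal (cmod (g' x)) \<partial>?N) + (\<integral>\<^sup>+x. ennreal (cmod (Gn n x - g' x)) \<partial>?N)))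
        \<longlonglongrightarrow> ennreal (C * B) * ((\<integral>\<^sup>+x. indicator ?S x * ennreal (cmod (g' x)) \<partial>?N) + 0)"
        by (intro ennreal_tendsto_cmult tendsto_const tendsto_add dist0) auto
    qed (use ineq in auto)
    also have "\<dots> = ennreal (C * B) * ennreal (\<integral>x. indicator ?S x * cmod (g' x) \<partial>?N)"
    proof -
      have "integrable ?N (\<lambda>x. indicator ?S x * cmod (g' x))"
        by (intro integrable_indicator_norm L2_integrable[OF fin g'L] Sb)
      then have "(\<integral>\<^sup>+x. ennreal (indicator ?S x * cmod (g' x)) \<partial>?N) = ennreal (\<integral>x. indicator ?S x * cmod (g' x) \<partial>?N)"
        by (intro nn_integral_eq_integral) auto
      moreover have "ennreal (indicator ?S x * cmod (g' x)) = indicator ?S x * ennreal (cmod (g' x))" for x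
        by (simp add: indicator_def)
      ultimately show ?thesis by simp
    qed
    also have "\<dots> = ennreal (C * B * (\<integral>x. indicator ?S x * cmod (g' x) \<partial>?N))"
      using C AB by (simp add: ennreal_mult)
    finally show ?thesis
      using C AB by (subst (asm) ennreal_le_iff) (auto intro!: mult_nonneg_nonneg integral_nonneg_AE)
  qed
  then show ?thesis
    unfolding trace_estimate_def using fL Ti g'L by blast
qed

end

section \<open>Linear combinations of trace estimates\<close>

lemma trace_estimate_D:
  assumes "trace_estimate D \<tau> d h M f T"
  shows "f \<in> L2 (lebesgue_on D)" "integrable lborel T"
  using assms by (auto simp: trace_estimate_def)

lemma trace_estimateI:
  assumes "f \<in> L2 (lebesgue_on D)" "integrable lborel T" "g \<in> L2 (lebesgue_on D)"
    "\<And>K A B C. K \<in> borel_measurable borel \<Longrightarrow> (\<And>x. cmod (K x) \<le> C) \<Longrightarrow> (\<And>x. x \<notin> slab \<tau> d M A B \<Longrightarrow> K x = 0)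
      \<Longrightarrow> slab \<tau> d M A B \<subseteq> D \<Longrightarrow> 0 < A \<Longrightarrow> A \<le> h \<Longrightarrow> 0 < B \<Longrightarrow>
        cmod ((\<integral>x. K x * f x \<partial>lebesgue_on D) - \<bar>det2 \<tau> d\<bar> *\<^sub>R (\<integral>z. K (param \<tau> d z) * T (fst z) \<partial>lborel))
          \<le> C * B * (\<integral>x. indicator (slab \<tau> d M A B) x * cmod (g x) \<partial>lebesgue_on D)"
  shows "trace_estimate D \<tau> d h M f T"
  unfolding trace_estimate_def using assms by blast

lemma trace_estimateE:
  assumes "trace_estimate D \<tau> d h M f T"
  obtains g where "g \<in> L2 (lebesgue_on D)"
    "\<And>K A B C. K \<in> borel_measurable borel \<Longrightarrow> (\<And>x. cmod (K x) \<le> C) \<Longrightarrow> (\<And>x. x \<notin> slab \<tau> d M A B \<Longrightarrow> K x = 0)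
      \<Longrightarrow> slab \<tau> d M A B \<subseteq> D \<Longrightarrow> 0 < A \<Longrightarrow> A \<le> h \<Longrightarrow> 0 < B \<Longrightarrow>
        cmod ((\<integral>x. K x * f x \<partial>lebesgue_on D) - \<bar>det2 \<tau> d\<bar> *\<^sub>R (\<integral>z. K (param \<tau> d z) * T (fst z) \<partial>lborel))
          \<le> C * B * (\<integral>x. indicator (slab \<tau> d M A B) x * cmod (g x) \<partial>lebesgue_on D)"
proof -
  obtain g where g: "g \<in> L2 (lebesgue_on D)"
    "\<forall>K A B C. K \<in> borel_measurable borel \<and> (\<forall>x. cmod (K x) \<le> C) \<and> (\<forall>x. x \<notin> slab \<tau> d M A B \<longrightarrow> K x = 0)
         \<and> slab \<tau> d M A B \<subseteq> D \<and> 0 < A \<and> A \<le> h \<and> 0 < B \<longrightarrow>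
        cmod ((\<integral>x. K x * f x \<partial>lebesgue_on D)
            - \<bar>det2 \<tau> d\<bar> *\<^sub>R (\<integral>z. K (param \<tau> d z) * T (fst z) \<partial>lborel))
          \<le> C * B * (\<integral>x. indicator (slab \<tau> d M A B) x * cmod (g x) \<partial>lebesgue_on D)"
    using assms unfolding trace_estimate_def by (elim conjE bexE)
  show ?thesis
    by (rule that[OF g(1)], rule g(2)[rule_format], intro conjI allI impI)
qed

lemma trace_estimate_add:
  assumes D: "open D" "bounded D" and det: "det2 \<tau> d \<noteq> 0"
    and 1: "trace_estimate D \<tau> d h M f1 T1" and 2: "trace_estimate D \<tau> d h M f2 T2"
  shows "trace_estimate D \<tau> d h M (\<lambda>x. f1 x + f2 x) (\<lambda>w. T1 w + T2 w)"
proof -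
  let ?N = "lebesgue_on D"
  have fin: "finite_measure ?N" by (rule finite_measure_lebesgue_on_open[OF D])
  note L = trace_estimate_D[OF 1] trace_estimate_D[OF 2]
  obtain g1 where g1: "g1 \<in> L2 ?N" "\<And>K A B C. K \<in> borel_measurable borel \<Longrightarrow> (\<And>x. cmod (K x) \<le> C) \<Longrightarrow> (\<And>x. x \<notin> slab \<tau> d M A B \<Longrightarrow> K x = 0)
      \<Longrightarrow> slab \<tau> d M A B \<subseteq> D \<Longrightarrow> 0 < A \<Longrightarrow> A \<le> h \<Longrightarrow> 0 < B \<Longrightarrow>
        cmod ((\<integral>x. K x * f1 x \<partial>?N) - \<bar>det2 \<tau> d\<bar> *\<^sub>R (\<integral>z. K (param \<tau> d z) * T1 (fst z) \<partial>lborel))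
          \<le> C * B * (\<integral>x. indicator (slab \<tau> d M A B) x * cmod (g1 x) \<partial>?N)"
    by (rule trace_estimateE[OF 1]) blast
  obtain g2 where g2: "g2 \<in> L2 ?N" "\<And>K A B C. K \<in> borel_measurable borel \<Longrightarrow> (\<And>x. cmod (K x) \<le> C) \<Longrightarrow> (\<And>x. x \<notin> slab \<tau> d M A B \<Longrightarrow> K x = 0)
      \<Longrightarrow> slab \<tau> d M A B \<subseteq> D \<Longrightarrow> 0 < A \<Longrightarrow> A \<le> h \<Longrightarrow> 0 < B \<Longrightarrow>
        cmod ((\<integral>x. K x * f2 x \<partial>?N) - \<bar>det2 \<tau> d\<bar> *\<^sub>R (\<integral>z. K (param \<tau> d z) * T2 (fst z) \<partial>lborel))
          \<le> C * B * (\<integral>x. indicator (slab \<tau> d M A B) x * cmod (g2 x) \<partial>?N)"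
    by (rule trace_estimateE[OF 2]) blast
  \<comment> \<open>The moduli are added, not the functions: cancellation in \<open>g1 + g2\<close>
    would spoil the bound.\<close>
  define g where "g x = complex_of_real (cmod (g1 x)) + complex_of_real (cmod (g2 x))" for x
  have gL: "g \<in> L2 ?N" unfolding g_def[abs_def] by (intro L2_add L2_norm g1 g2)
  have cg: "cmod (g x) = cmod (g1 x) + cmod (g2 x)" for x
    unfolding g_def of_real_add[symmetric] norm_of_real by simp
  have "cmod ((\<integral>x. K x * (f1 x + f2 x) \<partial>?N) - \<bar>det2 \<tau> d\<bar> *\<^sub>R (\<integral>z. K (param \<tau> d z) * (T1 (fst z) + T2 (fst z)) \<partial>lborel))
          \<le> C * B * (\<integral>x. indicator (slab \<tau> d M A B) x * cmod (g x) \<partial>?N)"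
    if K: "K \<in> borel_measurable borel" "\<And>x. cmod (K x) \<le> C" "\<And>x. x \<notin> slab \<tau> d M A B \<Longrightarrow> K x = 0"
      and sub: "slab \<tau> d M A B \<subseteq> D" and AB: "0 < A" "A \<le> h" "0 < B" for K A B C
  proof -
    have Kf: "integrable ?N (\<lambda>x. K x * f1 x)" "integrable ?N (\<lambda>x. K x * f2 x)"
      by (rule integrable_bounded_mult[OF L2_integrable[OF fin] borel_measurable_lebesgue_on[OF K(1)] K(2)]; fact L)+
    have KT: "integrable lborel (\<lambda>z. K (param \<tau> d z) * T1 (fst z))" "integrable lborel (\<lambda>z. K (param \<tau> d z) * T2 (fst z))"
      using kernel_trace_integrable(1)[OF L(2) det K AB(3)] kernel_trace_integrable(1)[OF L(4) det K AB(3)] by simp_all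
    have gi: "integrable ?N (\<lambda>x. indicator (slab \<tau> d M A B) x * cmod (g' x))" if "g' \<in> L2 ?N" for g'
      by (intro integrable_indicator_norm L2_integrable[OF fin that] borel_open open_slab)
    have "(\<integral>x. K x * (f1 x + f2 x) \<partial>?N) - \<bar>det2 \<tau> d\<bar> *\<^sub>R (\<integral>z. K (param \<tau> d z) * (T1 (fst z) + T2 (fst z)) \<partial>lborel) =
      ((\<integral>x. K x * f1 x \<partial>?N) - \<bar>det2 \<tau> d\<bar> *\<^sub>R (\<integral>z. K (param \<tau> d z) * T1 (fst z) \<partial>lborel)) +
      ((\<integral>x. K x * f2 x \<partial>?N) - \<bar>det2 \<tau> d\<bar> *\<^sub>R (\<integral>z. K (param \<tau> d z) * T2 (fst z) \<partial>lborel))"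
      using Kf KT by (simp add: distrib_left scaleR_add_right)
    also have "cmod \<dots> \<le> C * B * (\<integral>x. indicator (slab \<tau> d M A B) x * cmod (g1 x) \<partial>?N) +
        C * B * (\<integral>x. indicator (slab \<tau> d M A B) x * cmod (g2 x) \<partial>?N)"
      by (intro norm_triangle_mono g1(2) g2(2) K sub AB)
    also have "\<dots> = C * B * (\<integral>x. indicator (slab \<tau> d M A B) x * cmod (g x) \<partial>?N)"
      using gi[OF g1(1)] gi[OF g2(1)] by (simp add: cg distrib_left)
    finally show ?thesis .
  qed
  then show ?thesis
    by (rule trace_estimateI[OF L2_add[OF L(1,3)] Bochner_Integration.integrable_add[OF L(2,4)] gL])
qed

lemma trace_estimate_cmult:
  assumes "trace_estimate D \<tau> d h M f T"
  shows "trace_estimate D \<tau> d h M (\<lambda>x. c * f x) (\<lambda>w. c * T w)"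
proof -
  let ?N = "lebesgue_on D"
  note L = trace_estimate_D[OF assms]
  obtain g where g: "g \<in> L2 ?N" "\<And>K A B C. K \<in> borel_measurable borel \<Longrightarrow> (\<And>x. cmod (K x) \<le> C) \<Longrightarrow> (\<And>x. x \<notin> slab \<tau> d M A B \<Longrightarrow> K x = 0)
      \<Longrightarrow> slab \<tau> d M A B \<subseteq> D \<Longrightarrow> 0 < A \<Longrightarrow> A \<le> h \<Longrightarrow> 0 < B \<Longrightarrow>
        cmod ((\<integral>x. K x * f x \<partial>?N) - \<bar>det2 \<tau> d\<bar> *\<^sub>R (\<integral>z. K (param \<tau> d z) * T (fst z) \<partial>lborel))
          \<le> C * B * (\<integral>x. indicator (slab \<tau> d M A B) x * cmod (g x) \<partial>?N)"
    by (rule trace_estimateE[OF assms]) blast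
  have "cmod ((\<integral>x. K x * (c * f x) \<partial>?N) - \<bar>det2 \<tau> d\<bar> *\<^sub>R (\<integral>z. K (param \<tau> d z) * (c * T (fst z)) \<partial>lborel))
          \<le> C * B * (\<integral>x. indicator (slab \<tau> d M A B) x * cmod (c * g x) \<partial>?N)"
    if K: "K \<in> borel_measurable borel" "\<And>x. cmod (K x) \<le> C" "\<And>x. x \<notin> slab \<tau> d M A B \<Longrightarrow> K x = 0"
      and sub: "slab \<tau> d M A B \<subseteq> D" and AB: "0 < A" "A \<le> h" "0 < B" for K A B C
  proof -
    have "(\<integral>x. K x * (c * f x) \<partial>?N) - \<bar>det2 \<tau> d\<bar> *\<^sub>R (\<integral>z. K (param \<tau> d z) * (c * T (fst z)) \<partial>lborel) =
      c * ((\<integral>x. K x * f x \<partial>?N) - \<bar>det2 \<tau> d\<bar> *\<^sub>R (\<integral>z. K (param \<tau> d z) * T (fst z) \<partial>lborel))"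
      by (simp add: mult.left_commute[of _ c] right_diff_distrib)
    also have "cmod \<dots> \<le> cmod c * (C * B * (\<integral>x. indicator (slab \<tau> d M A B) x * cmod (g x) \<partial>?N))"
      unfolding norm_mult by (intro mult_left_mono g(2) K sub AB) auto
    also have "\<dots> = C * B * (\<integral>x. indicator (slab \<tau> d M A B) x * cmod (c * g x) \<partial>?N)"
      by (simp add: norm_mult mult.left_commute[of _ "cmod c"])
    finally show ?thesis .
  qed
  then show ?thesis
    by (rule trace_estimateI[OF L2_cmult[OF L(1)] integrable_mult_right[OF L(2)] L2_cmult[OF g(1)]])
qed

text \<open>The boundary conditions hold only almost everywhere on the face. A null set there,
  extended along the depth, is null in the product.\<close>

lemma trace_estimate_cong_AE:
  assumes "trace_estimate D \<tau> d h M f T" and ae: "AE w in lborel. T w = T' w" and m: "T' \<in> borel_measurable borel"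
  shows "trace_estimate D \<tau> d h M f T'"
proof -
  note L = trace_estimate_D[OF assms(1)]
  have Tm: "T \<in> borel_measurable borel" using borel_measurable_integrable[OF L(2)] by simp
  have "(\<integral>z. K (param \<tau> d z) * T (fst z) \<partial>lborel) = (\<integral>z. K (param \<tau> d z) * T' (fst z) \<partial>lborel)"
    if K: "K \<in> borel_measurable borel" for K
  proof (rule integral_cong_AE)
    have [measurable]: "K \<in> borel_measurable borel" by fact
    have "(\<lambda>z::(real \<times> real) \<times> real. H (fst z)) \<in> borel_measurable borel" if "H \<in> borel_measurable borel" for H :: "real \<times> real \<Rightarrow> complex"
    proof -
      have "(\<lambda>z::(real \<times> real) \<times> real. H (fst z)) \<in> borel_measurable (borel \<Otimes>\<^sub>M borel)" using that by measurable
      then show ?thesis by (simp add: borel_prod)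
    qed
    note [measurable] = this[OF Tm] this[OF m] Tm m
    show "(\<lambda>z. K (param \<tau> d z) * T (fst z)) \<in> borel_measurable lborel"
      "(\<lambda>z. K (param \<tau> d z) * T' (fst z)) \<in> borel_measurable lborel" by measurable
    have "{z \<in> space (lborel \<Otimes>\<^sub>M lborel). T (fst z) = T' (fst z)} \<in> sets (lborel \<Otimes>\<^sub>M lborel)"
      by measurable
    then have "AE z in lborel \<Otimes>\<^sub>M lborel. T (fst z) = T' (fst z)"
      using ae by (intro lborel_pair.AE_pair_measure) auto
    then show "AE z in lborel. K (param \<tau> d z) * T (fst z) = K (param \<tau> d z) * T' (fst z)"
      unfolding lborel_prod by eventually_elim simp
  qed
  moreover have "integrable lborel T'"
    using L(2) integrable_cong_AE[of T lborel T'] ae m Tm by simp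
  ultimately show ?thesis
    using assms(1) unfolding trace_estimate_def by simp
qed

section \<open>Integrals over shrinking slabs\<close>

lemma slab_mono: "A \<le> A' \<Longrightarrow> B \<le> B' \<Longrightarrow> slab \<tau> d M A B \<subseteq> slab \<tau> d M A' B'"
  by (auto simp: slab_def)

lemma measure_slab:
  assumes det: "det2 \<tau> d \<noteq> 0" and "0 \<le> A" "0 \<le> B" "0 \<le> M"
  shows "emeasure lborel (slab \<tau> d M A B) = ennreal (\<bar>det2 \<tau> d\<bar> * (A * (2 * M) * B))"
proof -
  have sm [measurable]: "slab \<tau> d M A B \<in> sets borel" by (intro borel_open open_slab)
  let ?Z = "({0<..<A} \<times> {-M<..<M}) \<times> {0<..<B}"
  have "emeasure lborel (slab \<tau> d M A B) = (\<integral>\<^sup>+x. indicator (slab \<tau> d M A B) x \<partial>lborel)" by simp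
  also have "\<dots> = ennreal \<bar>det2 \<tau> d\<bar> * (\<integral>\<^sup>+z. indicator (slab \<tau> d M A B) (param \<tau> d z) \<partial>lborel)"
    by (rule nn_integral_param[OF _ det]) measurable
  also have "(\<integral>\<^sup>+z. indicator (slab \<tau> d M A B) (param \<tau> d z) \<partial>lborel) = (\<integral>\<^sup>+z. indicator ?Z z \<partial>lborel)"
    by (intro nn_integral_cong) (simp add: indicator_def param_in_slab[OF det] del: mem_Times_iff)
  also have "\<dots> = emeasure (lborel \<Otimes>\<^sub>M lborel) ?Z"
    by (subst nn_integral_indicator) (auto simp: lborel_prod intro!: borel_open open_Times)
  also have "\<dots> = emeasure (lborel \<Otimes>\<^sub>M lborel) ({0<..<A} \<times> {-M<..<M}) * ennreal B"
  proof -
    have "{0<..<A} \<times> {-M<..<M} \<in> sets (borel :: (real \<times> real) measure)" by (intro borel_open open_Times) auto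
    then show ?thesis using assms by (subst lborel.emeasure_pair_measure_Times) (auto simp: lborel_prod)
  qed
  also have "\<dots> = ennreal (A * (2 * M)) * ennreal B"
    using assms by (subst lborel.emeasure_pair_measure_Times) (auto simp: ennreal_mult)
  finally show ?thesis using assms by (simp add: ennreal_mult)
qed

lemma tendsto_inverse_Suc: "(\<lambda>n. c * inverse (real (Suc n))) \<longlonglongrightarrow> 0"
  using tendsto_mult[OF tendsto_const[of c] LIMSEQ_inverse_real_of_nat] by simp

lemma scale_Suc_le: "0 \<le> B \<Longrightarrow> B * inverse (real (Suc n)) \<le> B"
  by (rule mult_left_le) (simp_all add: inverse_le_1_iff)

text \<open>The depth tends to 0, so every fixed point eventually leaves the slabs; dominated
  convergence with g itself does the rest.\<close>

lemma slab_integral_shrink: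
  assumes g: "integrable (lebesgue_on D) g" and B: "0 < B" and A: "\<And>n. A n \<le> Amax"
    and g0: "\<And>x. 0 \<le> g x"
  shows "(\<lambda>n. \<integral>x. indicator (slab \<tau> d M (A n) (B * inverse (real (Suc n)))) x * (g x :: real) \<partial>lebesgue_on D) \<longlonglongrightarrow> 0"
proof -
  let ?S = "\<lambda>n. slab \<tau> d M (A n) (B * inverse (real (Suc n)))"
  have Sm: "(indicator (?S n) :: space \<Rightarrow> real) \<in> borel_measurable (lebesgue_on D)" for n
    by (intro borel_measurable_lebesgue_on borel_measurable_indicator borel_open open_slab)
  have "(\<lambda>n. \<integral>x. indicator (?S n) x * g x \<partial>lebesgue_on D) \<longlonglongrightarrow> (\<integral>x. 0 \<partial>lebesgue_on D)"
  proof (rule integral_dominated_convergence[OF _ _ g])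
    show "(\<lambda>x. indicator (?S n) x * g x) \<in> borel_measurable (lebesgue_on D)" for n
      using Sm[of n] borel_measurable_integrable[OF g] by (rule borel_measurable_times)
    have "(\<lambda>n. indicator (?S n) x * g x) \<longlonglongrightarrow> 0" for x
    proof (cases "0 < coord2 \<tau> d x")
      case True
      have "eventually (\<lambda>n. B * inverse (real (Suc n)) < coord2 \<tau> d x) sequentially"
        by (rule order_tendstoD(2)[OF tendsto_inverse_Suc True])
      then have "eventually (\<lambda>n. indicator (?S n) x * g x = 0) sequentially"
        by eventually_elim (simp add: slab_def indicator_def)
      then show ?thesis by (rule tendsto_eventually)
    next
      case False
      then show ?thesis by (simp add: slab_def indicator_def)
    qed
    then show "AE x in lebesgue_on D. (\<lambda>n. indicator (?S n) x * g x) \<longlonglongrightarrow> 0" by simp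
    show "AE x in lebesgue_on D. norm (indicator (?S n) x * g x) \<le> g x" for n
      using g0 by (intro AE_I2) (simp add: indicator_def)
  qed simp
  then show ?thesis by simp
qed

text \<open>Cauchy-Schwarz on the slab, whose volume is quadratic in the scale.\<close>

lemma slab_integral_small:
  assumes D: "open D" "bounded D" and det: "det2 \<tau> d \<noteq> 0" and g: "g \<in> L2 (lebesgue_on D)"
    and AB: "0 < A" "0 < B" "0 < M"
  shows "(\<lambda>n. real (Suc n) * (\<integral>x. indicator (slab \<tau> d M (A * inverse (real (Suc n))) (B * inverse (real (Suc n)))) x
    * cmod (g x) \<partial>lebesgue_on D)) \<longlonglongrightarrow> 0"
proof -
  let ?r = "\<lambda>n. inverse (real (Suc n))" and ?N = "lebesgue_on D"
  let ?S = "\<lambda>n. slab \<tau> d M (A * ?r n) (B * ?r n)"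
  interpret finite_measure ?N by (rule finite_measure_lebesgue_on_open[OF D])
  define c where "c = \<bar>det2 \<tau> d\<bar> * (A * (2 * M) * B)"
  have c: "0 < c" using det AB by (simp add: c_def)
  define I where "I n = (\<integral>x. indicator (?S n) x * (cmod (g x))\<^sup>2 \<partial>?N)" for n
  have I: "I \<longlonglongrightarrow> 0"
    unfolding I_def using AB L2_D(2)[OF g]
    by (intro slab_integral_shrink[where Amax = A]) (auto simp: scale_Suc_le simp del: of_nat_Suc)
  have Sm: "?S n \<in> sets borel" for n by (intro borel_open open_slab)
  have SN: "?S n \<inter> D \<in> sets ?N" for n
    using D Sm[of n] by (subst sets_restrict_space_iff) auto
  \<comment> \<open>A weighted arithmetic-geometric mean, as in \<open>cube_integral_bound\<close>.
    With q = n + 1 the slab has volume c / q^2, and the weight q t turns the factor q on the left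
    into a bound free of q except through I n.\<close>
  have bound: "real (Suc n) * (\<integral>x. indicator (?S n) x * cmod (g x) \<partial>?N) \<le> (I n / t + c * t) / 2" if t: "0 < t" for n t
  proof -
    let ?q = "real (Suc n)"
    have i2: "integrable ?N (\<lambda>x. indicator (?S n) x * (cmod (g x))\<^sup>2)"
    proof -
      have "integrable ?N (\<lambda>x. complex_of_real ((cmod (g x))\<^sup>2))" using L2_D(2)[OF g] by (rule integrable_of_real)
      from integrable_indicator_norm[OF this Sm[of n]] show ?thesis unfolding norm_of_real abs_power2 .
    qed
    have i1: "integrable ?N (\<lambda>x. indicator (?S n \<inter> D) x :: real)"
      by (rule integrable_real_indicator[OF SN]) (simp add: emeasure_eq_measure)
    have "(\<integral>x. indicator (?S n) x * cmod (g x) \<partial>?N) \<le>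
        (\<integral>x. (1 / (?q * t) * (indicator (?S n) x * (cmod (g x))\<^sup>2) + ?q * t * indicator (?S n \<inter> D) x) / 2 \<partial>?N)"
    proof (rule integral_mono)
      show "integrable ?N (\<lambda>x. indicator (?S n) x * cmod (g x))"
        by (intro integrable_indicator_norm L2_integrable g Sm finite_measure_axioms)
      show "integrable ?N (\<lambda>x. (1 / (?q * t) * (indicator (?S n) x * (cmod (g x))\<^sup>2) + ?q * t * indicator (?S n \<inter> D) x) / 2)"
        using i1 i2 by (intro integrable_divide Bochner_Integration.integrable_add integrable_mult_right)
      fix x assume "x \<in> space ?N"
      then have x: "x \<in> D" by simp
      have "0 \<le> (cmod (g x) - ?q * t)\<^sup>2 / (?q * t)" using t by simp
      also have "\<dots> = 1 / (?q * t) * (cmod (g x))\<^sup>2 + ?q * t - 2 * cmod (g x)"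
      proof -
        have "(y - p)\<^sup>2 / p = 1 / p * y\<^sup>2 + p - 2 * y" if "0 < p" for y p :: real
          using that by (simp add: power2_eq_square field_simps)
        then show ?thesis using t by simp
      qed
      finally have "cmod (g x) \<le> (1 / (?q * t) * (cmod (g x))\<^sup>2 + ?q * t) / 2" by simp
      then show "indicator (?S n) x * cmod (g x) \<le>
        (1 / (?q * t) * (indicator (?S n) x * (cmod (g x))\<^sup>2) + ?q * t * indicator (?S n \<inter> D) x) / 2"
        using x by (cases "x \<in> ?S n") simp_all
    qed
    also have "\<dots> = (1 / (?q * t) * I n + ?q * t * measure ?N (?S n \<inter> D)) / 2"
      using i1 i2 SN by (simp add: I_def)
    also have "measure ?N (?S n \<inter> D) \<le> c * ?r n * ?r n"
    proof -
      have "emeasure ?N (?S n \<inter> D) = emeasure lebesgue (?S n \<inter> D)"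
        using D by (intro emeasure_restrict_space) auto
      also have "\<dots> \<le> emeasure lebesgue (?S n)" using Sm by (intro emeasure_mono) auto
      also have "\<dots> = ennreal (c * ?r n * ?r n)"
        using measure_slab[OF det, of "A * ?r n" "B * ?r n" M] AB Sm by (simp add: c_def mult_ac)
      finally show ?thesis using c by (simp add: emeasure_eq_measure)
    qed
    also have "(1 / (?q * t) * I n + ?q * t * (c * ?r n * ?r n)) / 2 = ((I n / t + c * t) / 2) * ?r n"
    proof -
      have "(1 / (q * t) * i + q * t * (c * inverse q * inverse q)) / 2 = ((i / t + c * t) / 2) * inverse q"
        if "0 < q" for q i using that t by (simp add: field_simps)
      then show ?thesis by simp
    qed
    finally have "(\<integral>x. indicator (?S n) x * cmod (g x) \<partial>?N) \<le> ((I n / t + c * t) / 2) * ?r n"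
      using t by (simp add: mult_left_mono divide_right_mono)
    then have "?q * (\<integral>x. indicator (?S n) x * cmod (g x) \<partial>?N) \<le> ?q * (((I n / t + c * t) / 2) * ?r n)"
      by (intro mult_left_mono) auto
    also have "\<dots> = (I n / t + c * t) / 2" by simp
    finally show ?thesis .
  qed
  show ?thesis
  proof (rule LIMSEQ_I)
    fix \<epsilon> :: real assume e: "0 < \<epsilon>"
    \<comment> \<open>This makes the volume term c t equal to \<epsilon>; the other term I n / t
      falls below \<epsilon> for large n.\<close>
    define t where "t = \<epsilon> / c"
    have t: "0 < t" using e c by (simp add: t_def)
    have "eventually (\<lambda>n. I n < \<epsilon> * t) sequentially" using e t by (intro order_tendstoD(2)[OF I]) simp
    then obtain n0 where n0: "\<And>n. n \<ge> n0 \<Longrightarrow> I n < \<epsilon> * t" by (auto simp: eventually_sequentially)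
    have "norm (real (Suc n) * (\<integral>x. indicator (?S n) x * cmod (g x) \<partial>?N) - 0) < \<epsilon>" if "n \<ge> n0" for n
    proof -
      have "I n / t < \<epsilon>" using n0[OF that] t by (simp add: pos_divide_less_eq)
      moreover have "c * t = \<epsilon>" using c by (simp add: t_def)
      moreover have "0 \<le> (\<integral>x. indicator (?S n) x * cmod (g x) \<partial>?N)" by (intro integral_nonneg_AE) auto
      ultimately show ?thesis using bound[OF t, of n] by simp
    qed
    then show "\<exists>no. \<forall>n\<ge>no. norm (real (Suc n) * (\<integral>x. indicator (?S n) x * cmod (g x) \<partial>?N) - 0) < \<epsilon>" by blast
  qed
qed

section \<open>Tangential derivatives on a face and blow-up at the edge\<close>

lemma test_functionI:
  assumes "smooth \<phi>" "\<And>x. \<phi> x \<noteq> 0 \<Longrightarrow> x \<in> C" "compact C" "C \<subseteq> D"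
  shows "test_function D \<phi>"
proof -
  have "closure {x. \<phi> x \<noteq> 0} \<subseteq> C"
    using assms(2,3) by (intro closure_minimal compact_imp_closed) auto
  then show ?thesis
    unfolding test_function_def compact_eq_bounded_closed
    using assms compact_imp_bounded[OF assms(3)] by (auto intro: bounded_subset)
qed

lemma test_function_bounded:
  assumes "test_function D \<phi>"
  obtains C where "\<And>x. \<bar>\<phi> x\<bar> \<le> C"
proof -
  have "bounded (\<phi> ` closure {x. \<phi> x \<noteq> 0})"
    using assms unfolding test_function_def
    by (intro compact_imp_bounded compact_continuous_image smooth_continuous_on) auto
  then obtain C where C: "\<forall>y \<in> \<phi> ` closure {x. \<phi> x \<noteq> 0}. norm y \<le> C"
    unfolding bounded_iff by (elim exE)
  have "\<bar>\<phi> x\<bar> \<le> max C 0" for x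
  proof (cases "\<phi> x = 0")
    case False
    then have "x \<in> closure {x. \<phi> x \<noteq> 0}" using closure_subset[of "{x. \<phi> x \<noteq> 0}"] by auto
    then show ?thesis using C by (force simp: le_max_iff_disj)
  qed simp
  then show ?thesis by (rule that)
qed

text \<open>Multiplies the depth by c and fixes the face; a kernel composed with it for c > 1 lives
  on a slab thinner by the factor c.\<close>

definition squeeze :: "real^2 \<Rightarrow> real^2 \<Rightarrow> real \<Rightarrow> space \<Rightarrow> space" where
  "squeeze \<tau> d c x = x + ((c - 1) * coord2 \<tau> d x) *\<^sub>R (d, 0)"

lemma coord2_linear: "coord2 \<tau> d (x + y) = coord2 \<tau> d x + coord2 \<tau> d y" "coord2 \<tau> d (a *\<^sub>R x) = a * coord2 \<tau> d x"
  by (simp_all add: coord2_def det2_def add_divide_distrib[symmetric] algebra_simps)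

lemma bounded_linear_squeeze: "bounded_linear (squeeze \<tau> d c)"
proof -
  have "linear (squeeze \<tau> d c)"
    by (rule linearI) (simp_all add: squeeze_def coord2_linear algebra_simps prod_eq_iff)
  then show ?thesis by (rule linear_conv_bounded_linear[THEN iffD1])
qed

lemma squeeze_param:
  assumes "det2 \<tau> d \<noteq> 0"
  shows "squeeze \<tau> d c (param \<tau> d z) = param \<tau> d (fst z, c * snd z)"
  using assms by (simp add: squeeze_def coord_param) (simp add: param_def algebra_simps)

lemma squeeze_inverse:
  assumes "det2 \<tau> d \<noteq> 0" "c \<noteq> 0"
  shows "squeeze \<tau> d (inverse c) (squeeze \<tau> d c x) = x"
  using param_coord[OF assms(1), of x] squeeze_param[OF assms(1)] assms(2)
  by (metis (no_types, opaque_lifting) fst_conv snd_conv left_inverse mult.assoc mult_1)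

lemma squeeze_in_slab:
  assumes "det2 \<tau> d \<noteq> 0" "0 < c"
  shows "squeeze \<tau> d c x \<in> slab \<tau> d M A B \<longleftrightarrow> x \<in> slab \<tau> d M A (B / c)"
proof -
  let ?z = "((coord1 \<tau> d x, snd x), coord2 \<tau> d x)"
  have "squeeze \<tau> d c x = param \<tau> d (fst ?z, c * snd ?z)"
    using squeeze_param[OF assms(1), of c ?z] param_coord[OF assms(1), of x] by simp
  moreover have "x = param \<tau> d ?z" using param_coord[OF assms(1)] by simp
  ultimately show ?thesis
    using assms(2) unfolding slab_def mem_Collect_eq
    by (simp add: coord_param[OF assms(1)] pos_less_divide_eq mult.commute zero_less_mult_iff)
qed

text \<open>The squeezed kernels concentrate on the face while their marginals there stay the same; since
  the trace of \<open>u\<close> vanishes, so do the traces of its tangential derivatives.\<close>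

lemma tangential_trace_zero:
  assumes D: "open D" "bounded D" and det: "det2 \<tau> d \<noteq> 0"
    and f: "trace_estimate D \<tau> d h M f S" and u: "trace_estimate D \<tau> d h M u (\<lambda>_. 0)"
    and weak: "\<And>\<phi>. test_function D \<phi> \<Longrightarrow>
      (\<integral>x. dir_deriv (\<tau>, 0) \<phi> x *\<^sub>R u x \<partial>lebesgue_on D) = - (\<integral>x. \<phi> x *\<^sub>R f x \<partial>lebesgue_on D)"
    and sub: "slab \<tau> d M A B \<subseteq> D" and AB: "0 < A" "A \<le> h" "0 < B"
    and K: "test_function (slab \<tau> d M A B) K"
  shows "(\<integral>z. of_real (K (param \<tau> d z)) * S (fst z) \<partial>lborel) = 0"
proof -
  let ?N = "lebesgue_on D" and ?P = "param \<tau> d" and ?J = "\<bar>det2 \<tau> d\<bar>"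
  let ?r = "\<lambda>n. inverse (real (Suc n))"
  have fin: "finite_measure ?N" by (rule finite_measure_lebesgue_on_open[OF D])
  define K' where "K' = dir_deriv (\<tau>, 0) K"
  have K': "test_function (slab \<tau> d M A B) K'" unfolding K'_def by (rule test_function_dir_deriv[OF K])
  obtain C where C: "\<And>x. \<bar>K x\<bar> \<le> C" by (rule test_function_bounded[OF K]) blast
  obtain C' where C': "\<And>x. \<bar>K' x\<bar> \<le> C'" by (rule test_function_bounded[OF K']) blast
  obtain g where g: "g \<in> L2 ?N" "\<And>K A B C. K \<in> borel_measurable borel \<Longrightarrow> (\<And>x. cmod (K x) \<le> C) \<Longrightarrow> (\<And>x. x \<notin> slab \<tau> d M A B \<Longrightarrow> K x = 0)
      \<Longrightarrow> slab \<tau> d M A B \<subseteq> D \<Longrightarrow> 0 < A \<Longrightarrow> A \<le> h \<Longrightarrow> 0 < B \<Longrightarrow>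
        cmod ((\<integral>x. K x * f x \<partial>?N) - ?J *\<^sub>R (\<integral>z. K (?P z) * S (fst z) \<partial>lborel))
          \<le> C * B * (\<integral>x. indicator (slab \<tau> d M A B) x * cmod (g x) \<partial>?N)"
    by (rule trace_estimateE[OF f]) blast
  obtain g' where g': "g' \<in> L2 ?N" "\<And>K A B C. K \<in> borel_measurable borel \<Longrightarrow> (\<And>x. cmod (K x) \<le> C) \<Longrightarrow> (\<And>x. x \<notin> slab \<tau> d M A B \<Longrightarrow> K x = 0)
      \<Longrightarrow> slab \<tau> d M A B \<subseteq> D \<Longrightarrow> 0 < A \<Longrightarrow> A \<le> h \<Longrightarrow> 0 < B \<Longrightarrow>
        cmod ((\<integral>x. K x * u x \<partial>?N) - ?J *\<^sub>R (\<integral>z. K (?P z) * 0 \<partial>lborel))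
          \<le> C * B * (\<integral>x. indicator (slab \<tau> d M A B) x * cmod (g' x) \<partial>?N)"
    by (rule trace_estimateE[OF u]) blast
  let ?I = "\<integral>z. of_real (K (?P z)) * S (fst z) \<partial>lborel"
  let ?s = "\<lambda>n. slab \<tau> d M A (B * ?r n)"
  have est: "?J * cmod ?I \<le> C * B * (\<integral>x. indicator (?s n) x * cmod (g x) \<partial>?N) + C' * B * (\<integral>x. indicator (?s n) x * cmod (g' x) \<partial>?N)" for n
  proof -
    let ?q = "real (Suc n)"
    let ?L = "squeeze \<tau> d ?q"
    have q: "0 < ?q" by simp
    have subn: "?s n \<subseteq> D" using AB by (intro order_trans[OF slab_mono sub]) (auto simp: scale_Suc_le simp del: of_nat_Suc)
    have Bn: "0 < B * ?r n" using AB by simp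
    have in_s: "?L x \<in> slab \<tau> d M A B \<longleftrightarrow> x \<in> ?s n" for x
      using squeeze_in_slab[OF det q] by (simp only: divide_inverse)
    have Lc: "continuous_on X ?L" for X by (intro linear_continuous_on bounded_linear_squeeze)
    have sm: "smooth (\<lambda>x. \<phi> (?L x))" if "smooth \<phi>" for \<phi> :: "space \<Rightarrow> real"
      by (rule smooth_compose_linear(1)[OF that bounded_linear_squeeze])
    have Kn: "test_function D (\<lambda>x. K (?L x))"
    proof (rule test_functionI)
      show "smooth (\<lambda>x. K (?L x))" using test_functionD[OF K] by (intro sm)
      let ?X = "squeeze \<tau> d (inverse ?q) ` closure {x. K x \<noteq> 0}"
      show "compact ?X"
        using K unfolding test_function_def
        by (intro compact_continuous_image linear_continuous_on bounded_linear_squeeze) auto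
      show "x \<in> ?X" if "K (?L x) \<noteq> 0" for x
        using that closure_subset[of "{x. K x \<noteq> 0}"] squeeze_inverse[OF det, of ?q x]
        by (intro image_eqI[of _ _ "?L x"]) auto
      have "?L (squeeze \<tau> d (inverse ?q) y) = y" for y
        using squeeze_inverse[OF det, of "inverse ?q" y] by simp
      then have "squeeze \<tau> d (inverse ?q) y \<in> ?s n" if "y \<in> slab \<tau> d M A B" for y
        using that in_s by metis
      moreover have "closure {x. K x \<noteq> 0} \<subseteq> slab \<tau> d M A B" using K by (simp add: test_function_def)
      ultimately show "?X \<subseteq> D" using subn by blast
    qed
    \<comment> \<open>The decisive invariance: differentiating the squeezed kernel along the face
      does not produce the large factor q, so its bound C' is the same for all n.\<close>
    have Ltau: "?L (\<tau>, 0) = (\<tau>, 0)"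
      by (simp add: squeeze_def coord2_def det2_linear prod_eq_iff)
    have dK: "dir_deriv (\<tau>, 0) (\<lambda>x. K (?L x)) = (\<lambda>x. K' (?L x))"
      by (rule ext) (simp only: smooth_compose_linear(2)[OF test_functionD(1)[OF K] bounded_linear_squeeze] Ltau K'_def)
    have meas: "(\<lambda>x. complex_of_real (\<phi> (?L x))) \<in> borel_measurable borel" if "smooth \<phi>" for \<phi> :: "space \<Rightarrow> real"
      by (intro borel_measurable_continuous_onI continuous_on_of_real smooth_continuous_on sm that)
    have zero: "complex_of_real (\<phi> (?L x)) = 0" if "test_function (slab \<tau> d M A B) \<phi>" "x \<notin> ?s n" for \<phi> x
      using test_functionD(2)[OF that(1)] in_s that(2) by simp
    have e1: "cmod ((\<integral>x. of_real (K (?L x)) * f x \<partial>?N) - ?J *\<^sub>R (\<integral>z. of_real (K (?L (?P z))) * S (fst z) \<partial>lborel))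
          \<le> C * (B * ?r n) * (\<integral>x. indicator (?s n) x * cmod (g x) \<partial>?N)"
      using C test_functionD(1)[OF K] zero[OF K] by (intro g(2) meas subn AB Bn) auto
    have e2: "cmod ((\<integral>x. of_real (K' (?L x)) * u x \<partial>?N) - ?J *\<^sub>R (\<integral>z. of_real (K' (?L (?P z))) * 0 \<partial>lborel))
          \<le> C' * (B * ?r n) * (\<integral>x. indicator (?s n) x * cmod (g' x) \<partial>?N)"
      using C' test_functionD(1)[OF K'] zero[OF K'] by (intro g'(2) meas subn AB Bn) auto
    have w: "(\<integral>x. of_real (K' (?L x)) * u x \<partial>?N) = - (\<integral>x. of_real (K (?L x)) * f x \<partial>?N)"
      by (rule weak[OF Kn, unfolded dK scaleR_conv_of_real])
    \<comment> \<open>S is constant in the depth, so squeezing merely divides the face integral by n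
      + 1.\<close>
    have scale: "(\<integral>z. of_real (K (?L (?P z))) * S (fst z) \<partial>lborel) = ?r n *\<^sub>R ?I"
    proof -
      have Si: "integrable lborel S" by (rule trace_estimate_D(2)[OF f])
      have i1: "integrable (lborel \<Otimes>\<^sub>M lborel) (\<lambda>z. of_real (K (?L (?P z))) * S (fst z))"
        unfolding lborel_prod
        by (rule kernel_trace_integrable(1)[OF Si det meas[OF test_functionD(1)[OF K]] _ zero[OF K] Bn, of C]) (simp_all add: C)
      have i2: "integrable (lborel \<Otimes>\<^sub>M lborel) (\<lambda>z. of_real (K (?P z)) * S (fst z))"
        unfolding lborel_prod
      proof (rule kernel_trace_integrable(1)[OF Si det _ _ _ AB(3), of _ C])
        show "(\<lambda>x. complex_of_real (K x)) \<in> borel_measurable borel"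
          by (intro borel_measurable_continuous_onI continuous_on_of_real smooth_continuous_on test_functionD(1)[OF K])
        show "complex_of_real (K x) = 0" if "x \<notin> slab \<tau> d M A B" for x
          using test_functionD(2)[OF K that] by simp
      qed (simp add: C)
      have "(\<integral>z. of_real (K (?L (?P z))) * S (fst z) \<partial>(lborel \<Otimes>\<^sub>M lborel)) = (\<integral>w. \<integral>b. of_real (K (?L (?P (w, b)))) * S w \<partial>lborel \<partial>lborel)"
        using lborel_pair.integral_fst'[OF i1] by simp
      also have "\<dots> = (\<integral>w. ?r n *\<^sub>R (\<integral>b. of_real (K (?P (w, b))) * S w \<partial>lborel) \<partial>lborel)"
      proof (rule Bochner_Integration.integral_cong[OF refl])
        fix w
        have "(\<integral>b. of_real (K (?P (w, b))) * S w \<partial>lborel) = \<bar>?q\<bar> *\<^sub>R (\<integral>b. of_real (K (?P (w, 0 + ?q * b))) * S w \<partial>lborel)"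
          by (rule lborel_integral_real_affine) simp
        then show "(\<integral>b. of_real (K (?L (?P (w, b)))) * S w \<partial>lborel) = ?r n *\<^sub>R (\<integral>b. of_real (K (?P (w, b))) * S w \<partial>lborel)"
          by (simp add: squeeze_param[OF det])
      qed
      also have "\<dots> = ?r n *\<^sub>R (\<integral>z. of_real (K (?P z)) * S (fst z) \<partial>(lborel \<Otimes>\<^sub>M lborel))"
        using lborel_pair.integral_fst'[OF i2] by simp
      finally show ?thesis unfolding lborel_prod .
    qed
    \<comment> \<open>Both error terms carry the depth \<open>B * ?r n\<close>, the same small
      factor as the face integral. It cancels, and what remains are integrals over thinning
      slabs.\<close>
    have "?r n * (?J * cmod ?I) = cmod (?J *\<^sub>R (?r n *\<^sub>R ?I))" by (simp add: norm_mult)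
    also have "\<dots> \<le> cmod ((\<integral>x. of_real (K (?L x)) * f x \<partial>?N) - ?J *\<^sub>R (?r n *\<^sub>R ?I)) + cmod (\<integral>x. of_real (K' (?L x)) * u x \<partial>?N)"
    proof -
      have "cmod b \<le> cmod (a - b) + cmod a" for a b
        using norm_triangle_sub[of b a] by (simp add: norm_minus_commute add.commute)
      then show ?thesis unfolding w norm_minus_cancel by blast
    qed
    also have "\<dots> \<le> C * (B * ?r n) * (\<integral>x. indicator (?s n) x * cmod (g x) \<partial>?N) + C' * (B * ?r n) * (\<integral>x. indicator (?s n) x * cmod (g' x) \<partial>?N)"
      using e1 e2 unfolding scale by simp
    also have "\<dots> = ?r n * (C * B * (\<integral>x. indicator (?s n) x * cmod (g x) \<partial>?N) + C' * B * (\<integral>x. indicator (?s n) x * cmod (g' x) \<partial>?N))"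
      by (simp add: algebra_simps)
    finally show ?thesis by (rule mult_left_le_imp_le) simp
  qed
  have gi: "integrable ?N (\<lambda>x. cmod (g x))" "integrable ?N (\<lambda>x. cmod (g' x))"
    using L2_integrable[OF fin g(1)] L2_integrable[OF fin g'(1)] by auto
  have "(\<lambda>n. C * B * (\<integral>x. indicator (?s n) x * cmod (g x) \<partial>?N) + C' * B * (\<integral>x. indicator (?s n) x * cmod (g' x) \<partial>?N)) \<longlonglongrightarrow> C * B * 0 + C' * B * 0"
    by (intro tendsto_add tendsto_mult_left slab_integral_shrink[where Amax = A] gi AB) auto
  then have "?J * cmod ?I \<le> C * B * 0 + C' * B * 0"
    by (rule LIMSEQ_le_const) (use est in auto)
  then have "?J * cmod ?I \<le> 0" by simp
  then show ?thesis using det by (simp add: mult_le_0_iff)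
qed

text \<open>Of the two factors n + 1, one is paid by the depth of the slab and the other by
  \<open>slab_integral_small\<close>.\<close>

lemma trace_estimate_blowup:
  assumes D: "open D" "bounded D" and det: "det2 \<tau> d \<noteq> 0" and f: "trace_estimate D \<tau> d h M f T"
    and sub: "slab \<tau> d M A B \<subseteq> D" and AB: "0 < A" "A \<le> h" "0 < B" and M: "0 < M"
    and K: "\<And>n. K n \<in> borel_measurable borel" "\<And>n x. cmod (K n x) \<le> C"
      "\<And>n x. x \<notin> slab \<tau> d M (A * inverse (real (Suc n))) (B * inverse (real (Suc n))) \<Longrightarrow> K n x = 0"
  shows "(\<lambda>n. (real (Suc n))\<^sup>2 * cmod ((\<integral>x. K n x * f x \<partial>lebesgue_on D)
    - \<bar>det2 \<tau> d\<bar> *\<^sub>R (\<integral>z. K n (param \<tau> d z) * T (fst z) \<partial>lborel))) \<longlonglongrightarrow> 0"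
proof -
  let ?r = "\<lambda>n. inverse (real (Suc n))" and ?N = "lebesgue_on D"
  obtain g where g: "g \<in> L2 ?N" "\<And>K A B C. K \<in> borel_measurable borel \<Longrightarrow> (\<And>x. cmod (K x) \<le> C) \<Longrightarrow> (\<And>x. x \<notin> slab \<tau> d M A B \<Longrightarrow> K x = 0)
      \<Longrightarrow> slab \<tau> d M A B \<subseteq> D \<Longrightarrow> 0 < A \<Longrightarrow> A \<le> h \<Longrightarrow> 0 < B \<Longrightarrow>
        cmod ((\<integral>x. K x * f x \<partial>?N) - \<bar>det2 \<tau> d\<bar> *\<^sub>R (\<integral>z. K (param \<tau> d z) * T (fst z) \<partial>lborel))
          \<le> C * B * (\<integral>x. indicator (slab \<tau> d M A B) x * cmod (g x) \<partial>?N)"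
    by (rule trace_estimateE[OF f]) blast
  let ?I = "\<lambda>n. \<integral>x. indicator (slab \<tau> d M (A * ?r n) (B * ?r n)) x * cmod (g x) \<partial>?N"
  have "(\<lambda>n. C * B * (real (Suc n) * ?I n)) \<longlonglongrightarrow> C * B * 0"
    by (intro tendsto_mult_left slab_integral_small D det g AB M)
  then have lim: "(\<lambda>n. C * B * (real (Suc n) * ?I n)) \<longlonglongrightarrow> 0" by simp
  have "(real (Suc n))\<^sup>2 * cmod ((\<integral>x. K n x * f x \<partial>?N) - \<bar>det2 \<tau> d\<bar> *\<^sub>R (\<integral>z. K n (param \<tau> d z) * T (fst z) \<partial>lborel))
      \<le> C * B * (real (Suc n) * ?I n)" for n
  proof -
    have le: "A * ?r n \<le> A" "B * ?r n \<le> B"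
      using AB by (simp_all add: scale_Suc_le del: of_nat_Suc)
    moreover have "A * ?r n \<le> h" "0 < A * ?r n" "0 < B * ?r n" using order_trans[OF le(1) AB(2)] AB by simp_all
    ultimately have "(real (Suc n))\<^sup>2 * cmod ((\<integral>x. K n x * f x \<partial>?N) - \<bar>det2 \<tau> d\<bar> *\<^sub>R (\<integral>z. K n (param \<tau> d z) * T (fst z) \<partial>lborel))
        \<le> (real (Suc n))\<^sup>2 * (C * (B * ?r n) * ?I n)"
      by (intro mult_left_mono g(2) K order_trans[OF slab_mono[OF le] sub]) auto
    also have "\<dots> = C * B * (real (Suc n) * ?I n)"
    proof -
      have "q\<^sup>2 * (C * (B * inverse q) * i) = C * B * (q * i)" if "0 < q" for q i
        using that by (simp add: power2_eq_square)
      then show ?thesis by simp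
    qed
    finally show ?thesis .
  qed
  then show ?thesis
    by (intro tendsto_sandwich[OF _ always_eventually[OF allI] tendsto_const lim]) auto
qed

text \<open>With \<xi> = p \<tau> + q \<nu>, the tangential part is negligible. The normal part is
  carried to the face, rewritten there by the boundary condition, and carried back into the volume
  as \<eta> v. The way back matters: v is close to a known value near the edge inside the region,
  whereas its trace is only an \<open>L2\<close> function.\<close>

lemma face_blowup:
  fixes Kn :: "nat \<Rightarrow> space \<Rightarrow> real" and p q :: real and c :: complex
  assumes D: "open D" "bounded D" and det: "det2 \<tau> d \<noteq> 0"
    and v: "trace_estimate D \<tau> d h M v tv" and u: "trace_estimate D \<tau> d h M u (\<lambda>_. 0)"
    and f\<nu>: "trace_estimate D \<tau> d h M f\<nu> (\<lambda>w. - (\<eta> w * tv w))" and f\<tau>: "trace_estimate D \<tau> d h M f\<tau> S"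
    and weak\<xi>: "\<And>\<phi>. test_function D \<phi> \<Longrightarrow> (\<integral>x. dir_deriv \<xi> \<phi> x *\<^sub>R u x \<partial>lebesgue_on D) =
        - (\<integral>x. \<phi> x *\<^sub>R (of_real p * f\<tau> x + of_real q * f\<nu> x) \<partial>lebesgue_on D)"
    and weak\<tau>: "\<And>\<phi>. test_function D \<phi> \<Longrightarrow> (\<integral>x. dir_deriv (\<tau>, 0) \<phi> x *\<^sub>R u x \<partial>lebesgue_on D) =
        - (\<integral>x. \<phi> x *\<^sub>R f\<tau> x \<partial>lebesgue_on D)"
    and sub: "slab \<tau> d M A B \<subseteq> D" and AB: "0 < A" "A \<le> h" "0 < B" and M: "0 < M"
    and \<eta>: "\<eta> \<in> borel_measurable borel" "\<And>w. cmod (\<eta> w) \<le> C\<eta>"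
    and Kn: "\<And>n. test_function (slab \<tau> d M (A * inverse (real (Suc n))) (B * inverse (real (Suc n)))) (Kn n)"
      "\<And>n x. 0 \<le> Kn n x" "\<And>n x. Kn n x \<le> 1"
    and E: "\<forall>\<^sub>F n in sequentially. AE x in lebesgue_on D. Kn n x \<noteq> 0 \<longrightarrow> cmod (\<eta> (coord1 \<tau> d x, snd x) * v x - c) \<le> E"
    and \<epsilon>: "0 < \<epsilon>"
  shows "\<forall>\<^sub>F n in sequentially. cmod ((\<integral>x. dir_deriv \<xi> (Kn n) x *\<^sub>R u x \<partial>lebesgue_on D) - of_real (q * (\<integral>x. Kn n x \<partial>lebesgue_on D)) * c)
    \<le> \<bar>q\<bar> * E * (\<integral>x. Kn n x \<partial>lebesgue_on D) + \<epsilon> * (inverse (real (Suc n)))\<^sup>2"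
proof -
  let ?r = "\<lambda>n. inverse (real (Suc n))" and ?N = "lebesgue_on D" and ?J = "\<bar>det2 \<tau> d\<bar>" and ?P = "param \<tau> d"
  let ?S = "\<lambda>n. slab \<tau> d M (A * ?r n) (B * ?r n)"
  have fin: "finite_measure ?N" by (rule finite_measure_lebesgue_on_open[OF D])
  interpret finite_measure ?N by (rule fin)
  have le: "A * ?r n \<le> A" "B * ?r n \<le> B" "0 < A * ?r n" "0 < B * ?r n" "A * ?r n \<le> h" for n
    using AB order_trans[OF scale_Suc_le[of A n], of h] by (simp_all add: scale_Suc_le del: of_nat_Suc)
  have subn: "?S n \<subseteq> D" for n using order_trans[OF slab_mono[OF le(1,2)] sub] .
  \<comment> \<open>The coefficient is extended into the slab as a constant along d, so that it can
    be absorbed into the bounded kernel.\<close>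
  define \<eta>' where "\<eta>' x = \<eta> (coord1 \<tau> d x, snd x)" for x
  have \<eta>'m: "\<eta>' \<in> borel_measurable borel"
    unfolding \<eta>'_def[abs_def]
    by (rule measurable_compose[OF _ \<eta>(1)])
      (intro borel_measurable_continuous_onI continuous_intros continuous_on_coord)
  have C\<eta>: "0 \<le> C\<eta>" using \<eta>(2) norm_ge_zero order_trans by blast
  have Kb: "Kn n \<in> borel_measurable borel" for n
    by (intro borel_measurable_continuous_onI smooth_continuous_on test_functionD(1)[OF Kn(1)])
  have Kz: "Kn n x = 0" if "x \<notin> ?S n" for n x by (rule test_functionD(2)[OF Kn(1) that])
  have K1: "(\<lambda>x. complex_of_real (Kn n x)) \<in> borel_measurable borel" "cmod (complex_of_real (Kn n x)) \<le> 1"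
    "x \<notin> ?S n \<Longrightarrow> complex_of_real (Kn n x) = 0" for n x
    using Kb[of n] Kn(2,3)[of n x] Kz[of x n] by simp_all
  have K2: "(\<lambda>x. \<eta>' x * complex_of_real (Kn n x)) \<in> borel_measurable borel" "cmod (\<eta>' x * complex_of_real (Kn n x)) \<le> C\<eta>"
    "x \<notin> ?S n \<Longrightarrow> \<eta>' x * complex_of_real (Kn n x) = 0" for n x
  proof -
    show "cmod (\<eta>' x * complex_of_real (Kn n x)) \<le> C\<eta>"
      unfolding norm_mult using mult_mono[OF \<eta>(2) K1(2)[where n = n and x = x] C\<eta>] by (simp add: \<eta>'_def)
  qed (use \<eta>'m K1 in auto)
  note blow = trace_estimate_blowup[OF D det _ sub AB M]
  define a\<tau> where "a\<tau> n = (\<integral>x. of_real (Kn n x) * f\<tau> x \<partial>?N)" for n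
  define a\<nu> where "a\<nu> n = (\<integral>x. of_real (Kn n x) * f\<nu> x \<partial>?N)" for n
  define b where "b n = ?J *\<^sub>R (\<integral>z. (\<eta>' (?P z) * of_real (Kn n (?P z))) * tv (fst z) \<partial>lborel)" for n
  define av where "av n = (\<integral>x. (\<eta>' x * of_real (Kn n x)) * v x \<partial>?N)" for n
  have 1: "(\<lambda>n. (real (Suc n))\<^sup>2 * cmod (a\<tau> n)) \<longlonglongrightarrow> 0"
  proof -
    have "(\<integral>z. of_real (Kn n (?P z)) * S (fst z) \<partial>lborel) = 0" for n
      by (rule tangential_trace_zero[OF D det f\<tau> u weak\<tau> subn le(3,5,4) Kn(1)])
    then show ?thesis
      using blow[OF f\<tau>, of "\<lambda>n x. of_real (Kn n x)" 1, OF K1] unfolding a\<tau>_def by simp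
  qed
  \<comment> \<open>The trace of f\<nu> is - \<eta> tv, so the estimate compares a\<nu> with - b;
    together with the next fact, a\<nu> is close to - av.\<close>
  have 2: "(\<lambda>n. (real (Suc n))\<^sup>2 * cmod (a\<nu> n + b n)) \<longlonglongrightarrow> 0"
  proof -
    have "?J *\<^sub>R (\<integral>z. of_real (Kn n (?P z)) * (- (\<eta> (fst z) * tv (fst z))) \<partial>lborel) = - b n" for n
      unfolding b_def by (simp add: \<eta>'_def coord_param[OF det] mult.left_commute mult.commute[of "\<eta> _"] mult.assoc)
    then show ?thesis
      using blow[OF f\<nu>, of "\<lambda>n x. of_real (Kn n x)" 1, OF K1] unfolding a\<nu>_def by simp
  qed
  have 3: "(\<lambda>n. (real (Suc n))\<^sup>2 * cmod (av n - b n)) \<longlonglongrightarrow> 0"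
    using blow[OF v, of "\<lambda>n x. \<eta>' x * of_real (Kn n x)" "C\<eta>", OF K2] unfolding av_def b_def .
  have "(\<lambda>n. \<bar>p\<bar> * ((real (Suc n))\<^sup>2 * cmod (a\<tau> n)) + \<bar>q\<bar> * ((real (Suc n))\<^sup>2 * cmod (a\<nu> n + b n)) + \<bar>q\<bar> * ((real (Suc n))\<^sup>2 * cmod (av n - b n)))
      \<longlonglongrightarrow> \<bar>p\<bar> * 0 + \<bar>q\<bar> * 0 + \<bar>q\<bar> * 0"
    by (intro tendsto_add tendsto_mult_left 1 2 3)
  then have "\<forall>\<^sub>F n in sequentially. \<bar>p\<bar> * ((real (Suc n))\<^sup>2 * cmod (a\<tau> n)) + \<bar>q\<bar> * ((real (Suc n))\<^sup>2 * cmod (a\<nu> n + b n)) + \<bar>q\<bar> * ((real (Suc n))\<^sup>2 * cmod (av n - b n)) < \<epsilon>"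
    using \<epsilon> by (intro order_tendstoD(2)[where y = 0]) auto
  with E show ?thesis
  proof eventually_elim
    case (elim n)
    let ?q = "real (Suc n)"
    have K1N: "(\<lambda>x. complex_of_real (Kn n x)) \<in> borel_measurable ?N" by (rule borel_measurable_lebesgue_on[OF K1(1)])
    note vi = L2_integrable[OF fin trace_estimate_D(1)[OF v]]
    have i\<tau>: "integrable ?N (\<lambda>x. of_real (Kn n x) * f\<tau> x)" "integrable ?N (\<lambda>x. of_real (Kn n x) * f\<nu> x)"
      using integrable_bounded_mult[OF L2_integrable[OF fin trace_estimate_D(1)[OF f\<tau>]] K1N K1(2)]
        integrable_bounded_mult[OF L2_integrable[OF fin trace_estimate_D(1)[OF f\<nu>]] K1N K1(2)] by auto
    have iv: "integrable ?N (\<lambda>x. (\<eta>' x * of_real (Kn n x)) * v x)"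
      by (rule integrable_bounded_mult[OF vi borel_measurable_lebesgue_on[OF K2(1)] K2(2)])
    have iK: "integrable ?N (Kn n)"
      using Kn(2,3) borel_measurable_lebesgue_on[OF Kb] by (intro integrable_const_bound[where B = 1]) auto
    have X: "(\<integral>x. dir_deriv \<xi> (Kn n) x *\<^sub>R u x \<partial>?N) = - (of_real p * a\<tau> n) - of_real q * (a\<nu> n)"
      using weak\<xi>[OF test_function_mono[OF Kn(1) subn]] i\<tau>
      by (simp add: scaleR_conv_of_real distrib_left mult.left_commute[of "of_real (Kn n _)"] a\<tau>_def a\<nu>_def)
    have main: "cmod (av n - of_real (\<integral>x. Kn n x \<partial>?N) * c) \<le> E * (\<integral>x. Kn n x \<partial>?N)"
    proof -
      have "av n - of_real (\<integral>x. Kn n x \<partial>?N) * c = (\<integral>x. (\<eta>' x * of_real (Kn n x)) * v x - of_real (Kn n x) * c \<partial>?N)"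
        using iv iK by (simp add: av_def)
      also have "cmod \<dots> \<le> (\<integral>x. E * Kn n x \<partial>?N)"
      proof (rule order_trans[OF integral_norm_bound integral_mono_AE])
        show "integrable ?N (\<lambda>x. E * Kn n x)" using iK by simp
        show "integrable ?N (\<lambda>x. cmod ((\<eta>' x * of_real (Kn n x)) * v x - of_real (Kn n x) * c))" using iv iK by simp
        show "AE x in ?N. cmod ((\<eta>' x * of_real (Kn n x)) * v x - of_real (Kn n x) * c) \<le> E * Kn n x"
          using elim(1)
        proof eventually_elim
          case (elim x)
          have "(\<eta>' x * of_real (Kn n x)) * v x - of_real (Kn n x) * c = of_real (Kn n x) * (\<eta>' x * v x - c)"
            by (simp add: algebra_simps)
          then have "cmod ((\<eta>' x * of_real (Kn n x)) * v x - of_real (Kn n x) * c) = Kn n x * cmod (\<eta>' x * v x - c)"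
            using Kn(2)[of n x] by (simp only: norm_mult norm_of_real abs_of_nonneg)
          also have "\<dots> \<le> Kn n x * E"
            using elim Kn(2)[of n x] by (cases "Kn n x = 0") (auto intro: mult_left_mono simp: \<eta>'_def)
          finally show ?case by (simp add: mult.commute)
        qed
      qed
      finally show ?thesis by simp
    qed
    have "(\<integral>x. dir_deriv \<xi> (Kn n) x *\<^sub>R u x \<partial>?N) - of_real (q * (\<integral>x. Kn n x \<partial>?N)) * c
       = of_real q * (av n - of_real (\<integral>x. Kn n x \<partial>?N) * c) - (of_real p * a\<tau> n + of_real q * (a\<nu> n + b n) + of_real q * (av n - b n))"
      unfolding X by (simp add: algebra_simps)
    also have "cmod \<dots> \<le> \<bar>q\<bar> * cmod (av n - of_real (\<integral>x. Kn n x \<partial>?N) * c) + (\<bar>p\<bar> * cmod (a\<tau> n) + \<bar>q\<bar> * cmod (a\<nu> n + b n) + \<bar>q\<bar> * cmod (av n - b n))"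
    proof -
      have n: "cmod (of_real q * z) = \<bar>q\<bar> * cmod z" for q z by (simp add: norm_mult)
      show ?thesis unfolding n[symmetric] by (intro norm_triangle_le_diff add_mono order_refl norm_triangle_le)
    qed
    also have "\<dots> \<le> \<bar>q\<bar> * (E * (\<integral>x. Kn n x \<partial>?N)) + \<epsilon> * (?r n)\<^sup>2"
    proof (intro add_mono mult_left_mono main)
      have "(\<bar>p\<bar> * cmod (a\<tau> n) + \<bar>q\<bar> * cmod (a\<nu> n + b n) + \<bar>q\<bar> * cmod (av n - b n)) * ?q\<^sup>2 \<le> \<epsilon>"
        using elim(2) by (simp add: algebra_simps)
      then show "\<bar>p\<bar> * cmod (a\<tau> n) + \<bar>q\<bar> * cmod (a\<nu> n + b n) + \<bar>q\<bar> * cmod (av n - b n) \<le> \<epsilon> * (?r n)\<^sup>2"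
        by (simp only: power_inverse divide_inverse[symmetric]) (simp add: pos_le_divide_eq)
    qed simp
    finally show ?case by (simp add: mult.assoc)
  qed
qed

section \<open>The conductive boundary condition on one face\<close>

lemma trace_estimate_sum:
  assumes D: "open D" "bounded D" and det: "det2 \<tau> d \<noteq> 0"
    and "finite B" "\<And>b. b \<in> B \<Longrightarrow> trace_estimate D \<tau> d h M (f b) (T b)"
  shows "trace_estimate D \<tau> d h M (\<lambda>x. \<Sum>b\<in>B. f b x) (\<lambda>w. \<Sum>b\<in>B. T b w)"
  using assms(4,5)
proof (induction B)
  case empty
  have "(\<lambda>_. 0) \<in> L2 (lebesgue_on D)" by (simp add: L2_def)
  then show ?case by (auto intro!: trace_estimateI)
next
  case (insert b B)
  then show ?case using trace_estimate_add[OF D det] by simp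
qed

lemma test_function_integrable:
  assumes D: "open D" "bounded D" and \<phi>: "test_function E \<phi>" and f: "f \<in> L2 (lebesgue_on D)"
  shows "integrable (lebesgue_on D) (\<lambda>x. \<phi> x *\<^sub>R f x)"
proof -
  obtain C where "\<And>x. \<bar>\<phi> x\<bar> \<le> C" by (rule test_function_bounded[OF \<phi>]) blast
  then show ?thesis
    by (intro integrable_bounded_scaleR L2_integrable[OF finite_measure_lebesgue_on_open[OF D] f]
        borel_measurable_lebesgue_on borel_measurable_continuous_onI smooth_continuous_on test_functionD(1)[OF \<phi>])
qed

text \<open>f \<xi> is the weak derivative of v - w in direction \<xi>, built from the partial
  derivatives that the normal traces provide and therefore linear in \<xi>. The boundary condition
  determines its trace for \<xi> = \<nu>.\<close>

lemma (in cylinder_face) conductive_face_data: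
  assumes D: "open D" "bounded D" and det: "det2 \<tau> d \<noteq> 0" and bc: "conductive_bc D \<sigma> \<nu> \<eta> v w"
    and \<eta>: "\<eta> \<in> borel_measurable \<sigma>"
  obtains f :: "space \<Rightarrow> space \<Rightarrow> complex" and S tv
  where "trace_estimate D \<tau> d h M v tv" "trace_estimate D \<tau> d h M (\<lambda>x. v x - w x) (\<lambda>_. 0)"
    "\<And>\<xi>. trace_estimate D \<tau> d h M (f \<xi>) (S \<xi>)"
    "trace_estimate D \<tau> d h M (f \<nu>) (\<lambda>z. - (trace_pullback \<tau> h M \<eta> z * tv z))"
    "\<And>\<xi> \<phi>. test_function D \<phi> \<Longrightarrow> (\<integral>x. dir_deriv \<xi> \<phi> x *\<^sub>R (v x - w x) \<partial>lebesgue_on D) = - (\<integral>x. \<phi> x *\<^sub>R f \<xi> x \<partial>lebesgue_on D)"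
    "\<And>a b \<xi> \<zeta> x. f (a *\<^sub>R \<xi> + b *\<^sub>R \<zeta>) x = of_real a * f \<xi> x + of_real b * f \<zeta> x"
proof -
  let ?N = "lebesgue_on D" and ?pb = "trace_pullback \<tau> h M"
  obtain tv tw dv dw where tr: "has_trace D \<sigma> v tv" "has_trace D \<sigma> w tw"
      "has_normal_trace D \<sigma> \<nu> v dv" "has_normal_trace D \<sigma> \<nu> w dw"
      and ae: "AE x in \<sigma>. tw x = tv x" "AE x in \<sigma>. dv x + \<eta> x * tv x = dw x"
    using bc unfolding conductive_bc_def by blast
  obtain G T where G: "\<forall>b\<in>Basis. weak_partial D b v (G b) \<and> has_trace D \<sigma> (G b) (T b)"
    and dv: "AE x in \<sigma>. dv x = (\<Sum>b\<in>Basis. (\<nu> \<bullet> b) *\<^sub>R T b x)"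
    using tr(3) unfolding has_normal_trace_def by blast
  obtain G' T' where G': "\<forall>b\<in>Basis. weak_partial D b w (G' b) \<and> has_trace D \<sigma> (G' b) (T' b)"
    and dw: "AE x in \<sigma>. dw x = (\<Sum>b\<in>Basis. (\<nu> \<bullet> b) *\<^sub>R T' b x)"
    using tr(4) unfolding has_normal_trace_def by blast
  have meas: "?pb g \<in> borel_measurable borel" if "has_trace D \<sigma> f g" for f g
    using that by (intro trace_pullback_measurable) (auto simp: has_trace_def L2_def)
  note est = has_trace_estimate[OF D det]
  define H where "H b x = G b x - G' b x" for b x
  define f where "f \<xi> x = (\<Sum>b\<in>Basis. of_real (\<xi> \<bullet> b) * H b x)" for \<xi> x
  define S where "S \<xi> z = (\<Sum>b\<in>Basis. of_real (\<xi> \<bullet> b) * (?pb (T b) z - ?pb (T' b) z))" for \<xi> z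
  have diff: "trace_estimate D \<tau> d h M (\<lambda>x. f1 x - f2 x) (\<lambda>z. T1 z - T2 z)"
    if "trace_estimate D \<tau> d h M f1 T1" "trace_estimate D \<tau> d h M f2 T2" for f1 f2 T1 T2
    using trace_estimate_add[OF D det that(1) trace_estimate_cmult[OF that(2), of "-1"]] by simp
  have fS: "trace_estimate D \<tau> d h M (f \<xi>) (S \<xi>)" for \<xi>
    unfolding f_def[abs_def] S_def[abs_def] H_def
    by (intro trace_estimate_sum D det trace_estimate_cmult diff est) (use G G' in auto)
  have AEW: "AE z in lborel. z \<in> W0 \<longrightarrow> P (face z)" if "AE x in \<sigma>. P x" for P
    using AE_face[OF that] by (subst (asm) AE_restrict_space_iff) (auto simp: AE_completion_iff)
  have tv: "trace_estimate D \<tau> d h M v (?pb tv)" by (rule est[OF tr(1)])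
  have u: "trace_estimate D \<tau> d h M (\<lambda>x. v x - w x) (\<lambda>_. 0)"
  proof (rule trace_estimate_cong_AE[OF diff[OF tv est[OF tr(2)]]])
    show "AE z in lborel. ?pb tv z - ?pb tw z = 0"
      using AEW[OF ae(1)] by eventually_elim (auto simp: trace_pullback_def indicator_def)
  qed simp
  have f\<nu>: "trace_estimate D \<tau> d h M (f \<nu>) (\<lambda>z. - (?pb \<eta> z * ?pb tv z))"
  proof (rule trace_estimate_cong_AE[OF fS])
    show "(\<lambda>z. - (?pb \<eta> z * ?pb tv z)) \<in> borel_measurable borel"
      using trace_pullback_measurable[OF \<eta>] meas[OF tr(1)] by measurable
    show "AE z in lborel. S \<nu> z = - (?pb \<eta> z * ?pb tv z)"
      using AEW[OF ae(2)] AEW[OF dv] AEW[OF dw]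
    proof eventually_elim
      case (elim z)
      show ?case
      proof (cases "z \<in> W0")
        case True
        then have "S \<nu> z = dv (face z) - dw (face z)"
          using elim by (simp add: S_def trace_pullback_def right_diff_distrib sum_subtractf scaleR_conv_of_real)
        also have "\<dots> = - (\<eta> (face z) * tv (face z))"
          using elim(1) True by (metis add_diff_cancel_left' minus_diff_eq)
        finally show ?thesis using True by (simp add: trace_pullback_def)
      next
        case False
        then show ?thesis by (simp add: S_def trace_pullback_def)
      qed
    qed
  qed
  have weak: "(\<integral>x. dir_deriv \<xi> \<phi> x *\<^sub>R (v x - w x) \<partial>?N) = - (\<integral>x. \<phi> x *\<^sub>R f \<xi> x \<partial>?N)"
    if \<phi>: "test_function D \<phi>" for \<xi> \<phi>
  proof -
    have L: "v \<in> L2 ?N" "w \<in> L2 ?N" "\<And>b. b \<in> Basis \<Longrightarrow> G b \<in> L2 ?N" "\<And>b. b \<in> Basis \<Longrightarrow> G' b \<in> L2 ?N"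
      using G[THEN bspec, OF e_in_Basis(1)] G'[THEN bspec, OF e_in_Basis(1)] G G' by (auto simp: weak_partial_def)
    have i: "integrable ?N (\<lambda>x. dir_deriv b \<phi> x *\<^sub>R v x)" "integrable ?N (\<lambda>x. dir_deriv b \<phi> x *\<^sub>R w x)" for b
      by (intro test_function_integrable[OF D test_function_dir_deriv[OF \<phi>]] L)+
    have iG: "integrable ?N (\<lambda>x. \<phi> x *\<^sub>R G b x)" "integrable ?N (\<lambda>x. \<phi> x *\<^sub>R G' b x)" if "b \<in> Basis" for b
      by (intro test_function_integrable[OF D \<phi>] L that)+
    have iH: "integrable ?N (\<lambda>x. \<phi> x *\<^sub>R H b x)" if "b \<in> Basis" for b
      using iG[OF that] by (simp add: H_def scaleR_diff_right)
    have b: "(\<integral>x. dir_deriv b \<phi> x *\<^sub>R (v x - w x) \<partial>?N) = - (\<integral>x. \<phi> x *\<^sub>R H b x \<partial>?N)" if "b \<in> Basis" for b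
    proof -
      have "(\<integral>x. dir_deriv b \<phi> x *\<^sub>R (v x - w x) \<partial>?N) = (\<integral>x. dir_deriv b \<phi> x *\<^sub>R v x \<partial>?N) - (\<integral>x. dir_deriv b \<phi> x *\<^sub>R w x \<partial>?N)"
        using i by (simp add: scaleR_diff_right)
      also have "\<dots> = - (\<integral>x. \<phi> x *\<^sub>R G b x \<partial>?N) + (\<integral>x. \<phi> x *\<^sub>R G' b x \<partial>?N)"
        using G G' \<phi> that unfolding weak_partial_def by simp
      also have "\<dots> = - (\<integral>x. \<phi> x *\<^sub>R H b x \<partial>?N)"
        using iG[OF that] by (simp add: H_def scaleR_diff_right)
      finally show ?thesis .
    qed
    have "dir_deriv \<xi> \<phi> x *\<^sub>R (v x - w x) = (\<Sum>b\<in>Basis. (\<xi> \<bullet> b) *\<^sub>R (dir_deriv b \<phi> x *\<^sub>R (v x - w x)))" for x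
      using dir_deriv_sum_Basis[OF smooth_differentiable[OF test_functionD(1)[OF \<phi>]], of \<xi> x]
      by (simp add: scaleR_sum_left)
    then have "(\<integral>x. dir_deriv \<xi> \<phi> x *\<^sub>R (v x - w x) \<partial>?N) = (\<integral>x. (\<Sum>b\<in>Basis. (\<xi> \<bullet> b) *\<^sub>R (dir_deriv b \<phi> x *\<^sub>R (v x - w x))) \<partial>?N)"
      by simp
    also have "\<dots> = (\<Sum>b\<in>Basis. (\<xi> \<bullet> b) *\<^sub>R (\<integral>x. dir_deriv b \<phi> x *\<^sub>R (v x - w x) \<partial>?N))"
    proof (subst Bochner_Integration.integral_sum)
      show "integrable ?N (\<lambda>x. (\<xi> \<bullet> b) *\<^sub>R (dir_deriv b \<phi> x *\<^sub>R (v x - w x)))" for b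
        unfolding scaleR_diff_right by (intro integrable_scaleR_right Bochner_Integration.integrable_diff i)
    qed (simp only: integral_scaleR_right)
    also have "\<dots> = - (\<Sum>b\<in>Basis. (\<xi> \<bullet> b) *\<^sub>R (\<integral>x. \<phi> x *\<^sub>R H b x \<partial>?N))"
      by (simp add: b sum_negf)
    also have "(\<Sum>b\<in>Basis. (\<xi> \<bullet> b) *\<^sub>R (\<integral>x. \<phi> x *\<^sub>R H b x \<partial>?N)) = (\<integral>x. (\<Sum>b\<in>Basis. (\<xi> \<bullet> b) *\<^sub>R (\<phi> x *\<^sub>R H b x)) \<partial>?N)"
    proof (subst Bochner_Integration.integral_sum)
      show "integrable ?N (\<lambda>x. (\<xi> \<bullet> b) *\<^sub>R (\<phi> x *\<^sub>R H b x))" if "b \<in> Basis" for b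
        by (intro integrable_scaleR_right iH that)
    qed (simp only: integral_scaleR_right)
    also have "\<dots> = (\<integral>x. \<phi> x *\<^sub>R f \<xi> x \<partial>?N)"
      by (intro Bochner_Integration.integral_cong) (simp_all add: f_def scaleR_conv_of_real sum_distrib_left mult_ac)
    finally show ?thesis .
  qed
  have lin: "f (a *\<^sub>R \<xi> + b *\<^sub>R \<zeta>) x = of_real a * f \<xi> x + of_real b * f \<zeta> x" for a b \<xi> \<zeta> x
    unfolding f_def sum_distrib_left sum.distrib[symmetric]
    by (intro sum.cong refl) (simp add: inner_add_left algebra_simps)
  show ?thesis by (rule that[OF tv u fS f\<nu> weak lin])
qed

section \<open>Kernels for the blow-up\<close>

lemma bump_exists:
  fixes c s :: real
  assumes "0 < s"
  shows "\<exists>k. smooth k \<and> (\<forall>x. 0 \<le> k x) \<and> (\<forall>x. k x \<le> (1::real)) \<and> (\<forall>x. k x \<noteq> 0 \<longrightarrow> \<bar>x - c\<bar> \<le> s)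
    \<and> integrable lborel k \<and> 0 < integral\<^sup>L lborel k"
proof -
  have "c - s < c - s / 2" using assms by simp
  from smooth_step_exists[OF this] obtain H where H: "smooth H" "\<And>x. x \<le> c - s \<Longrightarrow> H x = 0"
    "\<And>x. x \<ge> c - s / 2 \<Longrightarrow> H x = (1::real)" "\<And>x. c - s < x \<Longrightarrow> x < c - s / 2 \<Longrightarrow> 0 < H x \<and> H x < 1"
    by metis
  have H01: "0 \<le> H x" "H x \<le> 1" for x
    using H(2)[of x] H(3)[of x] H(4)[of x] by (cases "x \<le> c - s"; cases "x \<ge> c - s / 2"; force)+
  \<comment> \<open>A step times its reflection H (2 c - x), written for
    \<open>smooth_real_affine\<close>. It equals 1 on the middle interval of length s, which bounds
    its integral from below.\<close>
  define k where "k x = H x * (1 * H ((x - 2 * c) / (- 1)))" for x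
  have k: "smooth k"
    unfolding k_def[abs_def] by (intro smooth_mult[OF H(1)] smooth_real_affine(1)[OF H(1)])
  have k01: "0 \<le> k x" "k x \<le> 1" for x
    using H01 unfolding k_def by (auto intro: mult_le_one)
  have supp: "\<bar>x - c\<bar> \<le> s" if "k x \<noteq> 0" for x
  proof -
    have "H x \<noteq> 0" "H (2 * c - x) \<noteq> 0" using that by (auto simp: k_def)
    then have "\<not> x \<le> c - s" "\<not> 2 * c - x \<le> c - s" using H(2) by blast+
    then show ?thesis by linarith
  qed
  have int: "integrable lborel k"
  proof -
    have "integrable lborel (\<lambda>x. indicator {c - s..c + s} x *\<^sub>R k x)"
      by (intro borel_integrable_compact smooth_continuous_on k) auto
    moreover have "indicator {c - s..c + s} x *\<^sub>R k x = k x" for x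
      using supp[of x] by (auto simp: indicator_def abs_le_iff)
    then have "(\<lambda>x. indicator {c - s..c + s} x *\<^sub>R k x) = k" by blast
    ultimately show ?thesis by metis
  qed
  have "s = (\<integral>x. indicator {c - s / 2..c + s / 2} x \<partial>lborel)" using assms by simp
  also have "\<dots> \<le> integral\<^sup>L lborel k"
  proof (rule integral_mono[OF _ int])
    show "indicator {c - s / 2..c + s / 2} x \<le> k x" for x
      using k01(1)[of x] H(3)[of x] H(3)[of "2 * c - x"] by (auto simp: indicator_def k_def)
  qed (intro integrable_real_indicator, use assms in simp_all)
  finally have "0 < integral\<^sup>L lborel k" using assms by simp
  then show ?thesis using k k01 supp int by blast
qed

text \<open>Only the two transversal factors are rescaled, hence the power \<open>r^2\<close> that
  all errors are measured against.\<close>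

lemma integral_rescaled_tensor:
  assumes "integrable lborel k1" "integrable lborel k2" "integrable lborel k3" "0 < r"
  shows "integral\<^sup>L lborel (tensor (rescale 1 r 0 k1) (rescale 1 r 0 k2) k3) =
    r\<^sup>2 * (integral\<^sup>L lborel k1 * integral\<^sup>L lborel k2 * integral\<^sup>L lborel k3)"
proof -
  have "integrable lborel (rescale 1 r 0 k)" "integral\<^sup>L lborel (rescale 1 r 0 k) = r * integral\<^sup>L lborel k"
    if "integrable lborel k" for k
    using lborel_integrable_real_affine[OF that, of "1 / r" 0] lborel_integral_real_affine[of "1 / r" k 0] assms(4)
    by (simp_all add: rescale_def[abs_def] field_simps)
  then show ?thesis
    using assms by (subst integral_tensor) (auto simp: power2_eq_square)
qed

section \<open>The sector\<close>

lemma inner_face_param: "face_param a \<bullet> face_param b = cos (a - b)"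
  by (simp add: face_param_def inner_vec_def sum_2 cos_diff)

lemma det2_face_param: "det2 (face_param a) (face_param b) = sin (b - a)"
  by (simp add: face_param_def det2_def sin_diff)

lemma polar_form: "y = norm y *\<^sub>R face_param (polar_angle y)"
proof (cases "y = 0")
  case False
  let ?z = "Complex (y $ 1) (y $ 2)"
  have "?z \<noteq> 0" using False by (auto simp: complex_eq_iff vec_eq_iff forall_2)
  have n: "cmod ?z = norm y"
    unfolding cmod_def norm_vec_def L2_set_def by (simp add: sum_2)
  have "?z = of_real (cmod ?z) * exp (\<i> * of_real (Arg ?z))"
    using \<open>?z \<noteq> 0\<close> by (rule Arg_eq)
  then have "Complex (y $ 1) (y $ 2) = Complex (norm y * cos (polar_angle y)) (norm y * sin (polar_angle y))"
    unfolding n polar_angle_def by (simp add: exp_eq_polar complex_eq_iff)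
  then show ?thesis by (simp add: vec_eq_iff forall_2 face_param_def)
qed simp

text \<open>The sector as a circular cone about its bisector, with c < 0 for reflex openings. This
  form avoids angles and the branch cut of \<open>Arg\<close> from here on.\<close>

lemma sector_eq:
  assumes "-pi < \<theta>m" "\<theta>m < \<theta>M" "\<theta>M < pi"
  defines "e \<equiv> face_param ((\<theta>m + \<theta>M) / 2)" and "c \<equiv> cos ((\<theta>M - \<theta>m) / 2)"
  shows "sector \<theta>m \<theta>M = {y. y \<bullet> e > c * norm y}"
proof -
  let ?t = "(\<theta>m + \<theta>M) / 2" and ?b = "(\<theta>M - \<theta>m) / 2"
  have iff: "\<theta>m < \<phi> \<and> \<phi> < \<theta>M \<longleftrightarrow> cos (\<phi> - ?t) > c" if "- pi < \<phi>" "\<phi> \<le> pi" for \<phi>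
  proof -
    have b: "0 < ?b" "?b < pi" using assms by auto
    have eq: "\<theta>m < \<phi> \<and> \<phi> < \<theta>M \<longleftrightarrow> \<bar>\<phi> - ?t\<bar> < ?b" by (auto simp: abs_less_iff field_simps)
    have ca: "cos (\<phi> - ?t) = cos \<bar>\<phi> - ?t\<bar>" by (simp add: abs_if cos_minus[of "\<phi> - ?t", symmetric] del: cos_minus)
    show ?thesis
    proof (cases "\<bar>\<phi> - ?t\<bar> \<le> pi")
      case True
      then show ?thesis unfolding eq ca c_def using b by (subst cos_mono_less_eq) auto
    next
      case False
      \<comment> \<open>Beyond \<pi> the true angular distance to the bisector is 2 \<pi> minus the
        difference. It is still at least half the opening, because both rays stay off the branch
        cut.\<close>
      have "cos \<bar>\<phi> - ?t\<bar> = cos (2 * pi - \<bar>\<phi> - ?t\<bar>)" by (simp add: cos_diff)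
      also have "\<dots> \<le> cos ?b"
        using b False that assms by (intro cos_monotone_0_pi_le) (auto simp: abs_if field_simps split: if_splits)
      finally show ?thesis unfolding eq ca c_def using b False by auto
    qed
  qed
  have "y \<in> sector \<theta>m \<theta>M \<longleftrightarrow> y \<bullet> e > c * norm y" for y
  proof (cases "y = 0")
    case False
    have "y \<bullet> e = norm y * cos (polar_angle y - ?t)"
      unfolding e_def by (subst polar_form[of y]) (simp add: inner_face_param)
    moreover have "- pi < polar_angle y" "polar_angle y \<le> pi"
      unfolding polar_angle_def by (rule mpi_less_Arg Arg_le_pi)+
    ultimately show ?thesis
      using False iff[of "polar_angle y"] by (simp add: sector_def mult.commute)
  qed (simp add: sector_def)
  then show ?thesis by blast
qed

text \<open>The cone of directions pointing into the region from any of its boundary points; this works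
  both for convex (\<open>c \<ge> 0\<close>) and for reflex (\<open>c < 0\<close>) sectors.\<close>

lemma sector_add_cone:
  fixes e y q :: "'a::real_inner"
  assumes "y \<bullet> e \<ge> c * norm y" "q \<bullet> e > \<bar>c\<bar> * norm q"
  shows "(y + q) \<bullet> e > c * norm (y + q)"
proof (cases "c \<ge> 0")
  case True
  have "c * norm (y + q) \<le> c * (norm y + norm q)" using True by (intro mult_left_mono norm_triangle_ineq)
  then show ?thesis using assms True by (simp add: inner_add_left distrib_left)
next
  case False
  have "norm y - norm q \<le> norm (y + q)" using norm_diff_ineq[of y q] .
  then have "c * norm (y + q) \<le> c * (norm y - norm q)" using False by (intro mult_left_mono_neg) auto
  then show ?thesis using assms False by (simp add: inner_add_left right_diff_distrib)
qed

text \<open>The first claim ties the \<xi>-derivative of v - w to \<eta> v near the edge and will be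
  compared between the faces. The second, from the vanishing trace of v - w, will give its value at
  the edge.\<close>

lemma (in cylinder_face) conductive_face_estimate:
  fixes Kn :: "nat \<Rightarrow> space \<Rightarrow> real" and c :: complex
  assumes D: "open D" "bounded D" and det: "det2 \<tau> d \<noteq> 0" and bc: "conductive_bc D \<sigma> \<nu> \<eta> v w"
    and \<eta>: "\<eta> \<in> borel_measurable \<sigma>" "\<And>z. cmod (trace_pullback \<tau> h M \<eta> z) \<le> C\<eta>"
    and sub: "slab \<tau> d M A B \<subseteq> D" and AB: "0 < A" "A \<le> h" "0 < B"
    and Kn: "\<And>n. test_function (slab \<tau> d M (A * inverse (real (Suc n))) (B * inverse (real (Suc n)))) (Kn n)"
      "\<And>n x. 0 \<le> Kn n x" "\<And>n x. Kn n x \<le> 1"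
    and \<xi>: "\<xi> = (\<xi> \<bullet> (\<tau>, 0)) *\<^sub>R (\<tau>, 0) + (\<xi> \<bullet> \<nu>) *\<^sub>R \<nu>"
    and E: "\<forall>\<^sub>F n in sequentially. AE x in lebesgue_on D. Kn n x \<noteq> 0 \<longrightarrow>
      cmod (trace_pullback \<tau> h M \<eta> (coord1 \<tau> d x, snd x) * v x - c) \<le> E"
    and \<epsilon>: "0 < \<epsilon>"
  shows "\<forall>\<^sub>F n in sequentially. cmod ((\<integral>x. dir_deriv \<xi> (Kn n) x *\<^sub>R (v x - w x) \<partial>lebesgue_on D) - of_real ((\<xi> \<bullet> \<nu>) * (\<integral>x. Kn n x \<partial>lebesgue_on D)) * c)
      \<le> \<bar>\<xi> \<bullet> \<nu>\<bar> * E * (\<integral>x. Kn n x \<partial>lebesgue_on D) + \<epsilon> * (inverse (real (Suc n)))\<^sup>2"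
    and "(\<lambda>n. (real (Suc n))\<^sup>2 * cmod (\<integral>x. of_real (Kn n x) * (v x - w x) \<partial>lebesgue_on D)) \<longlonglongrightarrow> 0"
proof -
  obtain f S tv where fd: "trace_estimate D \<tau> d h M v tv" "trace_estimate D \<tau> d h M (\<lambda>x. v x - w x) (\<lambda>_. 0)"
    "\<And>\<xi>. trace_estimate D \<tau> d h M (f \<xi>) (S \<xi>)"
    "trace_estimate D \<tau> d h M (f \<nu>) (\<lambda>z. - (trace_pullback \<tau> h M \<eta> z * tv z))"
    "\<And>\<xi> \<phi>. test_function D \<phi> \<Longrightarrow> (\<integral>x. dir_deriv \<xi> \<phi> x *\<^sub>R (v x - w x) \<partial>lebesgue_on D) = - (\<integral>x. \<phi> x *\<^sub>R f \<xi> x \<partial>lebesgue_on D)"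
    "\<And>a b \<xi> \<zeta> x. f (a *\<^sub>R \<xi> + b *\<^sub>R \<zeta>) x = of_real a * f \<xi> x + of_real b * f \<zeta> x"
    by (rule conductive_face_data[OF D det bc \<eta>(1)]) blast
  have f\<xi>: "f \<xi> x = of_real (\<xi> \<bullet> (\<tau>, 0)) * f (\<tau>, 0) x + of_real (\<xi> \<bullet> \<nu>) * f \<nu> x" for x
    by (subst \<xi>) (rule fd(6))
  show "\<forall>\<^sub>F n in sequentially. cmod ((\<integral>x. dir_deriv \<xi> (Kn n) x *\<^sub>R (v x - w x) \<partial>lebesgue_on D) - of_real ((\<xi> \<bullet> \<nu>) * (\<integral>x. Kn n x \<partial>lebesgue_on D)) * c)
      \<le> \<bar>\<xi> \<bullet> \<nu>\<bar> * E * (\<integral>x. Kn n x \<partial>lebesgue_on D) + \<epsilon> * (inverse (real (Suc n)))\<^sup>2"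
  proof (rule face_blowup[OF D det fd(1,2,4,3) _ fd(5) sub AB M
          trace_pullback_measurable[OF \<eta>(1)] \<eta>(2) Kn E \<epsilon>])
    show "(\<integral>x. dir_deriv \<xi> \<phi> x *\<^sub>R (v x - w x) \<partial>lebesgue_on D) =
        - (\<integral>x. \<phi> x *\<^sub>R (of_real (\<xi> \<bullet> (\<tau>, 0)) * f (\<tau>, 0) x + of_real (\<xi> \<bullet> \<nu>) * f \<nu> x) \<partial>lebesgue_on D)"
      if "test_function D \<phi>" for \<phi>
      using fd(5)[OF that, of \<xi>] by (simp only: f\<xi>)
  qed
  have "(\<lambda>x. complex_of_real (Kn n x)) \<in> borel_measurable borel" for n
    by (intro borel_measurable_continuous_onI continuous_on_of_real smooth_continuous_on test_functionD(1)[OF Kn(1)])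
  moreover have "cmod (complex_of_real (Kn n x)) \<le> 1" for n x using Kn(2,3)[of n x] by simp
  moreover have "complex_of_real (Kn n x) = 0" if "x \<notin> slab \<tau> d M (A * inverse (real (Suc n))) (B * inverse (real (Suc n)))" for n x
    using test_functionD(2)[OF Kn(1) that] by simp
  ultimately show "(\<lambda>n. (real (Suc n))\<^sup>2 * cmod (\<integral>x. of_real (Kn n x) * (v x - w x) \<partial>lebesgue_on D)) \<longlonglongrightarrow> 0"
    using trace_estimate_blowup[OF D det fd(2) sub AB M, of "\<lambda>n x. of_real (Kn n x)" 1] by simp
qed

text \<open>Expansion in an orthonormal basis of the plane; s = 1 yields the normal of the upper
  face and s = -1 that of the lower one.\<close>

lemma normal_decomposition:
  fixes a b :: real
  assumes "a\<^sup>2 + b\<^sup>2 = 1" "s\<^sup>2 = 1"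
  defines "\<tau> \<equiv> (vector [a, b] :: real^2, 0 :: real)" and "\<nu> \<equiv> (vector [- s * b, s * a] :: real^2, 0 :: real)"
  shows "(y, 0) = ((y, 0) \<bullet> \<tau>) *\<^sub>R \<tau> + ((y, 0) \<bullet> \<nu>) *\<^sub>R \<nu>"
proof -
  have "y $ 1 = (y $ 1 * a + y $ 2 * b) * a + s\<^sup>2 * (y $ 1 * b - y $ 2 * a) * b"
  proof -
    have "(y $ 1 * a + y $ 2 * b) * a + 1 * (y $ 1 * b - y $ 2 * a) * b = y $ 1 * (a\<^sup>2 + b\<^sup>2)"
      by (simp add: algebra_simps power2_eq_square)
    then show ?thesis using assms(1,2) by simp
  qed
  moreover have "y $ 2 = (y $ 1 * a + y $ 2 * b) * b + s\<^sup>2 * (y $ 2 * a - y $ 1 * b) * a"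
  proof -
    have "(y $ 1 * a + y $ 2 * b) * b + 1 * (y $ 2 * a - y $ 1 * b) * a = y $ 2 * (a\<^sup>2 + b\<^sup>2)"
      by (simp add: algebra_simps power2_eq_square)
    then show ?thesis using assms(1,2) by simp
  qed
  ultimately show ?thesis
    by (simp add: \<tau>_def \<nu>_def prod_eq_iff vec_eq_iff forall_2 inner_vec_def sum_2 algebra_simps power2_eq_square)
qed

lemma open_sector_section: "open {y::real^2. y \<bullet> e > c * norm y}"
  by (intro open_Collect_less continuous_intros)

lemma norm_vec2_le: "norm (y :: real^2) \<le> \<bar>y $ 1\<bar> + \<bar>y $ 2\<bar>"
  using norm_le_l1_cart[of y] by (simp add: sum_2)

text \<open>A direction \<open>d\<close> near the bisector \<open>e\<close> such that \<open>e\<close> lies strictly between the ray and \<open>d\<close>.\<close>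

lemma sector_slab:
  fixes e \<tau> :: "real^2"
  assumes \<tau>: "norm \<tau> = 1" "\<tau> \<bullet> e = c" and e: "norm e = 1" and det: "det2 \<tau> e \<noteq> 0"
    and cone: "\<And>q. norm (q - e) < s0 \<Longrightarrow> q \<bullet> e > \<bar>c\<bar> * norm q" and \<kappa>: "0 < \<kappa>" "\<kappa> < s0"
    and c0: "0 < c0" "c0 * (3 + 3 * \<kappa>) \<le> h"
  defines "d \<equiv> e - \<kappa> *\<^sub>R \<tau>" and "A \<equiv> c0 * (\<kappa> + 1)" and "B \<equiv> 2 * c0"
  shows "det2 \<tau> d \<noteq> 0" "0 < A" "A \<le> h" "0 < B"
    and "slab \<tau> d M A B \<subseteq> ({y. y \<bullet> e > c * norm y} \<inter> ball 0 h) \<times> {-M<..<M}"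
    and "\<exists>s>0. \<forall>y r t. 0 < r \<and> \<bar>y $ 1 - r * (c0 * e $ 1)\<bar> \<le> r * s \<and> \<bar>y $ 2 - r * (c0 * e $ 2)\<bar> \<le> r * s \<and> t \<in> {-M<..<M}
        \<longrightarrow> (y, t) \<in> slab \<tau> d M (A * r) (B * r)"
proof -
  \<comment> \<open>Tilting e along \<tau> is a shear, so the determinant does not change.\<close>
  have d_eq: "det2 \<tau> d = det2 \<tau> e"
    using det2_linear(2)[of \<tau> 1 e "- \<kappa>" \<tau>] by (simp add: d_def det2_linear(3))
  then show det': "det2 \<tau> d \<noteq> 0" using det by simp
  have "A = \<kappa> * c0 + c0" "c0 * (3 + 3 * \<kappa>) = 3 * c0 + 3 * (\<kappa> * c0)" by (simp_all add: A_def algebra_simps)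
  then show A: "0 < A" "A \<le> h"
    using c0 mult_pos_pos[OF \<kappa>(1) c0(1)] by linarith+
  show B: "0 < B" using c0 by (simp add: B_def)
  have "norm (d - e) < s0" using \<tau>(1) \<kappa> by (simp add: d_def)
  note dc = cone[OF this]
  have nd: "norm d \<le> 1 + \<kappa>"
    using norm_triangle_ineq4[of e "\<kappa> *\<^sub>R \<tau>"] e \<tau>(1) \<kappa> by (simp add: d_def)
  show "slab \<tau> d M A B \<subseteq> ({y. y \<bullet> e > c * norm y} \<inter> ball 0 h) \<times> {-M<..<M}"
  proof
    fix x assume x: "x \<in> slab \<tau> d M A B"
    define a b where "a = coord1 \<tau> d x" and "b = coord2 \<tau> d x"
    have ab: "0 < a" "a < A" "0 < b" "b < B" and t: "snd x \<in> {-M<..<M}"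
      using x by (auto simp: slab_def a_def b_def)
    have fx: "fst x = a *\<^sub>R \<tau> + b *\<^sub>R d"
      using param_coord[OF det', of x] unfolding param_def a_def b_def by (metis fst_conv snd_conv)
    have "c * norm (fst x) < fst x \<bullet> e"
      unfolding fx
    proof (rule sector_add_cone)
      show "(a *\<^sub>R \<tau>) \<bullet> e \<ge> c * norm (a *\<^sub>R \<tau>)" using \<tau> ab by simp
      show "(b *\<^sub>R d) \<bullet> e > \<bar>c\<bar> * norm (b *\<^sub>R d)"
        using mult_strict_left_mono[OF dc ab(3)] ab by (simp add: mult.left_commute)
    qed
    moreover have "norm (fst x) < h"
    proof -
      have "norm (fst x) \<le> a + b * norm d"
        unfolding fx using norm_triangle_ineq[of "a *\<^sub>R \<tau>" "b *\<^sub>R d"] \<tau> ab by simp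
      also have "\<dots> < A + B * (1 + \<kappa>)"
        using ab nd \<kappa> by (intro add_less_le_mono mult_mono) auto
      \<comment> \<open>A + B (1 + \<kappa>) is exactly c0 (3 + 3 \<kappa>), which explains the
        constant in the assumption on c0.\<close>
      also have "\<dots> \<le> h" using c0 by (simp add: A_def B_def algebra_simps)
      finally show ?thesis .
    qed
    ultimately show "x \<in> ({y. y \<bullet> e > c * norm y} \<inter> ball 0 h) \<times> {-M<..<M}"
      using t by (simp add: mem_Times_iff)
  qed
  let ?O = "{y :: real^2. coord1 \<tau> d (y, 0) \<in> {0<..<A} \<and> coord2 \<tau> d (y, 0) \<in> {0<..<B}}"
  have "?O = (\<lambda>y. coord1 \<tau> d (y, 0)) -` {0<..<A} \<inter> (\<lambda>y. coord2 \<tau> d (y, 0)) -` {0<..<B}" by auto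
  moreover have "open \<dots>"
    by (intro open_Int open_vimage continuous_on_compose2[OF continuous_on_coord(1)[of UNIV]]
        continuous_on_compose2[OF continuous_on_coord(2)[of UNIV]] continuous_intros) auto
  ultimately have oO: "open ?O" by simp
  have "det2 e d = \<kappa> * det2 \<tau> e"
    using det2_linear(2)[of e 1 e "- \<kappa>" \<tau>] by (simp add: d_def det2_linear(3)) (simp add: det2_def algebra_simps)
  \<comment> \<open>The tilt moves c0 e off the boundary of the slab: for d = e its first coordinate
    would be 0. A and B exceed these coordinates by c0.\<close>
  then have "coord1 \<tau> d (c0 *\<^sub>R e, 0) = c0 * \<kappa>" "coord2 \<tau> d (c0 *\<^sub>R e, 0) = c0"
    using det det2_linear(1)[of c0 e 0 e d] det2_linear(2)[of \<tau> c0 e 0 e] by (simp_all add: coord1_def coord2_def d_eq)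
  then have "c0 *\<^sub>R e \<in> ?O" using c0 \<kappa> by (simp add: A_def B_def)
  then obtain \<rho> where \<rho>: "\<rho> > 0" "ball (c0 *\<^sub>R e) \<rho> \<subseteq> ?O" using oO open_contains_ball by blast
  show "\<exists>s>0. \<forall>y r t. 0 < r \<and> \<bar>y $ 1 - r * (c0 * e $ 1)\<bar> \<le> r * s \<and> \<bar>y $ 2 - r * (c0 * e $ 2)\<bar> \<le> r * s \<and> t \<in> {-M<..<M}
        \<longrightarrow> (y, t) \<in> slab \<tau> d M (A * r) (B * r)"
  \<comment> \<open>Each of two coordinates is off by at most \<rho> / 3, so the distance is below
    \<rho>.\<close>
  proof (intro exI[of _ "\<rho> / 3"] conjI allI impI)
    fix y :: "real^2" and r t :: real
    assume H: "0 < r \<and> \<bar>y $ 1 - r * (c0 * e $ 1)\<bar> \<le> r * (\<rho> / 3) \<and> \<bar>y $ 2 - r * (c0 * e $ 2)\<bar> \<le> r * (\<rho> / 3) \<and> t \<in> {-M<..<M}"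
    then have r: "0 < r" by simp
    let ?y = "(1 / r) *\<^sub>R y"
    have "norm (?y - c0 *\<^sub>R e) = norm (y - (r * c0) *\<^sub>R e) / r"
    proof -
      have "?y - c0 *\<^sub>R e = (1 / r) *\<^sub>R (y - (r * c0) *\<^sub>R e)" using r by (simp add: scaleR_diff_right)
      then show ?thesis using r by simp
    qed
    also have "norm (y - (r * c0) *\<^sub>R e) \<le> 2 * (r * (\<rho> / 3))"
      using norm_vec2_le[of "y - (r * c0) *\<^sub>R e"] H by (simp add: mult.assoc)
    also have "2 * (r * (\<rho> / 3)) / r < \<rho>" using r \<rho>(1) by simp
    finally have "norm (?y - c0 *\<^sub>R e) < \<rho>" using r by (simp add: divide_right_mono)
    then have "?y \<in> ball (c0 *\<^sub>R e) \<rho>" by (simp add: dist_norm norm_minus_commute)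
    then have "?y \<in> ?O" using \<rho>(2) by blast
    moreover have "coord1 \<tau> d (?y, 0) = coord1 \<tau> d (y, t) / r" "coord2 \<tau> d (?y, 0) = coord2 \<tau> d (y, t) / r"
      by (simp_all add: coord1_def coord2_def det2_def diff_divide_distrib mult.commute[of r])
    ultimately show "(y, t) \<in> slab \<tau> d M (A * r) (B * r)"
      using H r by (simp add: slab_def pos_divide_less_eq zero_less_divide_iff)
  qed (use \<rho> in simp)
qed

text \<open>Near the edge the coefficient is compared with its value at the edge point of the same
  height, which by independence of the third coordinate is \<eta> (0, 0). The edge lies in the
  closure of the rays although the rays omit it.\<close>

lemma (in cylinder_face) face_coefficient:
  assumes \<alpha>: "0 < \<alpha>" and X: "\<Gamma>h \<theta> h \<subseteq> X"
    and hoelder: "hoelder_on \<alpha> (closure X \<times> {-M..M}) \<eta>"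
    and indep: "\<forall>y \<in> closure X. \<forall>s \<in> {-M..M}. \<forall>t \<in> {-M..M}. \<eta> (y, s) = \<eta> (y, t)"
  obtains C H where "\<And>z. cmod (trace_pullback \<tau> h M \<eta> z) \<le> C"
    "\<And>a t. (a, t) \<in> W0 \<Longrightarrow> cmod (trace_pullback \<tau> h M \<eta> (a, t) - \<eta> (0, 0)) \<le> H * a powr \<alpha>"
proof -
  obtain C where C: "\<And>y t. y \<in> closure X \<Longrightarrow> t \<in> {-M..M} \<Longrightarrow> cmod (\<eta> (y, t)) \<le> C"
  proof -
    obtain C where "\<forall>z\<in>\<eta> ` (closure X \<times> {-M..M}). cmod z \<le> C"
      using hoelder unfolding hoelder_on_def bounded_iff by blast
    then show ?thesis by (intro that[of C]) auto
  qed
  obtain H where H: "\<And>x y. x \<in> closure X \<times> {-M..M} \<Longrightarrow> y \<in> closure X \<times> {-M..M} \<Longrightarrow> cmod (\<eta> x - \<eta> y) \<le> H * dist x y powr \<alpha>"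
    using hoelder unfolding hoelder_on_def by blast
  have in_X: "a *\<^sub>R \<tau> \<in> closure X" if "0 < a" "a < h" for a
    using face_param_in_ray[OF \<theta> that] X closure_subset by blast
  have zero: "0 \<in> closure X"
    unfolding closure_approachable
  proof (intro allI impI)
    fix e :: real assume "0 < e"
    define a where "a = min e h / 2"
    have a: "0 < a" "a < h" "a < e" using \<open>0 < e\<close> h by (auto simp: a_def min_def)
    then show "\<exists>y\<in>X. dist y 0 < e"
      using face_param_in_ray[OF \<theta> a(1,2)] X norm_face_param[of \<theta>] by (intro bexI[of _ "a *\<^sub>R \<tau>"]) auto
  qed
  show ?thesis
  proof (rule that)
    show "cmod (trace_pullback \<tau> h M \<eta> z) \<le> max C 0" for z
      using C[of "fst z *\<^sub>R \<tau>" "snd z"] in_X[of "fst z"]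
      by (cases "z \<in> W0") (auto simp: trace_pullback_def mem_Times_iff le_max_iff_disj)
    fix a t assume at: "(a, t) \<in> W0"
    have "\<eta> (0, 0) = \<eta> (0, t)" using indep zero at M by auto
    then have "cmod (trace_pullback \<tau> h M \<eta> (a, t) - \<eta> (0, 0)) = cmod (\<eta> (a *\<^sub>R \<tau>, t) - \<eta> (0, t))"
      using at by (simp add: trace_pullback_def)
    also have "\<dots> \<le> H * dist (a *\<^sub>R \<tau>, t) (0, t) powr \<alpha>"
      using in_X[of a] zero at by (intro H) auto
    also have "dist (a *\<^sub>R \<tau>, t) (0, t) = a"
      using at norm_face_param[of \<theta>] by (simp add: dist_Pair_Pair)
    finally show "cmod (trace_pullback \<tau> h M \<eta> (a, t) - \<eta> (0, 0)) \<le> H * a powr \<alpha>" .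
  qed
qed

lemma eq_pi_if_cos_eq_minus_one:
  fixes t :: real
  assumes "cos t = -1" "0 < t" "t < 2 * pi"
  shows "t = pi"
proof -
  obtain n :: int where n: "t = (2 * n + 1) * pi"
    using assms(1) by (auto simp: cos_eq_minus1)
  have "0 < (2 * real_of_int n + 1) * pi" "(2 * real_of_int n + 1) * pi < 2 * pi" using assms n by auto
  then have "-1 < 2 * real_of_int n" "2 * real_of_int n < 1"
    by (auto simp: zero_less_mult_iff)
  then have "n = 0" by linarith
  then show ?thesis using n by simp
qed

section \<open>Comparison of the two faces at the edge point\<close>

theorem theorem3p2:
  fixes \<Omega> :: "space set"
    and \<theta>m \<theta>M M \<alpha> h x3c L k :: real
    and q \<eta> v w :: "space \<Rightarrow> complex"
  assumes domain: "open \<Omega>" "connected \<Omega>" "bounded \<Omega>" "0 \<in> frontier \<Omega>"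
    and angles: "-pi < \<theta>m" "\<theta>m < \<theta>M" "\<theta>M < pi"
    and M: "0 < M"
    and \<alpha>: "0 < \<alpha>" "\<alpha> < 1"
    and h: "0 < h" "(ball 0 h \<times> {-M<..<M}) \<inter> \<Omega> = Sh \<theta>m \<theta>M h \<times> {-M<..<M}"
    and x3c: "x3c \<in> {-M<..<M}"
    and L: "0 < L" "{x3c - L<..<x3c + L} \<subseteq> {-M<..<M}"
    and k: "0 < k"
    and q: "q \<in> Linf (lebesgue_on (Sh \<theta>m \<theta>M h \<times> {-M<..<M}))"
    and \<eta>: "\<eta> \<in> Linf (face_measure \<theta>M h M)" "\<eta> \<in> Linf (face_measure \<theta>m h M)"
    and v: "v \<in> sobolev_H 2 \<Omega>"
    and w: "w \<in> sobolev_H 1 \<Omega>"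
    and nontrivial: "\<not> (AE x in lebesgue_on \<Omega>. v x = 0 \<and> w x = 0)"
    and eq_v: "weak_laplacian (Sh \<theta>m \<theta>M h \<times> {-M<..<M}) v (\<lambda>x. - of_real (k\<^sup>2) * v x)"
    and eq_w: "weak_laplacian (Sh \<theta>m \<theta>M h \<times> {-M<..<M}) w (\<lambda>x. - of_real (k\<^sup>2) * q x * w x)"
    and bc_upper: "conductive_bc (Sh \<theta>m \<theta>M h \<times> {-M<..<M}) (face_measure \<theta>M h M)
          (normal_upper \<theta>M) \<eta> v w"
    and bc_lower: "conductive_bc (Sh \<theta>m \<theta>M h \<times> {-M<..<M}) (face_measure \<theta>m h M)
          (normal_lower \<theta>m) \<eta> v w"
    and qw_hoelder: "\<exists>f. hoelder_on \<alpha> (closure (Sh \<theta>m \<theta>M h) \<times> {-M..M}) f \<and>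
          (AE x in lebesgue_on (Sh \<theta>m \<theta>M h \<times> {-M<..<M}). q x * w x = f x)"
    and \<eta>_hoelder: "hoelder_on \<alpha> (closure (\<Gamma>h \<theta>M h \<union> \<Gamma>h \<theta>m h) \<times> {-M..M}) \<eta>"
    and diff_H2: "(\<lambda>x. v x - w x) \<in> sobolev_H 2 (Sh \<theta>m \<theta>M h \<times> {-M<..<M})"
    and \<eta>_indep: "\<forall>y \<in> closure (\<Gamma>h \<theta>M h \<union> \<Gamma>h \<theta>m h). \<forall>s \<in> {-M..M}. \<forall>t \<in> {-M..M}. \<eta> (y, s) = \<eta> (y, t)"
    and \<eta>_edge: "\<eta> (0, 0) \<noteq> 0"
    and angle_ne_pi: "\<theta>M - \<theta>m \<noteq> pi"
  shows "vanishes_at (Sh \<theta>m \<theta>M h \<times> {-M<..<M}) v (0, x3c)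
       \<and> vanishes_at (Sh \<theta>m \<theta>M h \<times> {-M<..<M}) w (0, x3c)"
proof -
  let ?D = "Sh \<theta>m \<theta>M h \<times> {-M<..<M}" and ?p = "(0, x3c) :: space"
  let ?N = "lebesgue_on ?D" and ?r = "\<lambda>n. inverse (real (Suc n))"
  define e where "e = face_param ((\<theta>m + \<theta>M) / 2)"
  define c where "c = cos ((\<theta>M - \<theta>m) / 2)"
  define \<tau>M where "\<tau>M = face_param \<theta>M"
  define \<tau>m where "\<tau>m = face_param \<theta>m"
  have b: "0 < (\<theta>M - \<theta>m) / 2" "(\<theta>M - \<theta>m) / 2 < pi" using angles by auto
  have c1: "\<bar>c\<bar> < 1"
    using cos_monotone_0_pi[of 0 "(\<theta>M - \<theta>m) / 2"] cos_monotone_0_pi[of "(\<theta>M - \<theta>m) / 2" pi] b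
    by (auto simp: c_def abs_less_iff)
  have sin0: "sin ((\<theta>M - \<theta>m) / 2) \<noteq> 0" using sin_gt_zero[OF b] by simp
  have ne: "norm e = 1" "norm \<tau>M = 1" "norm \<tau>m = 1" by (simp_all add: e_def \<tau>M_def \<tau>m_def norm_face_param)
  have half: "\<theta>M - (\<theta>m + \<theta>M) / 2 = (\<theta>M - \<theta>m) / 2" "\<theta>m - (\<theta>m + \<theta>M) / 2 = - ((\<theta>M - \<theta>m) / 2)"
    "(\<theta>m + \<theta>M) / 2 - \<theta>M = - ((\<theta>M - \<theta>m) / 2)" "(\<theta>m + \<theta>M) / 2 - \<theta>m = (\<theta>M - \<theta>m) / 2"
    by (simp_all add: field_simps)
  have inner_\<tau>: "\<tau>M \<bullet> e = c" "\<tau>m \<bullet> e = c"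
    unfolding \<tau>M_def \<tau>m_def e_def inner_face_param half c_def by simp_all
  have det_\<tau>: "det2 \<tau>M e \<noteq> 0" "det2 \<tau>m e \<noteq> 0"
    unfolding \<tau>M_def \<tau>m_def e_def det2_face_param half using sin0 by simp_all
  have Sh_eq: "Sh \<theta>m \<theta>M h = {y. y \<bullet> e > c * norm y} \<inter> ball 0 h"
    unfolding Sh_def sector_eq[OF angles] e_def c_def ..
  have D: "open ?D" "bounded ?D"
    unfolding Sh_eq by (intro open_Times open_Int open_sector_section open_ball open_greaterThanLessThan)
      (intro bounded_Times bounded_subset[OF bounded_ball Int_lower2] bounded_box[where 'a = real, unfolded box_real])
  have Dm: "?D \<in> sets lebesgue" "\<Omega> \<in> sets lebesgue" using D domain(1) by auto
  have subO: "?D \<subseteq> \<Omega>" using h(2) by blast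
  \<comment> \<open>Since \<bar>c\<bar> < 1, the bisector lies in the open cone of directions that
    \<open>sector_add_cone\<close> admits; s0 is the room around it.\<close>
  have "open {q. q \<bullet> e > \<bar>c\<bar> * norm q}" by (rule open_sector_section)
  moreover have "e \<in> {q. q \<bullet> e > \<bar>c\<bar> * norm q}" using c1 ne by (simp add: power2_norm_eq_inner[symmetric])
  ultimately obtain s0 where s0: "0 < s0" "ball e s0 \<subseteq> {q. q \<bullet> e > \<bar>c\<bar> * norm q}"
    using open_contains_ball by blast
  have cone: "q \<bullet> e > \<bar>c\<bar> * norm q" if "norm (q - e) < s0" for q
    using s0(2) that by (auto simp: dist_norm norm_minus_commute)

  have s03: "0 < s0 / 3" using s0(1) by simp
  have cont: "\<exists>U. continuous_on (insert ?p ?D) U \<and> (AE x in ?N. u x = U x)" if u: "u \<in> sobolev_H 2 ?D" for u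
  proof (rule sobolev_H2_continuous[OF D u, of "s0 / 3" _ "(e, 0)"])
    fix x assume x: "x \<in> insert ?p ?D"
    show "\<exists>\<delta>>0. \<exists>r0>0. \<forall>y\<in>insert ?p ?D \<inter> ball x \<delta>. \<forall>r. 0 < r \<and> r \<le> r0 \<longrightarrow> cube (y + r *\<^sub>R (e, 0)) (r * (s0 / 3)) \<subseteq> ?D"
    proof (cases "x \<in> ?D")
      case True
      then obtain \<rho> where \<rho>: "0 < \<rho>" "ball x \<rho> \<subseteq> ?D" using D(1) open_contains_ball by blast
      obtain r0 where r0: "r0 > 0" "\<forall>y\<in>ball x (\<rho> / 2). \<forall>r. 0 < r \<and> r \<le> r0 \<longrightarrow> cube (y + r *\<^sub>R (e, 0)) (r * (s0 / 3)) \<subseteq> ball x \<rho>"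
        using cube_subset_ball[OF \<rho>(1) s03, of x "(e, 0)"] by blast
      have "cube (y + r *\<^sub>R (e, 0)) (r * (s0 / 3)) \<subseteq> ?D" if "y \<in> ball x (\<rho> / 2)" "0 < r" "r \<le> r0" for y r
        by (rule order_trans[OF _ \<rho>(2)]) (use r0(2) that in blast)
      then have "\<forall>y\<in>insert ?p ?D \<inter> ball x (\<rho> / 2). \<forall>r. 0 < r \<and> r \<le> r0 \<longrightarrow> cube (y + r *\<^sub>R (e, 0)) (r * (s0 / 3)) \<subseteq> ?D"
        by blast
      moreover have "0 < \<rho> / 2" using \<rho>(1) by simp
      ultimately show ?thesis using r0(1) by blast
    next
      case False
      then have xp: "x = ?p" using x by simp
      have "open (ball (0::real^2) h \<times> {-M<..<M})" by (intro open_Times) auto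
      moreover have "?p \<in> ball 0 h \<times> {-M<..<M}" using h x3c by simp
      ultimately obtain \<rho> where \<rho>: "0 < \<rho>" "ball ?p \<rho> \<subseteq> ball 0 h \<times> {-M<..<M}" using open_contains_ball by blast
      obtain r0 where r0: "r0 > 0" "\<And>y r. y \<in> ball ?p (\<rho> / 2) \<Longrightarrow> 0 < r \<Longrightarrow> r \<le> r0 \<Longrightarrow> cube (y + r *\<^sub>R (e, 0)) (r * (s0 / 3)) \<subseteq> ball ?p \<rho>"
        using cube_subset_ball[OF \<rho>(1) s03, of ?p "(e, 0)"] by blast
      \<comment> \<open>y may be the edge point itself or a point of the region near it; in both
        cases the weak inequality for \<open>fst y\<close> suffices for
        \<open>sector_add_cone\<close>, while \<rho> takes care of the remaining bounds of the
        cylinder.\<close>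
      have "cube (y + r *\<^sub>R (e, 0)) (r * (s0 / 3)) \<subseteq> ?D" if y: "y \<in> insert ?p ?D" "y \<in> ball ?p (\<rho> / 2)" and r: "0 < r" "r \<le> r0" for y r
      proof
        fix z assume z: "z \<in> cube (y + r *\<^sub>R (e, 0)) (r * (s0 / 3))"
        have zb: "z \<in> ball 0 h \<times> {-M<..<M}" using r0(2)[OF y(2) r] z \<rho>(2) by blast
        define q where "q = (1 / r) *\<^sub>R (fst z - fst y)"
        have fz: "fst z = fst y + r *\<^sub>R q" using r by (simp add: q_def)
        have "norm (q - e) = norm (fst z - fst y - r *\<^sub>R e) / r"
        proof -
          have "q - e = (1 / r) *\<^sub>R (fst z - fst y - r *\<^sub>R e)" using r by (simp add: q_def scaleR_diff_right)
          then show ?thesis using r by simp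
        qed
        also have "norm (fst z - fst y - r *\<^sub>R e) \<le> r * (s0 / 3) + r * (s0 / 3)"
          using norm_vec2_le[of "fst z - fst y - r *\<^sub>R e"] z by (simp add: cube_def diff_diff_eq)
        also have "(r * (s0 / 3) + r * (s0 / 3)) / r < s0" using r s0 by simp
        finally have "norm (q - e) < s0" using r by (simp add: divide_right_mono)
        note qc = cone[OF this]
        have "fst y \<bullet> e \<ge> c * norm (fst y)" using y(1) by (auto simp: Sh_eq)
        moreover have "(r *\<^sub>R q) \<bullet> e > \<bar>c\<bar> * norm (r *\<^sub>R q)"
          using mult_strict_left_mono[OF qc r(1)] r by (simp add: mult.left_commute)
        ultimately have "fst z \<bullet> e > c * norm (fst z)" unfolding fz by (rule sector_add_cone)
        then show "z \<in> ?D" using zb by (auto simp: Sh_eq mem_Times_iff)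
      qed
      then have "\<forall>y\<in>insert ?p ?D \<inter> ball ?p (\<rho> / 2). \<forall>r. 0 < r \<and> r \<le> r0 \<longrightarrow> cube (y + r *\<^sub>R (e, 0)) (r * (s0 / 3)) \<subseteq> ?D"
        by blast
      moreover have "0 < \<rho> / 2" using \<rho>(1) by simp
      ultimately show ?thesis unfolding xp using r0(1) by blast
    qed
  qed (use s0 in simp)
  obtain V where V: "continuous_on (insert ?p ?D) V" "AE x in ?N. v x = V x"
    using cont[OF sobolev_H_subset[OF Dm subO v]] by blast
  obtain U where U: "continuous_on (insert ?p ?D) U" "AE x in ?N. v x - w x = U x"
    using cont[OF diff_H2] by blast

  define \<kappa> where "\<kappa> = s0 / 2"
  define c0 where "c0 = h / (3 + 3 * \<kappa>)"
  have \<kappa>: "0 < \<kappa>" "\<kappa> < s0" using s0 by (auto simp: \<kappa>_def)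
  have c0: "0 < c0" "c0 * (3 + 3 * \<kappa>) \<le> h" using h \<kappa> by (auto simp: c0_def)
  define A where "A = c0 * (\<kappa> + 1)"
  define B where "B = 2 * c0"
  define dM where "dM = e - \<kappa> *\<^sub>R \<tau>M"
  define dm where "dm = e - \<kappa> *\<^sub>R \<tau>m"
  note slM = sector_slab[OF ne(2) inner_\<tau>(1) ne(1) det_\<tau>(1) cone \<kappa> c0, folded A_def B_def dM_def Sh_eq]
  note slm = sector_slab[OF ne(3) inner_\<tau>(2) ne(1) det_\<tau>(2) cone \<kappa> c0, folded A_def B_def dm_def Sh_eq]
  obtain sM where sM: "0 < sM" "\<And>y r t. 0 < r \<Longrightarrow> \<bar>y $ 1 - r * (c0 * e $ 1)\<bar> \<le> r * sM \<Longrightarrow> \<bar>y $ 2 - r * (c0 * e $ 2)\<bar> \<le> r * sM \<Longrightarrow> t \<in> {-M<..<M}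
        \<Longrightarrow> (y, t) \<in> slab \<tau>M dM M (A * r) (B * r)" using slM(6) by blast
  obtain sm where sm: "0 < sm" "\<And>y r t. 0 < r \<Longrightarrow> \<bar>y $ 1 - r * (c0 * e $ 1)\<bar> \<le> r * sm \<Longrightarrow> \<bar>y $ 2 - r * (c0 * e $ 2)\<bar> \<le> r * sm \<Longrightarrow> t \<in> {-M<..<M}
        \<Longrightarrow> (y, t) \<in> slab \<tau>m dm M (A * r) (B * r)" using slm(6) by blast
  define s where "s = min sM sm"
  have s: "0 < s" "s \<le> sM" "s \<le> sm" using sM sm by (auto simp: s_def)

  interpret up: cylinder_face \<theta>M h M by unfold_locales (use angles h M in auto)
  interpret lo: cylinder_face \<theta>m h M by unfold_locales (use angles h M in auto)
  obtain CM HM where CM: "\<And>z. cmod (trace_pullback \<tau>M h M \<eta> z) \<le> CM"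
    "\<And>a t. (a, t) \<in> {0<..<h} \<times> {-M<..<M} \<Longrightarrow> cmod (trace_pullback \<tau>M h M \<eta> (a, t) - \<eta> (0, 0)) \<le> HM * a powr \<alpha>"
    using up.face_coefficient[OF \<alpha>(1) _ \<eta>_hoelder \<eta>_indep] unfolding \<tau>M_def by blast
  obtain Cm Hm where Cm: "\<And>z. cmod (trace_pullback \<tau>m h M \<eta> z) \<le> Cm"
    "\<And>a t. (a, t) \<in> {0<..<h} \<times> {-M<..<M} \<Longrightarrow> cmod (trace_pullback \<tau>m h M \<eta> (a, t) - \<eta> (0, 0)) \<le> Hm * a powr \<alpha>"
    using lo.face_coefficient[OF \<alpha>(1) _ \<eta>_hoelder \<eta>_indep] unfolding \<tau>m_def by blast
  have \<eta>m: "\<eta> \<in> borel_measurable (face_measure \<theta>M h M)" "\<eta> \<in> borel_measurable (face_measure \<theta>m h M)"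
    using \<eta> by (auto simp: Linf_def)

  define \<xi> where "\<xi> = normal_upper \<theta>M - normal_lower \<theta>m"
  have sc: "(cos t)\<^sup>2 + (sin t)\<^sup>2 = 1" for t :: real by simp
  have \<xi>_fst: "\<xi> = (fst \<xi>, 0)" by (simp add: \<xi>_def normal_upper_def normal_lower_def prod_eq_iff)
  have \<xi>M: "\<xi> = (\<xi> \<bullet> (\<tau>M, 0)) *\<^sub>R (\<tau>M, 0) + (\<xi> \<bullet> normal_upper \<theta>M) *\<^sub>R normal_upper \<theta>M"
    using normal_decomposition[OF sc[of \<theta>M], of 1 "fst \<xi>"] \<xi>_fst
    by (simp add: \<tau>M_def face_param_def normal_upper_def)
  have \<xi>m: "\<xi> = (\<xi> \<bullet> (\<tau>m, 0)) *\<^sub>R (\<tau>m, 0) + (\<xi> \<bullet> normal_lower \<theta>m) *\<^sub>R normal_lower \<theta>m"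
    using normal_decomposition[OF sc[of \<theta>m], of "-1" "fst \<xi>"] \<xi>_fst
    by (simp add: \<tau>m_def face_param_def normal_lower_def)
  define qM where "qM = \<xi> \<bullet> normal_upper \<theta>M"
  define qm where "qm = \<xi> \<bullet> normal_lower \<theta>m"
  \<comment> \<open>The value at the edge that \<eta> v approaches, the same for both faces.\<close>
  define c1 where "c1 = \<eta> (0, 0) * V ?p"

  have key: "\<bar>qM - qm\<bar> * cmod c1 \<le> (\<bar>qM\<bar> + \<bar>qm\<bar>) * ((\<bar>CM\<bar> + \<bar>Cm\<bar> + cmod (V ?p)) * \<epsilon>) \<and> cmod (U ?p) \<le> \<epsilon>" if \<epsilon>: "0 < \<epsilon>" for \<epsilon>
  proof -
    obtain \<delta>1 where \<delta>1: "0 < \<delta>1" "\<And>x. x \<in> ?D \<Longrightarrow> dist x ?p < \<delta>1 \<Longrightarrow> cmod (V x - V ?p) \<le> \<epsilon>"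
      using V(1) \<epsilon> unfolding continuous_on_iff dist_norm[of "V _"] by (metis insertI1 insertI2 less_imp_le)
    obtain \<delta>2 where \<delta>2: "0 < \<delta>2" "\<And>x. x \<in> ?D \<Longrightarrow> dist x ?p < \<delta>2 \<Longrightarrow> cmod (U x - U ?p) \<le> \<epsilon>"
      using U(1) \<epsilon> unfolding continuous_on_iff dist_norm[of "U _"] by (metis insertI1 insertI2 less_imp_le)
    \<comment> \<open>The kernels do not shrink along the edge. Their fixed half-width \<delta>
      there is below both continuity radii, so the shrinking transversal part still fits, and keeps
      them between the heights -M and M.\<close>
    define \<delta> where "\<delta> = min (min \<delta>1 \<delta>2) (M - \<bar>x3c\<bar>) / 2"
    have \<delta>: "0 < \<delta>" "\<delta> < \<delta>1" "\<delta> < \<delta>2" "\<delta> < M - \<bar>x3c\<bar>"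
      using \<delta>1(1) \<delta>2(1) x3c by (auto simp: \<delta>_def abs_if min_def)
    from bump_exists[OF s(1), of "c0 * e $ 1"]
    obtain k1 :: "real \<Rightarrow> real" where "smooth k1 \<and> (\<forall>x. 0 \<le> k1 x) \<and> (\<forall>x. k1 x \<le> 1) \<and> (\<forall>x. k1 x \<noteq> 0 \<longrightarrow> \<bar>x - c0 * e $ 1\<bar> \<le> s)
      \<and> integrable lborel k1 \<and> 0 < integral\<^sup>L lborel k1" ..
    then have k1: "smooth k1" "0 \<le> k1 x" "k1 x \<le> 1" "k1 x \<noteq> 0 \<Longrightarrow> \<bar>x - c0 * e $ 1\<bar> \<le> s"
      "integrable lborel k1" "0 < integral\<^sup>L lborel k1" for x by blast+
    from bump_exists[OF s(1), of "c0 * e $ 2"]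
    obtain k2 :: "real \<Rightarrow> real" where "smooth k2 \<and> (\<forall>x. 0 \<le> k2 x) \<and> (\<forall>x. k2 x \<le> 1) \<and> (\<forall>x. k2 x \<noteq> 0 \<longrightarrow> \<bar>x - c0 * e $ 2\<bar> \<le> s)
      \<and> integrable lborel k2 \<and> 0 < integral\<^sup>L lborel k2" ..
    then have k2: "smooth k2" "0 \<le> k2 x" "k2 x \<le> 1" "k2 x \<noteq> 0 \<Longrightarrow> \<bar>x - c0 * e $ 2\<bar> \<le> s"
      "integrable lborel k2" "0 < integral\<^sup>L lborel k2" for x by blast+
    from bump_exists[OF \<delta>(1), of "x3c"]
    obtain k3 :: "real \<Rightarrow> real" where "smooth k3 \<and> (\<forall>x. 0 \<le> k3 x) \<and> (\<forall>x. k3 x \<le> 1) \<and> (\<forall>x. k3 x \<noteq> 0 \<longrightarrow> \<bar>x - x3c\<bar> \<le> \<delta>)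
      \<and> integrable lborel k3 \<and> 0 < integral\<^sup>L lborel k3" ..
    then have k3: "smooth k3" "0 \<le> k3 x" "k3 x \<le> 1" "k3 x \<noteq> 0 \<Longrightarrow> \<bar>x - x3c\<bar> \<le> \<delta>"
      "integrable lborel k3" "0 < integral\<^sup>L lborel k3" for x by blast+
    define K where "K n = tensor (rescale 1 (?r n) 0 k1) (rescale 1 (?r n) 0 k2) k3" for n
    define Q where "Q n = {x :: space. \<bar>fst x $ 1 - ?r n * (c0 * e $ 1)\<bar> \<le> ?r n * s \<and> \<bar>fst x $ 2 - ?r n * (c0 * e $ 2)\<bar> \<le> ?r n * s \<and> \<bar>snd x - x3c\<bar> \<le> \<delta>}" for n
    have r: "0 < ?r n" for n by simp
    have Ksm: "smooth (K n)" for n unfolding K_def by (intro smooth_tensor smooth_rescale k1 k2 k3)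
    have K01: "0 \<le> K n x" "K n x \<le> 1" for n x
      unfolding K_def tensor_def rescale_def using k1(2,3) k2(2,3) k3(2,3) by (auto intro!: mult_le_one mult_nonneg_nonneg)
    have KQ: "x \<in> Q n" if "K n x \<noteq> 0" for n x
    proof -
      have nz: "k1 (fst x $ 1 / ?r n) \<noteq> 0" "k2 (fst x $ 2 / ?r n) \<noteq> 0" "k3 (snd x) \<noteq> 0"
        using that by (auto simp: K_def tensor_def rescale_def)
      have "\<bar>y - \<rho> * z\<bar> \<le> \<rho> * s" if "\<bar>y / \<rho> - z\<bar> \<le> s" "0 < \<rho>" for y z \<rho> :: real
      proof -
        have "y - \<rho> * z = \<rho> * (y / \<rho> - z)" using that(2) by (simp add: right_diff_distrib)
        then show ?thesis using that by (simp add: abs_mult)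
      qed
      from this[OF k1(4)[OF nz(1)] r] this[OF k2(4)[OF nz(2)] r] k3(4)[OF nz(3)] show ?thesis by (simp add: Q_def)
    qed
    have Qc: "compact (Q n)" for n
    proof -
      have "Q n = cbox (vector [?r n * (c0 * e $ 1) - ?r n * s, ?r n * (c0 * e $ 2) - ?r n * s], x3c - \<delta>)
          (vector [?r n * (c0 * e $ 1) + ?r n * s, ?r n * (c0 * e $ 2) + ?r n * s], x3c + \<delta>)"
        by (auto simp: Q_def cbox_Pair_eq mem_box_cart forall_2 abs_le_iff)
      then show ?thesis by simp
    qed
    have Qs: "Q n \<subseteq> slab \<tau>M dM M (A * ?r n) (B * ?r n)" "Q n \<subseteq> slab \<tau>m dm M (A * ?r n) (B * ?r n)" for n
    proof -
      have rs: "?r n * s \<le> ?r n * sM" "?r n * s \<le> ?r n * sm" using s by (auto intro!: mult_left_mono)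
      have "(fst x, snd x) \<in> slab \<tau>M dM M (A * ?r n) (B * ?r n) \<and> (fst x, snd x) \<in> slab \<tau>m dm M (A * ?r n) (B * ?r n)"
        if "x \<in> Q n" for x
      proof -
        have x: "\<bar>fst x $ 1 - ?r n * (c0 * e $ 1)\<bar> \<le> ?r n * s" "\<bar>fst x $ 2 - ?r n * (c0 * e $ 2)\<bar> \<le> ?r n * s" "\<bar>snd x - x3c\<bar> \<le> \<delta>"
          using that by (auto simp: Q_def)
        have "snd x \<in> {-M<..<M}" using x(3) \<delta>(4) by (auto simp: abs_if split: if_splits)
        then show ?thesis
          using sM(2)[OF r order_trans[OF x(1) rs(1)] order_trans[OF x(2) rs(1)]]
            sm(2)[OF r order_trans[OF x(1) rs(2)] order_trans[OF x(2) rs(2)]] by blast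
      qed
      then show "Q n \<subseteq> slab \<tau>M dM M (A * ?r n) (B * ?r n)" "Q n \<subseteq> slab \<tau>m dm M (A * ?r n) (B * ?r n)"
        by (simp_all only: prod.collapse subset_iff) blast+
    qed
    have KtM: "test_function (slab \<tau>M dM M (A * ?r n) (B * ?r n)) (K n)" for n
      by (rule test_functionI[OF Ksm KQ Qc Qs(1)])
    have Ktm: "test_function (slab \<tau>m dm M (A * ?r n) (B * ?r n)) (K n)" for n
      by (rule test_functionI[OF Ksm KQ Qc Qs(2)])
    have Qd: "dist x ?p \<le> ?r n * (2 * c0 + 2 * s) + \<delta>" if "x \<in> Q n" for n x
    proof -
      have ei: "\<bar>e $ 1\<bar> \<le> 1" "\<bar>e $ 2\<bar> \<le> 1" using component_le_norm_cart[of e] ne(1) by auto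
      have "\<bar>y\<bar> \<le> ?r n * (c0 + s)" if "\<bar>y - ?r n * (c0 * z)\<bar> \<le> ?r n * s" "\<bar>z\<bar> \<le> 1" for y z
      proof -
        have "\<bar>?r n * (c0 * z)\<bar> \<le> ?r n * (c0 * 1)"
          unfolding abs_mult using that(2) c0(1) by (intro mult_mono) auto
        then show ?thesis using that(1) by (simp add: distrib_left)
      qed
      from this[OF _ ei(1), of "fst x $ 1"] this[OF _ ei(2), of "fst x $ 2"]
      have "\<bar>fst x $ 1\<bar> \<le> ?r n * (c0 + s)" "\<bar>fst x $ 2\<bar> \<le> ?r n * (c0 + s)"
        using \<open>x \<in> Q n\<close> unfolding Q_def by blast+
      then have "norm (fst x) \<le> ?r n * (c0 + s) + ?r n * (c0 + s)"
        using norm_vec2_le[of "fst x"] by linarith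
      moreover have "dist x ?p \<le> norm (fst x) + \<bar>snd x - x3c\<bar>"
        using sqrt_sum_squares_le_sum_abs[of "norm (fst x)" "dist (snd x) x3c"] by (cases x) (simp add: dist_Pair_Pair dist_real_def)
      ultimately show ?thesis using \<open>x \<in> Q n\<close> by (simp add: Q_def algebra_simps)
    qed
    have QD: "Q n \<subseteq> ?D" for n
    proof -
      have "slab \<tau>M dM M (A * ?r n) (B * ?r n) \<subseteq> slab \<tau>M dM M A B"
        by (intro slab_mono scale_Suc_le) (use slM(2,4) in auto)
      then show ?thesis using Qs(1) slM(5) by blast
    qed
    have near: "\<forall>\<^sub>F n in sequentially. \<forall>x\<in>Q n. dist x ?p < \<delta>1 \<and> dist x ?p < \<delta>2"
    proof -
      have "(\<lambda>n. (2 * c0 + 2 * s) * ?r n) \<longlonglongrightarrow> 0" by (rule tendsto_inverse_Suc)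
      then have "\<forall>\<^sub>F n in sequentially. (2 * c0 + 2 * s) * ?r n < min (\<delta>1 - \<delta>) (\<delta>2 - \<delta>)"
        using \<delta> by (intro order_tendstoD(2)) auto
      then show ?thesis
      proof eventually_elim
        case (elim n)
        show ?case using elim Qd[of _ n] by (force simp: mult.commute[of "2 * c0 + 2 * s"])
      qed
    qed
    \<comment> \<open>\<eta> is close to its edge value by its Hoelder bound and v by continuity of
      V; the statement is generic in the face.\<close>
    have close: "\<forall>\<^sub>F n in sequentially. AE x in ?N. K n x \<noteq> 0 \<longrightarrow>
        cmod (trace_pullback \<tau> h M \<eta> (coord1 \<tau> d x, snd x) * v x - c1) \<le> (\<bar>C'\<bar> + cmod (V ?p)) * \<epsilon>"
      if C': "\<And>z. cmod (trace_pullback \<tau> h M \<eta> z) \<le> C'"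
        and H: "\<And>a t. (a, t) \<in> {0<..<h} \<times> {-M<..<M} \<Longrightarrow> cmod (trace_pullback \<tau> h M \<eta> (a, t) - \<eta> (0, 0)) \<le> H * a powr \<alpha>"
        and Qs: "\<And>n. Q n \<subseteq> slab \<tau> d M (A * ?r n) (B * ?r n)" for \<tau> d C' H
    proof -
      have "(\<lambda>n. (A * ?r n) powr \<alpha>) \<longlonglongrightarrow> 0"
        using \<alpha>(1) slM(2) by (intro tendsto_zero_powrI[OF tendsto_inverse_Suc tendsto_const]) auto
      then have "(\<lambda>n. \<bar>H\<bar> * (A * ?r n) powr \<alpha>) \<longlonglongrightarrow> \<bar>H\<bar> * 0" by (intro tendsto_mult_left)
      then have "\<forall>\<^sub>F n in sequentially. \<bar>H\<bar> * (A * ?r n) powr \<alpha> < \<epsilon>" using \<epsilon> by (intro order_tendstoD(2)) auto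
      with near show ?thesis
      proof eventually_elim
        case (elim n)
        show ?case using V(2)
        proof (rule AE_mp, intro AE_I2 impI)
          fix x assume x: "x \<in> space ?N" "v x = V x" "K n x \<noteq> 0"
          have xQ: "x \<in> Q n" by (rule KQ[OF x(3)])
          have a: "0 < coord1 \<tau> d x" "coord1 \<tau> d x < A * ?r n" "snd x \<in> {-M<..<M}" using Qs xQ by (auto simp: slab_def)
          have Ah: "A * ?r n \<le> h" using order_trans[OF scale_Suc_le slM(3)] slM(2) by simp
          let ?g = "trace_pullback \<tau> h M \<eta> (coord1 \<tau> d x, snd x)"
          have "cmod (?g - \<eta> (0, 0)) \<le> H * coord1 \<tau> d x powr \<alpha>"
            using a Ah by (intro H) auto
          also have "\<dots> \<le> \<bar>H\<bar> * (A * ?r n) powr \<alpha>"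
            using a \<alpha> by (intro mult_mono powr_mono2) auto
          finally have g: "cmod (?g - \<eta> (0, 0)) \<le> \<epsilon>" using elim(2) by simp
          have Vx: "cmod (V x - V ?p) \<le> \<epsilon>" using \<delta>1(2) elim(1) xQ x(1) by simp
          have "?g * v x - c1 = ?g * (V x - V ?p) + (?g - \<eta> (0, 0)) * V ?p"
            using x(2) by (simp add: c1_def algebra_simps)
          also have "cmod \<dots> \<le> \<bar>C'\<bar> * \<epsilon> + \<epsilon> * cmod (V ?p)"
            using C' g Vx \<epsilon> by (intro norm_triangle_le add_mono) (auto simp: norm_mult intro!: mult_mono order_trans[OF C' abs_ge_self])
          finally show "cmod (?g * v x - c1) \<le> (\<bar>C'\<bar> + cmod (V ?p)) * \<epsilon>" by (simp add: algebra_simps)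
        qed
      qed
    qed
    define I where "I = integral\<^sup>L lborel k1 * integral\<^sup>L lborel k2 * integral\<^sup>L lborel k3"
    have I: "0 < I" using k1(6) k2(6) k3(6) by (simp add: I_def)
    have KI: "(\<integral>x. K n x \<partial>?N) = (?r n)\<^sup>2 * I" for n
    proof -
      \<comment> \<open>The support lies in the region, so the integral may be taken over the whole
        space, where it factorizes.\<close>
      have "(\<integral>x. K n x \<partial>?N) = (\<integral>x. K n x \<partial>lebesgue_on UNIV)"
        by (rule integral_lebesgue_on_subset[OF Dm(1) _ subset_UNIV]) (simp, use KQ QD in blast)
      also have "\<dots> = integral\<^sup>L lborel (K n)"
        unfolding lebesgue_on_UNIV_eq
        by (intro integral_completion) (simp add: borel_measurable_continuous_onI smooth_continuous_on Ksm)
      also have "\<dots> = (?r n)\<^sup>2 * I"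
        unfolding K_def I_def by (rule integral_rescaled_tensor[OF k1(5) k2(5) k3(5) r])
      finally show ?thesis .
    qed
    let ?X = "\<lambda>n. \<integral>x. dir_deriv \<xi> (K n) x *\<^sub>R (v x - w x) \<partial>?N"
    have est: "\<bar>qM - qm\<bar> * cmod c1 * I \<le> (\<bar>qM\<bar> * ((\<bar>CM\<bar> + cmod (V ?p)) * \<epsilon>) + \<bar>qm\<bar> * ((\<bar>Cm\<bar> + cmod (V ?p)) * \<epsilon>)) * I + 2 * \<epsilon>'"
      if \<epsilon>': "0 < \<epsilon>'" for \<epsilon>'
    proof -
      have eM: "\<forall>\<^sub>F n in sequentially. cmod (?X n - of_real (qM * (\<integral>x. K n x \<partial>?N)) * c1)
          \<le> \<bar>qM\<bar> * ((\<bar>CM\<bar> + cmod (V ?p)) * \<epsilon>) * (\<integral>x. K n x \<partial>?N) + \<epsilon>' * (?r n)\<^sup>2"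
        unfolding qM_def
        by (rule up.conductive_face_estimate(1)[folded \<tau>M_def, OF D slM(1) bc_upper \<eta>m(1) CM(1) slM(5,2,3,4) KtM K01 \<xi>M
              close[OF CM Qs(1)] \<epsilon>'])
      have em: "\<forall>\<^sub>F n in sequentially. cmod (?X n - of_real (qm * (\<integral>x. K n x \<partial>?N)) * c1)
          \<le> \<bar>qm\<bar> * ((\<bar>Cm\<bar> + cmod (V ?p)) * \<epsilon>) * (\<integral>x. K n x \<partial>?N) + \<epsilon>' * (?r n)\<^sup>2"
        unfolding qm_def
        by (rule lo.conductive_face_estimate(1)[folded \<tau>m_def, OF D slm(1) bc_lower \<eta>m(2) Cm(1) slm(5,2,3,4) Ktm K01 \<xi>m
              close[OF Cm Qs(2)] \<epsilon>'])
      have "\<exists>n. cmod (?X n - of_real (qM * (\<integral>x. K n x \<partial>?N)) * c1)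
          \<le> \<bar>qM\<bar> * ((\<bar>CM\<bar> + cmod (V ?p)) * \<epsilon>) * (\<integral>x. K n x \<partial>?N) + \<epsilon>' * (?r n)\<^sup>2 \<and>
        cmod (?X n - of_real (qm * (\<integral>x. K n x \<partial>?N)) * c1)
          \<le> \<bar>qm\<bar> * ((\<bar>Cm\<bar> + cmod (V ?p)) * \<epsilon>) * (\<integral>x. K n x \<partial>?N) + \<epsilon>' * (?r n)\<^sup>2"
        using eventually_happens'[OF _ eventually_conj[OF eM em]] by simp
      then obtain n where n: "cmod (?X n - of_real (qM * ((?r n)\<^sup>2 * I)) * c1)
          \<le> \<bar>qM\<bar> * ((\<bar>CM\<bar> + cmod (V ?p)) * \<epsilon>) * ((?r n)\<^sup>2 * I) + \<epsilon>' * (?r n)\<^sup>2"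
        "cmod (?X n - of_real (qm * ((?r n)\<^sup>2 * I)) * c1)
          \<le> \<bar>qm\<bar> * ((\<bar>Cm\<bar> + cmod (V ?p)) * \<epsilon>) * ((?r n)\<^sup>2 * I) + \<epsilon>' * (?r n)\<^sup>2"
        unfolding KI by blast
      \<comment> \<open>The integral \<open>?X n\<close> contains no face data, so it cancels
        between the two estimates. What remains is the difference of the two normal components times
        c1.\<close>
      have "(?X n - of_real (qm * ((?r n)\<^sup>2 * I)) * c1) - (?X n - of_real (qM * ((?r n)\<^sup>2 * I)) * c1)
          = of_real ((qM - qm) * ((?r n)\<^sup>2 * I)) * c1"
        by (simp add: algebra_simps)
      then have "(?r n)\<^sup>2 * (\<bar>qM - qm\<bar> * cmod c1 * I) = cmod ((?X n - of_real (qm * ((?r n)\<^sup>2 * I)) * c1) - (?X n - of_real (qM * ((?r n)\<^sup>2 * I)) * c1))"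
        using I by (simp only: norm_mult norm_of_real) (simp add: abs_mult)
      also have "\<dots> \<le> (\<bar>qm\<bar> * ((\<bar>Cm\<bar> + cmod (V ?p)) * \<epsilon>) * ((?r n)\<^sup>2 * I) + \<epsilon>' * (?r n)\<^sup>2) + (\<bar>qM\<bar> * ((\<bar>CM\<bar> + cmod (V ?p)) * \<epsilon>) * ((?r n)\<^sup>2 * I) + \<epsilon>' * (?r n)\<^sup>2)"
        by (intro norm_triangle_le_diff add_mono n)
      also have "\<dots> = (?r n)\<^sup>2 * ((\<bar>qM\<bar> * ((\<bar>CM\<bar> + cmod (V ?p)) * \<epsilon>) + \<bar>qm\<bar> * ((\<bar>Cm\<bar> + cmod (V ?p)) * \<epsilon>)) * I + 2 * \<epsilon>')"
        by (simp add: algebra_simps)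
      finally show ?thesis by (rule mult_left_le_imp_le) (use r in simp)
    qed
    have "\<bar>qM - qm\<bar> * cmod c1 * I \<le> (\<bar>qM\<bar> * ((\<bar>CM\<bar> + cmod (V ?p)) * \<epsilon>) + \<bar>qm\<bar> * ((\<bar>Cm\<bar> + cmod (V ?p)) * \<epsilon>)) * I"
      by (rule field_le_epsilon) (use est[of "_ / 2"] in simp)
    then have "\<bar>qM - qm\<bar> * cmod c1 \<le> \<bar>qM\<bar> * ((\<bar>CM\<bar> + cmod (V ?p)) * \<epsilon>) + \<bar>qm\<bar> * ((\<bar>Cm\<bar> + cmod (V ?p)) * \<epsilon>)"
      using I by (rule mult_right_le_imp_le)
    also have "\<dots> \<le> \<bar>qM\<bar> * ((\<bar>CM\<bar> + \<bar>Cm\<bar> + cmod (V ?p)) * \<epsilon>) + \<bar>qm\<bar> * ((\<bar>CM\<bar> + \<bar>Cm\<bar> + cmod (V ?p)) * \<epsilon>)"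
      using \<epsilon> by (intro add_mono mult_left_mono mult_right_mono) auto
    finally have first: "\<bar>qM - qm\<bar> * cmod c1 \<le> (\<bar>qM\<bar> + \<bar>qm\<bar>) * ((\<bar>CM\<bar> + \<bar>Cm\<bar> + cmod (V ?p)) * \<epsilon>)"
      by (simp add: distrib_right)

    have Ulim: "(\<lambda>n. (real (Suc n))\<^sup>2 * cmod (\<integral>x. of_real (K n x) * (v x - w x) \<partial>?N)) \<longlonglongrightarrow> 0"
      by (rule up.conductive_face_estimate(2)[folded \<tau>M_def, OF D slM(1) bc_upper \<eta>m(1) CM(1) slM(5,2,3,4) KtM K01 \<xi>M
            close[OF CM Qs(1)] \<epsilon>])
    have "cmod (U ?p) * I \<le> \<epsilon> * I + \<epsilon>'" if \<epsilon>': "0 < \<epsilon>'" for \<epsilon>'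
    proof -
      have "\<forall>\<^sub>F n in sequentially. (real (Suc n))\<^sup>2 * cmod (\<integral>x. of_real (K n x) * (v x - w x) \<partial>?N) < \<epsilon>'"
        by (rule order_tendstoD(2)[OF Ulim \<epsilon>'])
      from eventually_happens'[OF _ eventually_conj[OF this near]] obtain n where
        n: "(real (Suc n))\<^sup>2 * cmod (\<integral>x. of_real (K n x) * (v x - w x) \<partial>?N) < \<epsilon>'" "\<forall>x\<in>Q n. dist x ?p < \<delta>1 \<and> dist x ?p < \<delta>2"
        by auto
      have uL: "(\<lambda>x. v x - w x) \<in> L2 ?N" using diff_H2 by (simp add: numeral_2_eq_2)
      have Kb: "K n \<in> borel_measurable borel" by (intro borel_measurable_continuous_onI smooth_continuous_on Ksm)
      interpret finite_measure ?N by (rule finite_measure_lebesgue_on_open[OF D])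
      have iu: "integrable ?N (\<lambda>x. of_real (K n x) * (v x - w x))"
        using test_function_integrable[OF D KtM uL] by (simp add: scaleR_conv_of_real)
      have iK: "integrable ?N (K n)"
        using K01 borel_measurable_lebesgue_on[OF Kb] by (intro integrable_const_bound[where B = 1]) auto
      \<comment> \<open>The kernel average of v - w is within \<epsilon> of \<open>U ?p\<close> by
        continuity, and it tends to 0 by \<open>Ulim\<close>.\<close>
      have "cmod (of_real ((?r n)\<^sup>2 * I) * U ?p - (\<integral>x. of_real (K n x) * (v x - w x) \<partial>?N)) = cmod (\<integral>x. of_real (K n x) * U ?p - of_real (K n x) * (v x - w x) \<partial>?N)"
        using iu iK KI[of n] by simp
      also have "\<dots> \<le> (\<integral>x. \<epsilon> * K n x \<partial>?N)"
      proof (rule order_trans[OF integral_norm_bound integral_mono_AE])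
        show "integrable ?N (\<lambda>x. cmod (of_real (K n x) * U ?p - of_real (K n x) * (v x - w x)))"
          using iu iK by simp
        show "integrable ?N (\<lambda>x. \<epsilon> * K n x)" using iK by simp
        show "AE x in ?N. cmod (of_real (K n x) * U ?p - of_real (K n x) * (v x - w x)) \<le> \<epsilon> * K n x"
          using U(2)
        proof (rule AE_mp, intro AE_I2 impI)
          fix x assume x: "x \<in> space ?N" "v x - w x = U x"
          have "of_real (K n x) * U ?p - of_real (K n x) * (v x - w x) = of_real (K n x) * (U ?p - U x)"
            unfolding x(2) by (simp add: right_diff_distrib)
          then have "cmod (of_real (K n x) * U ?p - of_real (K n x) * (v x - w x)) = K n x * cmod (U x - U ?p)"
            using K01(1)[of n x] by (simp only: norm_mult norm_of_real abs_of_nonneg norm_minus_commute)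
          also have "\<dots> \<le> K n x * \<epsilon>"
          proof (cases "K n x = 0")
            case False
            then have "cmod (U x - U ?p) \<le> \<epsilon>" using \<delta>2(2) n(2) KQ x(1) by simp
            then show ?thesis using K01(1) by (intro mult_left_mono) auto
          qed simp
          finally show "cmod (of_real (K n x) * U ?p - of_real (K n x) * (v x - w x)) \<le> \<epsilon> * K n x" by (simp add: mult.commute)
        qed
      qed
      also have "\<dots> = (?r n)\<^sup>2 * (\<epsilon> * I)" using KI[of n] by simp
      finally have 1: "cmod (of_real ((?r n)\<^sup>2 * I) * U ?p - (\<integral>x. of_real (K n x) * (v x - w x) \<partial>?N)) \<le> (?r n)\<^sup>2 * (\<epsilon> * I)" .
      have 2: "cmod (\<integral>x. of_real (K n x) * (v x - w x) \<partial>?N) \<le> (?r n)\<^sup>2 * \<epsilon>'"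
        using n(1) by (simp only: power_inverse) (simp add: inverse_eq_divide pos_le_divide_eq mult.commute)
      have "(?r n)\<^sup>2 * (cmod (U ?p) * I) = cmod (of_real ((?r n)\<^sup>2 * I) * U ?p)"
        using I by (simp only: norm_mult norm_of_real) (simp add: abs_mult)
      also have "\<dots> \<le> (?r n)\<^sup>2 * \<epsilon>' + (?r n)\<^sup>2 * (\<epsilon> * I)"
        using 1 2 norm_triangle_sub[of "of_real ((?r n)\<^sup>2 * I) * U ?p" "\<integral>x. of_real (K n x) * (v x - w x) \<partial>?N"] by linarith
      also have "\<dots> = (?r n)\<^sup>2 * (\<epsilon> * I + \<epsilon>')" by (simp add: distrib_left)
      finally show ?thesis by (rule mult_left_le_imp_le) (use r in simp)
    qed
    then have "cmod (U ?p) * I \<le> \<epsilon> * I" by (rule field_le_epsilon)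
    then have "cmod (U ?p) \<le> \<epsilon>" using I by (rule mult_right_le_imp_le)
    with first show ?thesis by blast
  qed
  have Up: "U ?p = 0"
    using field_le_epsilon[of "cmod (U ?p)" 0] key by simp
  have "\<bar>qM - qm\<bar> * cmod c1 \<le> 0"
  proof (rule field_le_epsilon)
    fix \<epsilon> :: real assume \<epsilon>: "0 < \<epsilon>"
    define m where "m = (\<bar>qM\<bar> + \<bar>qm\<bar>) * (\<bar>CM\<bar> + \<bar>Cm\<bar> + cmod (V ?p))"
    have m: "0 \<le> m" by (simp add: m_def)
    \<comment> \<open>Rescaling \<epsilon> by m + 1 instead of m avoids a division by 0.\<close>
    have "\<bar>qM - qm\<bar> * cmod c1 \<le> m * (\<epsilon> / (m + 1))"
      using conjunct1[OF key, of "\<epsilon> / (m + 1)"] \<epsilon> m unfolding m_def[symmetric] mult.assoc[symmetric] by simp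
    also have "\<dots> \<le> \<epsilon>" using \<epsilon> m by (simp add: field_simps)
    finally show "\<bar>qM - qm\<bar> * cmod c1 \<le> 0 + \<epsilon>" by simp
  qed
  moreover have "qM - qm \<noteq> 0"
  proof
    assume "qM - qm = 0"
    then have "\<xi> \<bullet> \<xi> = 0" by (simp add: qM_def qm_def \<xi>_def inner_diff_right)
    then have "normal_upper \<theta>M = normal_lower \<theta>m" by (simp add: \<xi>_def)
    then have s: "sin \<theta>M = - sin \<theta>m" "cos \<theta>M = - cos \<theta>m"
      by (simp_all add: normal_upper_def normal_lower_def vec_eq_iff forall_2)
    have "cos (\<theta>M - \<theta>m) = - ((cos \<theta>m)\<^sup>2 + (sin \<theta>m)\<^sup>2)"
      unfolding cos_diff s power2_eq_square by (simp only: mult_minus_left minus_add_distrib)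
    then have "cos (\<theta>M - \<theta>m) = -1" by (simp add: sc del: cos_diff)
    moreover have "0 < \<theta>M - \<theta>m" "\<theta>M - \<theta>m < 2 * pi" using angles by auto
    ultimately have "\<theta>M - \<theta>m = pi" by (rule eq_pi_if_cos_eq_minus_one)
    then show False using angle_ne_pi by simp
  qed
  ultimately have "c1 = 0" by (auto simp: mult_le_0_iff)
  then have Vp: "V ?p = 0" using \<eta>_edge by (simp add: c1_def)
  \<comment> \<open>w is only known to be in \<open>H1\<close>; its continuous representative is
    that of v minus that of v - w.\<close>
  have "continuous_on (insert ?p ?D) (\<lambda>x. V x - U x)" by (intro continuous_on_diff V U)
  moreover have "AE x in ?N. w x = V x - U x" using V(2) U(2) by eventually_elim (simp add: algebra_simps)
  ultimately show ?thesis
    unfolding vanishes_at_def using V Vp Up by (intro conjI exI[of _ V] exI[of _ "\<lambda>x. V x - U x"]) auto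
qed

end
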